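(* Let $\Sigma$ be a minimal surface (without boundary) in $\mathbb E^n$. Suppose that the unit ball $\mathbb B^n$ splits $\Sigma$ into two pieces $E\Sigma=\Sigma\cap(\mathbb E^n\setminus\mathring{\mathbb B}^n)$ and $I\Sigma=\Sigma\cap\mathbb B^n$ which are, respectively, an exterior free boundary minimal surface (in $\mathbb E^n\setminus\mathring{\mathbb B}^n$) and a free boundary minimal surface in $\mathbb B^n$, with common boundary $\Sigma\cap\partial\mathbb B^n$. Then $$\mathrm{Ind}(I\Sigma)+\mathrm{Ind}(E\Sigma)\ge\mathrm{Ind}(\Sigma).$$
   Context: $\mathbb E^n$ is Euclidean $n$-space; $\mathbb B^n$, $\mathring{\mathbb B}^n$ are the closed and open unit balls centered at the origin. Minimal surfaces are immersed (the surface is identified with its image; intersections are understood as preimages under the immersion). A free boundary minimal surface in $M=\mathbb B^n$ or $M=\mathbb E^n\setminus\mathring{\mathbb B}^n$ (in the latter case called exterior) is an immersed surface with zero mean curvature whose boundary is exactly its intersection with $\partial M$ and which meets $\partial M$ orthogonally. Let $N\Sigma$ be the normal bundle with normal connection $\nabla^\bot$, $b_{ij}=(\nabla_{e_i}e_j)^\bot$ the second fundamental form in a local orthonormal tangent frame, and $\mathcal B(X)=\sum_{i,j}\langle b_{ij},X\rangle b_{ij}$. The second variation of area on $X\in\Gamma(N\Sigma)$ is $$\delta^2A(X)=\int_\Sigma(|\nabla^\bot X|^2-\langle\mathcal B(X),X\rangle)\,dA+\varepsilon\int_{\partial\Sigma}|X|^2\,dL,$$ where $\varepsilon=-1$ for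 free boundary minimal surfaces in $\mathbb B^n$, $\varepsilon=+1$ for exterior ones, and the boundary term is absent for surfaces without boundary. For a bounded (relatively compact) domain $\Omega\subset\Sigma$ (which may contain points of $\partial\Sigma$), $\mathrm{Ind}(\Omega)$ is the maximal dimension of a vector space of smooth sections of $N\Sigma$ supported in $\Omega$ on which $\delta^2A$ is negative definite; $\mathrm{Ind}(\Sigma)=\sup_\Omega\mathrm{Ind}(\Omega)$ over all bounded domains. *)

theory Defs
  imports "HOL-Analysis.Analysis" "HOL-Library.Function_Algebras"
begin

subsection \<open>Smooth maps\<close>

primrec Ck_on :: "nat \<Rightarrow> ('m::euclidean_space \<Rightarrow> 'b::real_normed_vector) \<Rightarrow> 'm set \<Rightarrow> bool" where
  "Ck_on 0 f U \<longleftrightarrow> continuous_on U f"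
| "Ck_on (Suc k) f U \<longleftrightarrow>
     (\<forall>x\<in>U. f differentiable (at x)) \<and> (\<forall>v. Ck_on k (\<lambda>x. frechet_derivative f (at x) v) U)"

text \<open>Smoothness on a set that need not be open (a relatively open subset of a half-plane):
  local existence of smooth extensions.\<close>

definition smooth_on :: "'m::euclidean_space set \<Rightarrow> ('m \<Rightarrow> 'b::real_normed_vector) \<Rightarrow> bool" where
  "smooth_on S f \<longleftrightarrow>
     (\<forall>x\<in>S. \<exists>U g. open U \<and> x \<in> U \<and> (\<forall>k. Ck_on k g U) \<and> (\<forall>y\<in>S \<inter> U. g y = f y))"

text \<open>On a relatively open subset \<open>V\<close> of a half-plane or of the whole space the derivative within
  \<open>V\<close> is unique; at boundary points it is the derivative of any smooth extension.\<close>

abbreviation D :: "'m::euclidean_space set \<Rightarrow> ('m \<Rightarrow> 'b::real_normed_vector) \<Rightarrow> 'm \<Rightarrow> 'm \<Rightarrow> 'b" where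
  "D V f x \<equiv> frechet_derivative f (at x within V)"


subsection \<open>Immersed manifolds with boundary\<close>

text \<open>A manifold is given by an abstract topology \<open>X\<close> together with the immersion \<open>F\<close>, and is
  modelled on \<open>H\<close>: the whole space for manifolds without boundary, a half-space for manifolds with
  boundary. Local parametrizations (inverse charts) are the homeomorphisms \<open>\<phi>\<close> from relatively open
  subsets of \<open>H\<close> onto open subsets of \<open>X\<close> for which \<open>F \<circ> \<phi>\<close> is a smooth immersion. The transition
  maps between them are automatically smooth, because \<open>F \<circ> \<phi>\<close> is an immersion; so they
  constitute the maximal smooth atlas for which \<open>F\<close> is an immersion.\<close>

definition local_param ::
  "(real^'k) set \<Rightarrow> 'a topology \<Rightarrow> ('a \<Rightarrow> real^'n) \<Rightarrow> (real^'k) set \<Rightarrow> (real^'k \<Rightarrow> 'a) \<Rightarrow> bool" where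
  "local_param H X F V \<phi> \<longleftrightarrow>
     openin (top_of_set H) V \<and> openin X (\<phi> ` V) \<and>
     homeomorphic_map (top_of_set V) (subtopology X (\<phi> ` V)) \<phi> \<and>
     smooth_on V (F \<circ> \<phi>) \<and> (\<forall>x\<in>V. inj (D V (F \<circ> \<phi>) x))"

definition immersed :: "(real^'k) set \<Rightarrow> 'a topology \<Rightarrow> ('a \<Rightarrow> real^'n) \<Rightarrow> bool" where
  "immersed H X F \<longleftrightarrow>
     Hausdorff_space X \<and> second_countable X \<and>
     (\<forall>p\<in>topspace X. \<exists>V \<phi>. local_param H X F V \<phi> \<and> p \<in> \<phi> ` V)"

text \<open>The Riemannian measure of the metric induced by \<open>F\<close>, on the Borel sets of \<open>X\<close>: in every
  local parametrization its density is the square root of the Gram determinant. It is arc length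
  for \<open>'k = 1\<close> and area for \<open>'k = 2\<close>.\<close>

definition gram_det :: "(real^'k) set \<Rightarrow> (real^'k \<Rightarrow> real^'n) \<Rightarrow> real^'k \<Rightarrow> real" where
  "gram_det V f x = det (\<chi> i j. D V f x (axis i 1) \<bullet> D V f x (axis j 1))"

definition volume_measure :: "(real^'k) set \<Rightarrow> 'a topology \<Rightarrow> ('a \<Rightarrow> real^'n) \<Rightarrow> 'a measure" where
  "volume_measure H X F = (THE M.
     space M = topspace X \<and> sets M = sigma_sets (topspace X) {U. openin X U} \<and>
     (\<forall>V \<phi> A. local_param H X F V \<phi> \<and> A \<in> sets M \<and> A \<subseteq> \<phi> ` V \<longrightarrow>
        emeasure M A =
          (\<integral>\<^sup>+ x \<in> V \<inter> \<phi> -` A. ennreal (sqrt (gram_det V (F \<circ> \<phi>) x)) \<partial>lborel)))"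


subsection \<open>Immersed surfaces\<close>

definition half_plane :: "(real^2) set" where
  "half_plane = {x. 0 \<le> x $ 1}"

definition surface_boundary :: "'a topology \<Rightarrow> ('a \<Rightarrow> real^'n) \<Rightarrow> 'a set" where
  "surface_boundary X F =
     {p. \<exists>V \<phi>. local_param half_plane X F V \<phi> \<and> (\<exists>x\<in>V. x $ 1 = 0 \<and> \<phi> x = p)}"

definition area_measure :: "'a topology \<Rightarrow> ('a \<Rightarrow> real^'n) \<Rightarrow> 'a measure" where
  "area_measure X F = volume_measure half_plane X F"

text \<open>The boundary of a surface is an immersed curve without boundary.\<close>

definition boundary_length_measure :: "'a topology \<Rightarrow> ('a \<Rightarrow> real^'n) \<Rightarrow> 'a measure" where
  "boundary_length_measure X F =
     volume_measure (UNIV :: (real^1) set) (subtopology X (surface_boundary X F)) F"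

definition tangent_space :: "'a topology \<Rightarrow> ('a \<Rightarrow> real^'n) \<Rightarrow> 'a \<Rightarrow> (real^'n) set" where
  "tangent_space X F p =
     {w. \<exists>V \<phi> x v. local_param half_plane X F V \<phi> \<and> x \<in> V \<and> \<phi> x = p \<and> w = D V (F \<circ> \<phi>) x v}"

definition normal_space :: "'a topology \<Rightarrow> ('a \<Rightarrow> real^'n) \<Rightarrow> 'a \<Rightarrow> (real^'n) set" where
  "normal_space X F p = orthogonal_comp (tangent_space X F p)"

text \<open>The remaining local notions are written in a parametrization \<open>f = F \<circ> \<phi>\<close> with domain \<open>V\<close>,
  using an orthonormal tangent frame \<open>e i = Df (u i)\<close> that is given by its coordinate fields \<open>u i\<close>.
  The derivative of a map along \<open>e i\<close> at the point with coordinates \<open>x\<close> is the derivative of its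
  coordinate expression in direction \<open>u i x\<close>.\<close>

definition frame ::
  "(real^2) set \<Rightarrow> (real^2 \<Rightarrow> real^'n) \<Rightarrow> (2 \<Rightarrow> real^2 \<Rightarrow> real^2) \<Rightarrow> 2 \<Rightarrow> real^2 \<Rightarrow> real^'n" where
  "frame V f u i x = D V f x (u i x)"

definition framed_param ::
  "'a topology \<Rightarrow> ('a \<Rightarrow> real^'n) \<Rightarrow> (real^2) set \<Rightarrow> (real^2 \<Rightarrow> 'a) \<Rightarrow> (2 \<Rightarrow> real^2 \<Rightarrow> real^2) \<Rightarrow> bool"
  where
  "framed_param X F V \<phi> u \<longleftrightarrow>
     local_param half_plane X F V \<phi> \<and> (\<forall>i. smooth_on V (u i)) \<and>
     (\<forall>x\<in>V. \<forall>i j. frame V (F \<circ> \<phi>) u i x \<bullet> frame V (F \<circ> \<phi>) u j x = (if i = j then 1 else 0))"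

definition normal_part ::
  "(real^2) set \<Rightarrow> (real^2 \<Rightarrow> real^'n) \<Rightarrow> (2 \<Rightarrow> real^2 \<Rightarrow> real^2) \<Rightarrow> real^2 \<Rightarrow> real^'n \<Rightarrow> real^'n" where
  "normal_part V f u x w = w - (\<Sum>i\<in>UNIV. (w \<bullet> frame V f u i x) *\<^sub>R frame V f u i x)"

definition second_ff ::
  "(real^2) set \<Rightarrow> (real^2 \<Rightarrow> real^'n) \<Rightarrow> (2 \<Rightarrow> real^2 \<Rightarrow> real^2) \<Rightarrow> 2 \<Rightarrow> 2 \<Rightarrow> real^2 \<Rightarrow> real^'n" where
  "second_ff V f u i j x = normal_part V f u x (D V (frame V f u j) x (u i x))"

text \<open>\<open>normal_deriv V f u Y i x\<close> is the normal covariant derivative along \<open>e i\<close> of the normal field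
  with coordinate expression \<open>Y\<close>.\<close>

definition normal_deriv ::
  "(real^2) set \<Rightarrow> (real^2 \<Rightarrow> real^'n) \<Rightarrow> (2 \<Rightarrow> real^2 \<Rightarrow> real^2) \<Rightarrow> (real^2 \<Rightarrow> real^'n) \<Rightarrow>
     2 \<Rightarrow> real^2 \<Rightarrow> real^'n" where
  "normal_deriv V f u Y i x = normal_part V f u x (D V Y x (u i x))"

definition simons_op ::
  "(real^2) set \<Rightarrow> (real^2 \<Rightarrow> real^'n) \<Rightarrow> (2 \<Rightarrow> real^2 \<Rightarrow> real^2) \<Rightarrow> real^2 \<Rightarrow> real^'n \<Rightarrow> real^'n" where
  "simons_op V f u x w =
     (\<Sum>i\<in>UNIV. \<Sum>j\<in>UNIV. (second_ff V f u i j x \<bullet> w) *\<^sub>R second_ff V f u i j x)"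

definition minimal_surface :: "'a topology \<Rightarrow> ('a \<Rightarrow> real^'n) \<Rightarrow> bool" where
  "minimal_surface X F \<longleftrightarrow>
     immersed half_plane X F \<and>
     (\<forall>V \<phi> u. framed_param X F V \<phi> u \<longrightarrow> (\<forall>x\<in>V. (\<Sum>i\<in>UNIV. second_ff V (F \<circ> \<phi>) u i i x) = 0))"

text \<open>Used for \<open>M = cball 0 1\<close> and \<open>M = - ball 0 1\<close>, whose frontier is the unit sphere. The normal
  of the sphere at \<open>F p\<close> is spanned by \<open>F p\<close>, so the surface meets the sphere orthogonally at \<open>p\<close>
  iff \<open>F p\<close> is tangent to the surface.\<close>

definition free_boundary_minimal_surface ::
  "(real^'n) set \<Rightarrow> 'a topology \<Rightarrow> ('a \<Rightarrow> real^'n) \<Rightarrow> bool" where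
  "free_boundary_minimal_surface M X F \<longleftrightarrow>
     minimal_surface X F \<and> F ` topspace X \<subseteq> M \<and>
     surface_boundary X F = {p \<in> topspace X. F p \<in> frontier M} \<and>
     (\<forall>p\<in>surface_boundary X F. F p \<in> tangent_space X F p)"


subsection \<open>Second variation and index\<close>

text \<open>The value at \<open>p\<close> of the interior integrand does not depend on the chosen framed
  parametrization.\<close>

definition variation_density :: "'a topology \<Rightarrow> ('a \<Rightarrow> real^'n) \<Rightarrow> ('a \<Rightarrow> real^'n) \<Rightarrow> 'a \<Rightarrow> real" where
  "variation_density X F Y p =
     (let (V, \<phi>, u) = (SOME (V, \<phi>, u). framed_param X F V \<phi> u \<and> p \<in> \<phi> ` V);
          x = inv_into V \<phi> p
      in (\<Sum>i\<in>UNIV. (norm (normal_deriv V (F \<circ> \<phi>) u (Y \<circ> \<phi>) i x))\<^sup>2)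
         - simons_op V (F \<circ> \<phi>) u x (Y p) \<bullet> Y p)"

text \<open>The coefficient \<open>\<epsilon>\<close> of the boundary term is \<open>-1\<close> for free boundary minimal surfaces in the
  unit ball, \<open>1\<close> for exterior ones, and \<open>0\<close> (no boundary term) for surfaces without boundary.\<close>

definition second_variation ::
  "real \<Rightarrow> 'a topology \<Rightarrow> ('a \<Rightarrow> real^'n) \<Rightarrow> ('a \<Rightarrow> real^'n) \<Rightarrow> real" where
  "second_variation \<epsilon> X F Y =
     (\<integral>p. variation_density X F Y p \<partial>area_measure X F)
     + \<epsilon> * (\<integral>p. (norm (Y p))\<^sup>2 \<partial>boundary_length_measure X F)"

text \<open>Smooth sections of the normal bundle with support in \<open>\<Omega>\<close>. Functions on \<open>'a\<close> are total; the
  value \<open>0\<close> outside \<open>topspace X\<close> makes the function determined by the section.\<close>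

definition normal_sections ::
  "'a topology \<Rightarrow> ('a \<Rightarrow> real^'n) \<Rightarrow> 'a set \<Rightarrow> ('a \<Rightarrow> real^'n) set" where
  "normal_sections X F \<Omega> =
     {Y. (\<forall>p. p \<notin> topspace X \<longrightarrow> Y p = 0) \<and>
         (\<forall>p\<in>topspace X. Y p \<in> normal_space X F p) \<and>
         (\<forall>V \<phi>. local_param half_plane X F V \<phi> \<longrightarrow> smooth_on V (Y \<circ> \<phi>)) \<and>
         X closure_of {p \<in> topspace X. Y p \<noteq> 0} \<subseteq> \<Omega>}"

global_interpretation fun_vs:
  vector_space "\<lambda>(c::real) (Y::'a \<Rightarrow> 'b::real_vector) p. c *\<^sub>R Y p"
  by unfold_locales (auto simp: fun_eq_iff scaleR_add_right scaleR_add_left)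

definition index_on :: "real \<Rightarrow> 'a topology \<Rightarrow> ('a \<Rightarrow> real^'n) \<Rightarrow> 'a set \<Rightarrow> enat" where
  "index_on \<epsilon> X F \<Omega> =
     Sup {enat (fun_vs.dim W) | W.
       fun_vs.subspace W \<and> (\<exists>B. finite B \<and> fun_vs.span B = W) \<and>
       W \<subseteq> normal_sections X F \<Omega> \<and> (\<forall>Y\<in>W. Y \<noteq> 0 \<longrightarrow> second_variation \<epsilon> X F Y < 0)}"

text \<open>Domains are open subsets of \<open>X\<close>; they may contain boundary points of the surface and need
  not be connected.\<close>

definition index :: "real \<Rightarrow> 'a topology \<Rightarrow> ('a \<Rightarrow> real^'n) \<Rightarrow> enat" where
  "index \<epsilon> X F =
     (SUP \<Omega>\<in>{\<Omega>. openin X \<Omega> \<and> compactin X (X closure_of \<Omega>)}. index_on \<epsilon> X F \<Omega>)"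


subsection \<open>The pieces cut out by the unit ball\<close>

definition interior_piece :: "'a topology \<Rightarrow> ('a \<Rightarrow> real^'n) \<Rightarrow> 'a topology" where
  "interior_piece X F = subtopology X (F -` cball 0 1)"

definition exterior_piece :: "'a topology \<Rightarrow> ('a \<Rightarrow> real^'n) \<Rightarrow> 'a topology" where
  "exterior_piece X F = subtopology X (F -` (- ball 0 1))"

end

theory Submission
  imports Defs
begin

text \<open>Let \<open>W\<close> be a space of normal fields with support in a bounded domain on which the second
  variation of \<open>\<Sigma>\<close> is negative definite. Restricting to the two pieces, the second variation is
  the sum \<open>q + r\<close> of the second variations of \<open>I\<Sigma>\<close> and \<open>E\<Sigma>\<close>, because the boundary terms cancel.
  Choosing a maximal subspace of \<open>W\<close> on which \<open>q\<close> is negative definite, \<open>q\<close> is nonnegative, hence \<open>r\<close>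
  negative definite, on its \<open>q\<close>-orthogonal complement. Restriction is injective on a subspace where
  the second variation of the piece is negative, so the two dimensions are bounded by the two
  indices.

  The second variations of \<open>\<Sigma>\<close> and of its pieces are integrals of the same integrand against the
  same measures: boundary charts of a piece and interior charts of \<open>\<Sigma>\<close> are related by transition
  maps, under which integrand and measure are invariant.\<close>

subsection \<open>Calculus of \<open>C\<^sup>k\<close> maps\<close>

text \<open>Two features make the comparison delicate. The measures are definite descriptions over
  all charts, and the integrand is evaluated in a chart and frame picked by \<open>SOME\<close>,
  separately for \<Sigma> and for each piece. Moreover, near the sphere a chart of a piece is no
  chart of \<Sigma>, because its image is not open. Hence transition maps start from a merely
  embedded parametrization, with one-sided derivatives at its edge. Measures are identified through
  uniqueness on a countable disjoint decomposition. The integrand is rewritten as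
  \<open>shape_energy\<close>, which contains only first derivatives of the immersion and of the
  field, so that a change of chart or frame acts through one linear map at one point. The splitting
  treats \<open>q\<close> and \<open>r\<close> differently: only \<open>q\<close> has to be a
  quadratic form. This rests on integrability, which the compact closure of the domain provides. The
  common boundary belongs to both pieces; counting it twice does not affect the area integral
  because it is a null set.\<close>

lemma Ck_on_subset: "Ck_on k f U \<Longrightarrow> V \<subseteq> U \<Longrightarrow> Ck_on k f V"
  by (induction k arbitrary: f) (auto intro: continuous_on_subset)

lemma Ck_on_Suc_D: "Ck_on (Suc k) f U \<Longrightarrow> Ck_on k f U"
proof (induction k arbitrary: f)
  case 0
  then show ?case
    by (auto intro!: continuous_at_imp_continuous_on differentiable_imp_continuous_within)
next
  case (Suc k)
  then show ?case by (metis Ck_on.simps(2))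
qed

lemma Ck_on_imp_continuous_on: "Ck_on k f U \<Longrightarrow> continuous_on U f"
  by (induction k arbitrary: f) (auto intro!: continuous_at_imp_continuous_on differentiable_imp_continuous_within)

lemma frechet_derivative_cong_open:
  assumes "open U" "x \<in> U" "\<And>y. y \<in> U \<Longrightarrow> f y = g y"
  shows "frechet_derivative f (at x) = frechet_derivative g (at x)"
proof -
  have "(f has_derivative f') (at x) \<longleftrightarrow> (g has_derivative f') (at x)" for f'
    using assms has_derivative_transform_within_open by (metis (full_types))
  then show ?thesis by (simp add: frechet_derivative_def)
qed

lemma Ck_on_cong:
  assumes "open U" "\<And>y. y \<in> U \<Longrightarrow> f y = g y"
  shows "Ck_on k f U \<longleftrightarrow> Ck_on k g U"
  using assms(2)
proof (induction k arbitrary: f g)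
  case 0
  then show ?case by (auto intro: continuous_on_eq)
next
  case (Suc k)
  have *: "frechet_derivative f (at x) = frechet_derivative g (at x)" if "x \<in> U" for x
    using frechet_derivative_cong_open[OF assms(1) that, of f g] Suc.prems by auto
  have "f differentiable (at x) \<longleftrightarrow> g differentiable (at x)" if "x \<in> U" for x
    using that Suc.prems assms(1) unfolding differentiable_def
    by (metis (full_types) has_derivative_transform_within_open)
  moreover have "Ck_on k (\<lambda>x. frechet_derivative f (at x) v) U \<longleftrightarrow> Ck_on k (\<lambda>x. frechet_derivative g (at x) v) U" for v
    by (rule Suc.IH) (simp add: *)
  ultimately show ?case by auto
qed

text \<open>Replaces the chosen \<open>frechet_derivative\<close> by any explicit derivative
  formula, so that the inductions below can follow the usual rules of differentiation.\<close>

lemma Ck_on_SucI: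
  assumes "open U" "\<And>x. x \<in> U \<Longrightarrow> (f has_derivative f' x) (at x)"
    and "\<And>v. Ck_on k (\<lambda>x. f' x v) U"
  shows "Ck_on (Suc k) f U"
proof -
  have "frechet_derivative f (at x) = f' x" if "x \<in> U" for x
    using assms(2)[OF that] by (metis frechet_derivative_at)
  then have "Ck_on k (\<lambda>x. frechet_derivative f (at x) v) U" for v
    using assms(3)[of v] by (subst Ck_on_cong[OF assms(1), of _ "\<lambda>x. f' x v"]) auto
  then show ?thesis using assms(2) by (auto simp: differentiable_def)
qed

lemma Ck_on_Suc_has_derivative:
  "Ck_on (Suc k) f U \<Longrightarrow> x \<in> U \<Longrightarrow> (f has_derivative frechet_derivative f (at x)) (at x)"
  by (simp add: frechet_derivative_works)

lemma Ck_on_const: "open U \<Longrightarrow> Ck_on k (\<lambda>x. c) U"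
proof (induction k arbitrary: c)
  case (Suc k)
  then show ?case by (intro Ck_on_SucI[where f' = "\<lambda>x v. 0"]) auto
qed simp

lemma Ck_on_bounded_linear: "bounded_linear L \<Longrightarrow> open U \<Longrightarrow> Ck_on k L U"
proof (cases k)
  case 0
  assume "bounded_linear L"
  then show ?thesis using 0 by (simp add: linear_continuous_on)
next
  case (Suc j)
  assume "bounded_linear L" "open U"
  then show ?thesis unfolding Suc
    by (intro Ck_on_SucI[where f' = "\<lambda>x v. L v"] Ck_on_const bounded_linear_imp_has_derivative)
qed

lemma Ck_on_add:
  "open U \<Longrightarrow> Ck_on k f U \<Longrightarrow> Ck_on k g U \<Longrightarrow> Ck_on k (\<lambda>x. f x + g x) U"
proof (induction k arbitrary: f g)
  case 0
  then show ?case by (auto intro: continuous_intros)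
next
  case (Suc k)
  note d = Ck_on_Suc_has_derivative[OF Suc.prems(2)] Ck_on_Suc_has_derivative[OF Suc.prems(3)]
  show ?case
    by (rule Ck_on_SucI[OF \<open>open U\<close> has_derivative_add[OF d]]) (use Suc in auto)
qed

lemma Ck_on_sum:
  "open U \<Longrightarrow> (\<And>i. i \<in> I \<Longrightarrow> Ck_on k (f i) U) \<Longrightarrow> Ck_on k (\<lambda>x. \<Sum>i\<in>I. f i x) U"
  by (induction I rule: infinite_finite_induct) (auto intro: Ck_on_const Ck_on_add)

text \<open>By the product rule the derivative is a sum of two terms of the same form, so the
  induction closes. One statement covers products, scalar multiples and inner products.\<close>

lemma Ck_on_bilinear:
  assumes "bounded_bilinear B" and "open U"
  shows "Ck_on k f U \<Longrightarrow> Ck_on k g U \<Longrightarrow> Ck_on k (\<lambda>x. B (f x) (g x)) U"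
proof (induction k arbitrary: f g)
  case 0
  then show ?case using assms(1) by (auto intro: bounded_bilinear.continuous_on)
next
  case (Suc k)
  note d = Ck_on_Suc_has_derivative[OF Suc.prems(1)] Ck_on_Suc_has_derivative[OF Suc.prems(2)]
  show ?case
    by (rule Ck_on_SucI[OF \<open>open U\<close> bounded_bilinear.FDERIV[OF assms(1) d]])
       (use Suc.prems[THEN Ck_on_Suc_D] Suc assms(2) in \<open>auto intro!: Ck_on_add Suc.IH\<close>)
qed

lemma Ck_on_compose_linear:
  assumes "bounded_linear L" and "open U"
  shows "Ck_on k f U \<Longrightarrow> Ck_on k (\<lambda>x. L (f x)) U"
proof (induction k arbitrary: f)
  case 0
  then show ?case using assms(1) by (auto intro: bounded_linear.continuous_on)
next
  case (Suc k)
  note d = Ck_on_Suc_has_derivative[OF Suc.prems(1)]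
  show ?case
    by (rule Ck_on_SucI[OF \<open>open U\<close> bounded_linear.has_derivative[OF assms(1) d]])
       (use Suc in \<open>auto intro!: Suc.IH\<close>)
qed

lemma Ck_on_compose:
  fixes f :: "'m::euclidean_space \<Rightarrow> 'p::euclidean_space" and g :: "'p \<Rightarrow> 'b::real_normed_vector"
  assumes "open U" "Ck_on k f U" "Ck_on k g T" "f ` U \<subseteq> T"
  shows "Ck_on k (\<lambda>x. g (f x)) U"
  using assms(2-4)
proof (induction k arbitrary: g)
  case 0
  then show ?case by (auto intro: continuous_on_compose2)
next
  case (Suc k)
  note df = Ck_on_Suc_has_derivative[OF Suc.prems(1)]
  note dg = Ck_on_Suc_has_derivative[OF Suc.prems(2)]
  let ?g' = "\<lambda>y. frechet_derivative g (at y)"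
  let ?f' = "\<lambda>y. frechet_derivative f (at y)"
  \<comment> \<open>The chain rule evaluates the derivative of \<open>g\<close> in a direction that
    moves with \<open>x\<close>, while the induction hypothesis only treats fixed directions.
    Expanding the direction in \<open>Basis\<close> separates the two dependencies.\<close>
  have d: "((\<lambda>x. g (f x)) has_derivative (\<lambda>v. \<Sum>b\<in>Basis. (?f' x v \<bullet> b) *\<^sub>R ?g' (f x) b)) (at x)"
    if x: "x \<in> U" for x
  proof -
    have fx: "f x \<in> T" using Suc.prems(3) x by auto
    have "linear (?g' (f x))" using dg[OF fx] has_derivative_linear by blast
    then have "?g' (f x) (?f' x v) = (\<Sum>b\<in>Basis. (?f' x v \<bullet> b) *\<^sub>R ?g' (f x) b)" for v
      by (subst euclidean_representation[of "?f' x v", symmetric]) (simp only: linear_sum linear_cmul)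
    then show ?thesis using has_derivative_compose[OF df[OF x] dg[OF fx]] by simp
  qed
  show ?case
  proof (rule Ck_on_SucI[OF \<open>open U\<close> d])
    fix v
    have 1: "Ck_on k (\<lambda>x. ?g' (f x) b) U" for b
      by (rule Suc.IH) (use Suc.prems Suc.prems(1)[THEN Ck_on_Suc_D] in auto)
    have 2: "Ck_on k (\<lambda>x. ?f' x v \<bullet> b) U" for b
      using Suc.prems(1) assms(1) by (intro Ck_on_compose_linear[OF bounded_linear_inner_left]) auto
    show "Ck_on k (\<lambda>x. \<Sum>b\<in>Basis. (?f' x v \<bullet> b) *\<^sub>R ?g' (f x) b) U"
      using 1 2 assms(1) by (intro Ck_on_sum Ck_on_bilinear[OF bounded_bilinear_scaleR])
  qed auto
qed

lemma Ck_on_inverse: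
  fixes f :: "'m::euclidean_space \<Rightarrow> real"
  assumes "open U" "\<And>x. x \<in> U \<Longrightarrow> f x \<noteq> 0"
  shows "Ck_on k f U \<Longrightarrow> Ck_on k (\<lambda>x. inverse (f x)) U"
proof (induction k)
  case 0
  then show ?case using assms by (auto intro: continuous_intros)
next
  case (Suc k)
  note df = Ck_on_Suc_has_derivative[OF Suc.prems(1)]
  have i: "Ck_on k (\<lambda>x. inverse (f x)) U" using Suc Ck_on_Suc_D by blast
  show ?case
  proof (rule Ck_on_SucI[OF \<open>open U\<close> Deriv.has_derivative_inverse[OF assms(2) df]])
    show "Ck_on k (\<lambda>x. - (inverse (f x) * frechet_derivative f (at x) v * inverse (f x))) U" for v
      using Suc.prems i assms(1)
      by (intro Ck_on_compose_linear[OF bounded_linear_minus[OF bounded_linear_ident]]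
          Ck_on_bilinear[OF bounded_bilinear_mult]) auto
  qed auto
qed

text \<open>The exponent varies in the induction since differentiation lowers it by one. The case
  \<open>a = -1/2\<close> normalizes the vectors in the Gram-Schmidt process.\<close>

lemma Ck_on_powr:
  fixes f :: "'m::euclidean_space \<Rightarrow> real"
  assumes "open U" "\<And>x. x \<in> U \<Longrightarrow> f x > 0"
  shows "Ck_on k f U \<Longrightarrow> Ck_on k (\<lambda>x. f x powr a) U"
proof (induction k arbitrary: a)
  case 0
  then show ?case using assms by (auto intro!: continuous_intros simp: less_imp_neq[THEN not_sym])
next
  case (Suc k)
  note df = Ck_on_Suc_has_derivative[OF Suc.prems(1)]
  have d: "((\<lambda>x. f x powr a) has_derivative (\<lambda>v. a * f x powr (a - 1) * frechet_derivative f (at x) v)) (at x)"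
    if "x \<in> U" for x
    using has_derivative_powr[OF df[OF that] has_derivative_const[of a] assms(2)[OF that]] assms(2)[OF that]
    by (simp add: field_simps powr_diff)
  show ?case
  proof (rule Ck_on_SucI[OF \<open>open U\<close> d])
    fix v
    have "Ck_on k (\<lambda>x. f x powr (a - 1)) U" using Suc Ck_on_Suc_D by blast
    then show "Ck_on k (\<lambda>x. a * f x powr (a - 1) * frechet_derivative f (at x) v) U"
      using Suc.prems assms(1)
      by (intro Ck_on_bilinear[OF bounded_bilinear_mult] Ck_on_const) auto
  qed auto
qed

lemma Ck_on_prod:
  fixes f :: "'i \<Rightarrow> 'm::euclidean_space \<Rightarrow> real"
  shows "open U \<Longrightarrow> (\<And>i. i \<in> I \<Longrightarrow> Ck_on k (f i) U) \<Longrightarrow> Ck_on k (\<lambda>x. \<Prod>i\<in>I. f i x) U"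
  by (induction I rule: infinite_finite_induct)
     (auto intro!: Ck_on_const Ck_on_bilinear[OF bounded_bilinear_mult])

lemma Ck_on_det:
  fixes A :: "'m::euclidean_space \<Rightarrow> real^'k^'k"
  assumes "open U" "\<And>i j. Ck_on k (\<lambda>x. A x $ i $ j) U"
  shows "Ck_on k (\<lambda>x. det (A x)) U"
  unfolding det_def using assms
  by (intro Ck_on_sum Ck_on_bilinear[OF bounded_bilinear_mult] Ck_on_prod Ck_on_const)

lemma Ck_on_vec_lambda:
  fixes f :: "'k::finite \<Rightarrow> 'm::euclidean_space \<Rightarrow> real"
  assumes "open U" "\<And>i. Ck_on k (f i) U"
  shows "Ck_on k (\<lambda>x. \<chi> i. f i x) U"
proof -
  have "(\<chi> i. f i x) = (\<Sum>i\<in>UNIV. f i x *\<^sub>R axis i 1)" for x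
    by (simp add: vec_eq_iff axis_def if_distrib cong: if_cong)
  then show ?thesis using assms
    by (auto intro!: Ck_on_sum Ck_on_bilinear[OF bounded_bilinear_scaleR] Ck_on_const)
qed

text \<open>The inverse function theorem gives a differentiable \<open>h\<close> whose derivative is
  the inverse of the derivative of \<open>G\<close> at \<open>h z\<close>. By Cramer's rule that
  inverse depends smoothly on the point, so each degree of smoothness of \<open>h\<close> passes to
  its derivative and raises the degree of \<open>h\<close> by one.\<close>

lemma smooth_inverse_function:
  fixes G :: "real^'k \<Rightarrow> real^'k"
  assumes "open T" and G: "\<And>k. Ck_on k G T" and "y \<in> T" "inj (frechet_derivative G (at y))"
  obtains T' P h where "open T'" "T' \<subseteq> T" "y \<in> T'" "open P" "homeomorphism T' P G h" "\<And>k. Ck_on k h P"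
proof -
  let ?D = "\<lambda>x. frechet_derivative G (at x)"
  let ?B = "\<lambda>x. Blinfun (?D x)"
  have dG: "(G has_derivative ?D x) (at x)" if "x \<in> T" for x
    using Ck_on_Suc_has_derivative[OF G[of "Suc 0"] that] .
  then have bl: "bounded_linear (?D x)" if "x \<in> T" for x
    using that has_derivative_bounded_linear by blast
  have B: "blinfun_apply (?B x) = ?D x" if "x \<in> T" for x
    using bl[OF that] by (rule bounded_linear_Blinfun_apply)
  have DC: "Ck_on k (\<lambda>x. ?D x v) T" for k v
    using G[of "Suc k"] by simp
  have contB: "continuous_on T ?B"
  proof (rule continuous_on_blinfun_componentwise)
    show "continuous_on T (\<lambda>x. blinfun_apply (?B x) i)" for i
      using Ck_on_imp_continuous_on[OF DC[of 0 i]] by (rule continuous_on_eq) (simp add: B)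
  qed
  obtain L where L: "linear L" "L \<circ> ?D y = id"
    using linear_injective_left_inverse bl[OF \<open>y \<in> T\<close>] assms(4) bounded_linear.linear by blast
  have "Blinfun L o\<^sub>L ?B y = id_blinfun"
    using L B[OF \<open>y \<in> T\<close>] linear_conv_bounded_linear[of L]
    by (intro blinfun_eqI) (simp add: bounded_linear_Blinfun_apply fun_eq_iff)
  from inverse_function_theorem[OF \<open>open T\<close> _ contB \<open>y \<in> T\<close> this] dG B
  obtain T' P h h' where *: "open T'" "T' \<subseteq> T" "y \<in> T'" "open P" "homeomorphism T' P G h"
    and dh: "\<And>z. z \<in> P \<Longrightarrow> (h has_derivative h' z) (at z)"
    and h': "\<And>z. z \<in> P \<Longrightarrow> h' z = inv (blinfun_apply (?B (h z)))"
    and bij: "\<And>z. z \<in> P \<Longrightarrow> bij (blinfun_apply (?B (h z)))"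
    by (metis (no_types, lifting))
  have hP: "h ` P = T'" using *(5) by (simp add: homeomorphism_def)
  define M where "M x = matrix (?D x)" for x
  have Mv: "M x *v w = ?D x w" if "x \<in> T" for x w
    unfolding M_def using bl[OF that] by (simp add: bounded_linear.linear matrix_works)
  have detM: "det (M x) \<noteq> 0" if "x \<in> T'" for x
  proof -
    obtain z where z: "z \<in> P" "x = h z" using hP \<open>x \<in> T'\<close> by blast
    have "x \<in> T" using that *(2) by auto
    then have "inj (?D x)" using bij[OF z(1)] B[of x] z(2) by (simp add: bij_is_inj)
    then show ?thesis using bl[OF \<open>x \<in> T\<close>] unfolding M_def
      by (simp add: bounded_linear.linear det_nz_iff_inj)
  qed
  \<comment> \<open>Cramer's formula for the solution \<open>w\<close> of
    \<open>M x *v w = v\<close>: column \<open>j\<close> is replaced by \<open>v\<close>.\<close>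
  define R where "R v x = (\<chi> j. det (\<chi> i l. if l = j then v $ i else M x $ i $ l) * inverse (det (M x)))" for v x
  have MC: "Ck_on k (\<lambda>x. M x $ i $ l) T'" for k i l
    unfolding M_def matrix_def
    using Ck_on_compose_linear[OF bounded_linear_vec_nth \<open>open T'\<close> Ck_on_subset[OF DC *(2)]]
    by simp
  have RC: "Ck_on k (R v) T'" for k v
    unfolding R_def
  proof (intro Ck_on_vec_lambda Ck_on_bilinear[OF bounded_bilinear_mult] Ck_on_inverse Ck_on_det *(1) detM)
    show "Ck_on k (\<lambda>x. (\<chi> i l. if l = j then v $ i else M x $ i $ l) $ i $ l) T'" for j i l
      using MC *(1) Ck_on_const by (cases "l = j") auto
  qed (auto intro: MC)
  have h'R: "h' z v = R v (h z)" if "z \<in> P" for z v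
  proof -
    have hz: "h z \<in> T'" "h z \<in> T" using that hP *(2) by auto
    have "M (h z) *v h' z v = v"
      using bij[OF that] by (simp add: h'[OF that] Mv[OF hz(2)] B[OF hz(2)] bij_is_surj surj_f_inv_f)
    then show ?thesis using cramer[OF detM[OF hz(1)], of "h' z v" v]
      by (simp add: R_def divide_inverse)
  qed
  have "Ck_on k h P" for k
  proof (induction k)
    case 0
    then show ?case using *(5) by (simp add: homeomorphism_def)
  next
    case (Suc k)
    show ?case
    proof (rule Ck_on_SucI[OF *(4) dh])
      show "Ck_on k (\<lambda>z. h' z v) P" for v
        using Ck_on_compose[OF *(4) Suc RC[of k v]] hP
        by (subst Ck_on_cong[OF *(4) h'R]) auto
    qed
  qed
  with * show thesis by (rule that)
qed

subsection \<open>Derivatives on half-space-like domains\<close>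

text \<open>What the modelling sets \<open>UNIV\<close> and \<open>half_plane\<close> have in common: one-sided directions at
  every point, which makes derivatives within relatively open subsets unique.\<close>

definition model_space :: "(real^'k) set \<Rightarrow> bool" where
  "model_space H \<longleftrightarrow> H \<in> sets borel \<and> (\<forall>x\<in>H. \<forall>i. \<forall>d\<ge>0. x + d *\<^sub>R axis i 1 \<in> H)"

lemma model_space_UNIV: "model_space UNIV"
  by (simp add: model_space_def)

lemma closed_half_plane: "closed half_plane"
proof -
  have eq: "half_plane = {x. (0::real) \<le> x $ 1}"
    by (simp add: half_plane_def)
  show ?thesis unfolding eq by (intro closed_Collect_le continuous_intros)
qed

lemma model_space_half_plane: "model_space half_plane"
  using closed_half_plane by (auto simp: model_space_def half_plane_def axis_def)

lemma openin_model_borel: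
  assumes "model_space H" "openin (top_of_set H) V"
  shows "V \<in> sets borel"
  using assms by (auto simp: openin_open model_space_def)

lemma D_eqI:
  assumes "model_space H" "openin (top_of_set H) V" "x \<in> V" "(f has_derivative f') (at x within V)"
  shows "D V f x = f'"
proof -
  have "\<exists>d. 0 < \<bar>d\<bar> \<and> \<bar>d\<bar> < e \<and> x + d *\<^sub>R i \<in> V" if "i \<in> Basis" "e > 0" for i e
  proof -
    obtain O' where O': "open O'" "V = H \<inter> O'" using assms(2) by (auto simp: openin_open)
    with assms(3) obtain r where r: "r > 0" "ball x r \<subseteq> O'" by (auto simp: open_contains_ball)
    obtain j where j: "i = axis j 1" using \<open>i \<in> Basis\<close> by (auto simp: Basis_vec_def)
    define d where "d = min r e / 2"
    have d: "0 < d" "d < r" "d < e" using r \<open>e > 0\<close> by (auto simp: d_def)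
    have "x + d *\<^sub>R i \<in> H" using assms(1,3) O'(2) d(1) by (auto simp: model_space_def j)
    moreover have "x + d *\<^sub>R i \<in> ball x r" using d \<open>i \<in> Basis\<close> by (simp add: dist_norm)
    ultimately show ?thesis using d r O' by (intro exI[of _ d]) auto
  qed
  moreover have "(f has_derivative D V f x) (at x within V)"
    using assms(4) by (metis frechet_derivative_works differentiable_def)
  ultimately show ?thesis using assms(4) by (intro frechet_derivative_unique_within) auto
qed

lemma differentiable_D: "f differentiable (at x within V) \<Longrightarrow> (f has_derivative D V f x) (at x within V)"
  by (simp add: frechet_derivative_works)

lemma has_derivative_within_cong:
  assumes "(g has_derivative f') (at x within S)" "open U" "x \<in> U" "x \<in> S" "\<And>y. y \<in> S \<inter> U \<Longrightarrow> g y = f y"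
  shows "(f has_derivative f') (at x within S)"
  using assms(1)
proof -
  obtain r where "r > 0" "ball x r \<subseteq> U" using assms(2,3) by (auto simp: open_contains_ball)
  then show ?thesis using assms
    by (intro has_derivative_transform_within[OF assms(1), of r]) (auto simp: dist_commute subset_iff)
qed

subsection \<open>Smooth maps on sets\<close>

lemma smooth_onE:
  assumes "smooth_on S f" "x \<in> S"
  obtains U g where "open U" "x \<in> U" "\<And>k. Ck_on k g U" "\<And>y. y \<in> S \<inter> U \<Longrightarrow> g y = f y"
proof -
  obtain U g where "open U" "x \<in> U" "\<forall>k. Ck_on k g U" "\<forall>y\<in>S \<inter> U. g y = f y"
    using assms unfolding smooth_on_def by blast
  then show thesis using that[of U g] by auto
qed

lemma smooth_onI:
  assumes "\<And>x. x \<in> S \<Longrightarrow> \<exists>U g. open U \<and> x \<in> U \<and> (\<forall>k. Ck_on k g U) \<and> (\<forall>y\<in>S \<inter> U. g y = f y)"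
  shows "smooth_on S f"
  using assms unfolding smooth_on_def by blast

lemma smooth_on_Ck: "open U \<Longrightarrow> (\<And>k. Ck_on k f U) \<Longrightarrow> smooth_on U f"
  by (rule smooth_onI) auto

lemma smooth_on_cong: "(\<And>x. x \<in> S \<Longrightarrow> f x = g x) \<Longrightarrow> smooth_on S f \<longleftrightarrow> smooth_on S g"
  unfolding smooth_on_def by simp

lemma smooth_on_subset: "smooth_on S f \<Longrightarrow> T \<subseteq> S \<Longrightarrow> smooth_on T f"
proof (rule smooth_onI)
  fix x assume T: "smooth_on S f" "T \<subseteq> S" "x \<in> T"
  then have "x \<in> S" by auto
  obtain U g where "open U" "x \<in> U" "\<And>k. Ck_on k g U" "\<And>y. y \<in> S \<inter> U \<Longrightarrow> g y = f y"
    using smooth_onE[OF T(1) \<open>x \<in> S\<close>] by blast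
  then show "\<exists>U g. open U \<and> x \<in> U \<and> (\<forall>k. Ck_on k g U) \<and> (\<forall>y\<in>T \<inter> U. g y = f y)"
    using T(2) by (intro exI[of _ U] exI[of _ g]) auto
qed

lemma smooth_on_local:
  assumes "\<And>x. x \<in> S \<Longrightarrow> \<exists>S'. openin (top_of_set S) S' \<and> x \<in> S' \<and> smooth_on S' f"
  shows "smooth_on S f"
proof (rule smooth_onI)
  fix x assume "x \<in> S"
  then obtain S' where S': "openin (top_of_set S) S'" "x \<in> S'" "smooth_on S' f" using assms by blast
  then obtain O' where O': "open O'" "S' = S \<inter> O'" by (auto simp: openin_open)
  obtain U g where g: "open U" "x \<in> U" "\<And>k. Ck_on k g U" "\<And>y. y \<in> S' \<inter> U \<Longrightarrow> g y = f y"
    using smooth_onE[OF S'(3,2)] by blast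
  show "\<exists>U g. open U \<and> x \<in> U \<and> (\<forall>k. Ck_on k g U) \<and> (\<forall>y\<in>S \<inter> U. g y = f y)"
    using g O' S'(2) by (intro exI[of _ "U \<inter> O'"] exI[of _ g]) (auto intro: Ck_on_subset[OF g(3)])
qed

lemma smooth_on_const: "smooth_on S (\<lambda>x. c)"
  by (rule smooth_onI) (auto intro!: exI[of _ UNIV] Ck_on_const)

lemma smooth_on_extension_has_derivative:
  assumes "open U" "\<And>k. Ck_on k g U" "\<And>y. y \<in> S \<inter> U \<Longrightarrow> g y = f y" "y \<in> S \<inter> U"
  shows "(f has_derivative frechet_derivative g (at y)) (at y within S)"
proof (rule has_derivative_within_cong[OF _ assms(1)])
  show "(g has_derivative frechet_derivative g (at y)) (at y within S)"
    using Ck_on_Suc_has_derivative[OF assms(2)[of "Suc 0"]] assms(4) has_derivative_at_withinI by blast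
qed (use assms in auto)

lemma smooth_on_differentiable:
  assumes "smooth_on S f" "x \<in> S"
  shows "f differentiable (at x within S)"
proof -
  obtain U g where "open U" "x \<in> U" "\<And>k. Ck_on k g U" "\<And>y. y \<in> S \<inter> U \<Longrightarrow> g y = f y"
    using smooth_onE[OF assms] by blast
  from smooth_on_extension_has_derivative[OF this(1,3,4), where y = x] \<open>x \<in> U\<close> assms(2)
  show ?thesis by (auto simp: differentiable_def)
qed

lemma smooth_on_has_derivative:
  "smooth_on S f \<Longrightarrow> x \<in> S \<Longrightarrow> (f has_derivative D S f x) (at x within S)"
  by (simp add: smooth_on_differentiable differentiable_D)

lemma smooth_on_continuous_on: "smooth_on S f \<Longrightarrow> continuous_on S f"
  by (simp add: continuous_on_eq_continuous_within differentiable_imp_continuous_within smooth_on_differentiable)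

text \<open>By uniqueness, \<open>D V f\<close> agrees near each point with the ordinary derivative
  of one smooth extension, and that derivative is itself the required extension.\<close>

lemma smooth_on_D:
  assumes "model_space H" "openin (top_of_set H) V" "smooth_on V f"
  shows "smooth_on V (\<lambda>x. D V f x v)"
proof (rule smooth_onI)
  fix x assume "x \<in> V"
  obtain U g where g: "open U" "x \<in> U" "\<And>k. Ck_on k g U" "\<And>y. y \<in> V \<inter> U \<Longrightarrow> g y = f y"
    using smooth_onE[OF assms(3) \<open>x \<in> V\<close>] by blast
  have "D V f y = frechet_derivative g (at y)" if "y \<in> V \<inter> U" for y
    using D_eqI[OF assms(1,2) _ smooth_on_extension_has_derivative[OF g(1,3,4) that]] that by auto
  moreover have "Ck_on k (\<lambda>x. frechet_derivative g (at x) v) U" for k using g(3)[of "Suc k"] by simp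
  ultimately show "\<exists>U g. open U \<and> x \<in> U \<and> (\<forall>k. Ck_on k g U) \<and> (\<forall>y\<in>V \<inter> U. g y = D V f y v)"
    using g(1,2) by (intro exI[of _ U] exI[of _ "\<lambda>x. frechet_derivative g (at x) v"]) auto
qed

lemma smooth_on_compose:
  fixes f :: "'m::euclidean_space \<Rightarrow> 'p::euclidean_space" and g :: "'p \<Rightarrow> 'b::real_normed_vector"
  assumes "smooth_on T g" "smooth_on S f" "f ` S \<subseteq> T"
  shows "smooth_on S (\<lambda>x. g (f x))"
proof (rule smooth_onI)
  fix x assume x: "x \<in> S"
  obtain U f' where f': "open U" "x \<in> U" "\<And>k. Ck_on k f' U" "\<And>y. y \<in> S \<inter> U \<Longrightarrow> f' y = f y"
    using smooth_onE[OF assms(2) x] by blast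
  have "f x \<in> T" using x assms(3) by auto
  obtain W g' where g': "open W" "f x \<in> W" "\<And>k. Ck_on k g' W" "\<And>y. y \<in> T \<inter> W \<Longrightarrow> g' y = g y"
    using smooth_onE[OF assms(1) \<open>f x \<in> T\<close>] by blast
  let ?U = "U \<inter> f' -` W"
  have "open ?U"
    using continuous_openin_preimage_gen[OF Ck_on_imp_continuous_on[OF f'(3)] g'(1)] f'(1)
    by (simp add: openin_open_eq)
  moreover have "x \<in> ?U" using f' g' x by auto
  moreover have "Ck_on k (\<lambda>x. g' (f' x)) ?U" for k
    by (rule Ck_on_compose[OF \<open>open ?U\<close> Ck_on_subset[OF f'(3)] g'(3)]) auto
  moreover have "g' (f' y) = g (f y)" if "y \<in> S \<inter> ?U" for y
    using that f'(4)[of y] g'(4)[of "f y"] assms(3) by auto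
  ultimately show "\<exists>U h. open U \<and> x \<in> U \<and> (\<forall>k. Ck_on k h U) \<and> (\<forall>y\<in>S \<inter> U. h y = g (f y))"
    by (intro exI[of _ ?U] exI[of _ "\<lambda>x. g' (f' x)"]) auto
qed

lemma smooth_on_bilinear:
  assumes "bounded_bilinear B" "smooth_on S f" "smooth_on S g"
  shows "smooth_on S (\<lambda>x. B (f x) (g x))"
proof (rule smooth_onI)
  fix x assume x: "x \<in> S"
  obtain U f' where f': "open U" "x \<in> U" "\<And>k. Ck_on k f' U" "\<And>y. y \<in> S \<inter> U \<Longrightarrow> f' y = f y"
    using smooth_onE[OF assms(2) x] by blast
  obtain W g' where g': "open W" "x \<in> W" "\<And>k. Ck_on k g' W" "\<And>y. y \<in> S \<inter> W \<Longrightarrow> g' y = g y"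
    using smooth_onE[OF assms(3) x] by blast
  show "\<exists>U h. open U \<and> x \<in> U \<and> (\<forall>k. Ck_on k h U) \<and> (\<forall>y\<in>S \<inter> U. h y = B (f y) (g y))"
    using f' g' by (intro exI[of _ "U \<inter> W"] exI[of _ "\<lambda>x. B (f' x) (g' x)"])
      (auto intro!: Ck_on_bilinear[OF assms(1)] intro: Ck_on_subset[OF f'(3)] Ck_on_subset[OF g'(3)])
qed

lemma smooth_on_compose_linear:
  assumes "bounded_linear L" "smooth_on S f"
  shows "smooth_on S (\<lambda>x. L (f x))"
proof (rule smooth_onI)
  fix x assume x: "x \<in> S"
  obtain U f' where f': "open U" "x \<in> U" "\<And>k. Ck_on k f' U" "\<And>y. y \<in> S \<inter> U \<Longrightarrow> f' y = f y"
    using smooth_onE[OF assms(2) x] by blast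
  then show "\<exists>U h. open U \<and> x \<in> U \<and> (\<forall>k. Ck_on k h U) \<and> (\<forall>y\<in>S \<inter> U. h y = L (f y))"
    by (intro exI[of _ U] exI[of _ "\<lambda>x. L (f' x)"])
      (auto intro!: Ck_on_compose_linear[OF assms(1)])
qed

lemma smooth_on_add:
  assumes "smooth_on S f" "smooth_on S g"
  shows "smooth_on S (\<lambda>x. f x + g x)"
proof (rule smooth_onI)
  fix x assume x: "x \<in> S"
  obtain U f' where f': "open U" "x \<in> U" "\<And>k. Ck_on k f' U" "\<And>y. y \<in> S \<inter> U \<Longrightarrow> f' y = f y"
    using smooth_onE[OF assms(1) x] by blast
  obtain W g' where g': "open W" "x \<in> W" "\<And>k. Ck_on k g' W" "\<And>y. y \<in> S \<inter> W \<Longrightarrow> g' y = g y"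
    using smooth_onE[OF assms(2) x] by blast
  show "\<exists>U h. open U \<and> x \<in> U \<and> (\<forall>k. Ck_on k h U) \<and> (\<forall>y\<in>S \<inter> U. h y = f y + g y)"
    using f' g' by (intro exI[of _ "U \<inter> W"] exI[of _ "\<lambda>x. f' x + g' x"])
      (auto intro!: Ck_on_add intro: Ck_on_subset[OF f'(3)] Ck_on_subset[OF g'(3)])
qed

lemma smooth_on_sum: "(\<And>i. i \<in> I \<Longrightarrow> smooth_on S (f i)) \<Longrightarrow> smooth_on S (\<lambda>x. \<Sum>i\<in>I. f i x)"
  by (induction I rule: infinite_finite_induct) (auto intro: smooth_on_const smooth_on_add)

lemma smooth_on_diff: "smooth_on S f \<Longrightarrow> smooth_on S g \<Longrightarrow> smooth_on S (\<lambda>x. f x - g x)"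
  using smooth_on_add[of S f "\<lambda>x. - g x"]
    smooth_on_compose_linear[OF bounded_linear_minus[OF bounded_linear_ident], of S g] by simp

lemmas smooth_on_inner = smooth_on_bilinear[OF bounded_bilinear_inner]
  and smooth_on_mult = smooth_on_bilinear[OF bounded_bilinear_mult]
  and smooth_on_scaleR = smooth_on_bilinear[OF bounded_bilinear_scaleR]

lemma smooth_on_powr:
  fixes f :: "'m::euclidean_space \<Rightarrow> real"
  assumes "smooth_on S f" "\<And>x. x \<in> S \<Longrightarrow> f x > 0"
  shows "smooth_on S (\<lambda>x. f x powr a)"
proof (rule smooth_on_compose[where T = "{0<..}", OF _ assms(1)])
  show "smooth_on {0<..} (\<lambda>t::real. t powr a)"
    by (intro smooth_on_Ck Ck_on_powr Ck_on_bounded_linear[OF bounded_linear_ident]) auto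
qed (use assms in auto)

text \<open>Through a linear left inverse of the derivative, the inverse function theorem applies to
  immersions into spaces of larger dimension.\<close>

lemma smooth_local_left_inverse:
  fixes g :: "real^'k \<Rightarrow> real^'n"
  assumes "open W" "smooth_on W g" "y \<in> W" "inj (D W g y)"
  obtains T P and h :: "real^'k \<Rightarrow> real^'k" and L :: "real^'n \<Rightarrow> real^'k"
  where "open T" "y \<in> T" "T \<subseteq> W" "open P" "smooth_on P h" "linear L"
    "\<And>z. z \<in> T \<Longrightarrow> L (g z) \<in> P \<and> h (L (g z)) = z"
proof -
  obtain U g' where g': "open U" "y \<in> U" "\<And>k. Ck_on k g' U" "\<And>z. z \<in> W \<inter> U \<Longrightarrow> g' z = g z"
    using smooth_onE[OF assms(2,3)] by blast
  have "(g has_derivative frechet_derivative g' (at y)) (at y)"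
    using smooth_on_extension_has_derivative[where S = W and y = y, OF g'(1,3,4)] assms(1,3) g'(2)
    by (simp add: at_within_open[OF assms(3,1)])
  moreover have "(g has_derivative D W g y) (at y)"
    using smooth_on_has_derivative[OF assms(2,3)] assms(1,3) by (simp add: at_within_open[OF assms(3,1)])
  ultimately have eq: "frechet_derivative g' (at y) = D W g y" by (rule has_derivative_unique)
  have lin: "linear (D W g y)"
    using smooth_on_has_derivative[OF assms(2,3)] by (rule has_derivative_linear)
  obtain L where L: "linear L" "L \<circ> D W g y = id"
    using linear_injective_left_inverse[OF lin assms(4)] by blast
  then have bL: "bounded_linear L" by (simp add: linear_conv_bounded_linear)
  let ?G = "\<lambda>z. L (g' z)"
  have "(?G has_derivative (\<lambda>v. L (frechet_derivative g' (at y) v))) (at y)"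
    using bounded_linear.has_derivative[OF bL Ck_on_Suc_has_derivative[OF g'(3)[of "Suc 0"] g'(2)]] .
  then have "frechet_derivative ?G (at y) = (\<lambda>v. L (D W g y v))"
    unfolding eq by (rule frechet_derivative_at[symmetric])
  moreover have "L (D W g y v) = v" for v using L(2) by (simp add: fun_eq_iff)
  ultimately have inj: "inj (frechet_derivative ?G (at y))" by (simp add: inj_def)
  have oWU: "open (W \<inter> U)" using assms(1) g'(1) by auto
  have GC: "Ck_on k ?G (W \<inter> U)" for k
    using Ck_on_compose_linear[OF bL oWU Ck_on_subset[OF g'(3)]] by auto
  have "y \<in> W \<inter> U" using assms(3) g'(2) by simp
  then obtain T P h where *: "open T" "T \<subseteq> W \<inter> U" "y \<in> T" "open P" "homeomorphism T P ?G h" "\<And>k. Ck_on k h P"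
    using smooth_inverse_function[OF oWU GC _ inj] by blast
  have "L (g z) \<in> P \<and> h (L (g z)) = z" if "z \<in> T" for z
  proof -
    have "g' z = g z" using *(2) that g'(4) by blast
    then show ?thesis using *(5) that by (auto simp: homeomorphism_def simp flip: \<open>g' z = g z\<close>)
  qed
  with * L(1) show thesis by (intro that[of T P h L]) (auto intro: smooth_on_Ck)
qed

subsection \<open>Transition maps\<close>

lemma at_within_openin:
  assumes "openin (top_of_set V) V'" "x \<in> V'"
  shows "at x within V' = at x within V"
proof -
  obtain O' where "open O'" "V' = V \<inter> O'" using assms(1) by (auto simp: openin_open)
  then show ?thesis using assms(2) by (intro at_within_nhd[of x O']) auto
qed

text \<open>Continuity of \<open>t\<close> is enough: the injective derivative \<open>g'\<close> forces \<open>t\<close> to be Lipschitz at \<open>x\<close>,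
  so that the linear error term of \<open>g\<close> is controlled by \<open>z - x\<close>.\<close>

lemma has_derivative_factor:
  fixes f :: "'a::real_normed_vector \<Rightarrow> 'c::real_normed_vector" and g :: "'b::real_normed_vector \<Rightarrow> 'c"
  assumes df: "(f has_derivative f') (at x within S)"
    and dg: "(g has_derivative g') (at (t x) within T)"
    and tT: "t ` S \<subseteq> T" and x: "x \<in> S" and gt: "\<And>z. z \<in> S \<Longrightarrow> g (t z) = f z"
    and cont: "continuous (at x within S) t" and L: "bounded_linear L" and Lg: "\<And>v. L (g' v) = v"
  shows "(t has_derivative (\<lambda>v. L (f' v))) (at x within S)"
  unfolding has_derivative_within_alt2
proof (intro conjI allI impI)
  have bf: "bounded_linear f'" using df by (rule has_derivative_bounded_linear)
  show "bounded_linear (\<lambda>v. L (f' v))" using bounded_linear_compose[OF L bf] by (simp add: o_def)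
  then obtain M where M: "M > 0" "\<And>v. norm (L (f' v)) \<le> norm v * M"
    using bounded_linear.pos_bounded by blast
  obtain K where K: "K > 0" "\<And>v. norm (L v) \<le> norm v * K"
    using bounded_linear.pos_bounded[OF L] by blast
  fix e :: real assume e: "e > 0"
  \<comment> \<open>The first entry allows half of \<open>norm r\<close> to be absorbed in the
    Lipschitz bound with constant \<open>2 * (M + K)\<close>; the second then makes the error of
    \<open>g\<close> at most half of the permitted one. In \<open>e2\<close> the entry 1 serves the
    Lipschitz bound and the other entry gives the second half.\<close>
  define e1 where "e1 = min (1 / (2 * K)) (e / (4 * K * (M + K)))"
  define e2 where "e2 = min 1 (e / (2 * K))"
  have e1: "e1 > 0" "e1 * K \<le> 1 / 2" "e1 * (4 * K * (M + K)) \<le> e"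
  proof -
    show "e1 > 0" using e K M by (simp add: e1_def)
    have "e1 \<le> 1 / (2 * K)" by (simp add: e1_def)
    then show "e1 * K \<le> 1 / 2" using K by (simp add: field_simps)
    have "e1 \<le> e / (4 * K * (M + K))" by (simp add: e1_def)
    moreover have "4 * K * (M + K) > 0" using K M by simp
    ultimately show "e1 * (4 * K * (M + K)) \<le> e" by (simp add: pos_le_divide_eq)
  qed
  have e2: "e2 > 0" "e2 \<le> 1" "e2 * (2 * K) \<le> e"
  proof -
    show "e2 > 0" "e2 \<le> 1" using e K by (simp_all add: e2_def)
    have "e2 \<le> e / (2 * K)" by (simp add: e2_def)
    then show "e2 * (2 * K) \<le> e" using K by (simp add: pos_le_divide_eq)
  qed
  obtain d where d: "d > 0" "\<And>y. y \<in> T \<Longrightarrow> norm (y - t x) < d \<Longrightarrow> norm (g y - g (t x) - g' (y - t x)) \<le> e1 * norm (y - t x)"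
    using dg e1(1) unfolding has_derivative_within_alt by blast
  have "eventually (\<lambda>z. dist (t z) (t x) < d) (at x within S)"
    using cont d(1) by (auto simp: continuous_within tendsto_iff)
  moreover have "eventually (\<lambda>z. norm (f z - f x - f' (z - x)) \<le> e2 * norm (z - x)) (at x within S)"
    using df e2(1) unfolding has_derivative_within_alt2 by blast
  moreover have "eventually (\<lambda>z. z \<in> S) (at x within S)" by (simp add: eventually_at_filter)
  ultimately show "eventually (\<lambda>z. norm (t z - t x - L (f' (z - x))) \<le> e * norm (z - x)) (at x within S)"
  proof eventually_elim
    case (elim z)
    define r where "r = t z - t x"
    define a where "a = g (t z) - g (t x) - g' r"
    define b where "b = f z - f x - f' (z - x)"
    have na: "norm a \<le> e1 * norm r"
      using d(2)[of "t z"] elim tT by (auto simp: a_def r_def dist_norm)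
    have nb: "norm b \<le> e2 * norm (z - x)" using elim by (simp add: b_def)
    have "f' (z - x) + b = g' r + a" using elim gt x by (simp add: a_def b_def)
    then have "L (f' (z - x)) + L b = r + L a"
      using bounded_linear.linear[OF L] Lg by (metis linear_add)
    then have rr: "r - L (f' (z - x)) = L b - L a" by (simp add: algebra_simps)
    have La: "norm (L a) \<le> e1 * K * norm r"
      using K(2)[of a] mult_right_mono[OF na less_imp_le[OF K(1)]] by (simp add: mult_ac)
    have Lb: "norm (L b) \<le> e2 * K * norm (z - x)"
      using K(2)[of b] mult_right_mono[OF nb less_imp_le[OF K(1)]] by (simp add: mult_ac)
    have "norm r \<le> norm (L (f' (z - x))) + norm (L b) + norm (L a)"
      using rr by (smt (verit, best) norm_triangle_ineq norm_triangle_ineq4 add_diff_cancel diff_add_cancel)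
    also have "\<dots> \<le> norm (z - x) * M + e2 * K * norm (z - x) + e1 * K * norm r"
      using M(2)[of "z - x"] La Lb by linarith
    also have "\<dots> \<le> norm (z - x) * M + 1 * K * norm (z - x) + 1 / 2 * norm r"
      using e1(2) e2(2) K(1) by (intro add_mono mult_right_mono order_refl) auto
    \<comment> \<open>The term with \<open>1 / 2 * norm r\<close> is moved to the left-hand side;
      this is the Lipschitz bound of \<open>t\<close> at \<open>x\<close>.\<close>
    finally have "norm r \<le> 2 * (M + K) * norm (z - x)" by (simp add: algebra_simps)
    then have "e1 * K * norm r \<le> e1 * K * (2 * (M + K) * norm (z - x))"
      using e1(1) K(1) by (intro mult_left_mono) auto
    also have "\<dots> = (e1 * (4 * K * (M + K))) * (norm (z - x) / 2)" by (simp add: algebra_simps)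
    also have "\<dots> \<le> e * (norm (z - x) / 2)" using e1(3) by (intro mult_right_mono) auto
    finally have "norm (L a) \<le> e * (norm (z - x) / 2)" using La by linarith
    moreover have "e2 * K * norm (z - x) \<le> e * (norm (z - x) / 2)"
      using mult_right_mono[OF e2(3), of "norm (z - x) / 2"] by (simp add: mult_ac)
    then have "norm (L b) \<le> e * (norm (z - x) / 2)" using Lb by linarith
    ultimately have "norm (L b - L a) \<le> e * norm (z - x)"
      using norm_triangle_ineq4[of "L b" "L a"] by linarith
    then show ?case using rr by (simp add: r_def)
  qed
qed

text \<open>A parametrization whose image need not be open, such as a boundary chart of one of the two pieces
  regarded as a map into the whole surface.\<close>

definition emb_param ::
  "(real^'k) set \<Rightarrow> 'a topology \<Rightarrow> ('a \<Rightarrow> real^'n) \<Rightarrow> (real^'k) set \<Rightarrow> (real^'k \<Rightarrow> 'a) \<Rightarrow> bool" where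
  "emb_param H X F V \<phi> \<longleftrightarrow>
     openin (top_of_set H) V \<and> homeomorphic_map (top_of_set V) (subtopology X (\<phi> ` V)) \<phi> \<and>
     smooth_on V (F \<circ> \<phi>) \<and> (\<forall>x\<in>V. inj (D V (F \<circ> \<phi>) x))"

lemma local_param_emb: "local_param H X F V \<phi> \<Longrightarrow> emb_param H X F V \<phi>"
  by (simp add: local_param_def emb_param_def)

text \<open>Passing from a piece to the whole space loses only the openness of the image: the image
  lies in \<open>S\<close>, so it inherits the same topology from both.\<close>

lemma local_param_subtopology_emb:
  assumes "local_param H (subtopology X S) F V \<phi>"
  shows "emb_param H X F V \<phi>"
proof -
  have "openin (subtopology X S) (\<phi> ` V)" using assms by (simp add: local_param_def)
  then have "\<phi> ` V \<subseteq> S" using openin_subset by fastforce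
  then have "subtopology (subtopology X S) (\<phi> ` V) = subtopology X (\<phi> ` V)"
    by (simp add: subtopology_subtopology Int_absorb1)
  then show ?thesis using assms by (simp add: local_param_def emb_param_def)
qed

lemma
  assumes "emb_param H X F V \<phi>"
  shows emb_param_openin: "openin (top_of_set H) V"
    and emb_param_inj: "inj_on \<phi> V"
    and emb_param_subset: "\<phi> ` V \<subseteq> topspace X"
    and emb_param_continuous: "continuous_map (top_of_set V) X \<phi>"
    and emb_param_inv_continuous: "continuous_map (subtopology X (\<phi> ` V)) (top_of_set V) (inv_into V \<phi>)"
    and emb_param_smooth: "smooth_on V (F \<circ> \<phi>)"
    and emb_param_imm: "x \<in> V \<Longrightarrow> inj (D V (F \<circ> \<phi>) x)"
proof -
  have h: "homeomorphic_map (top_of_set V) (subtopology X (\<phi> ` V)) \<phi>"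
    using assms by (simp add: emb_param_def)
  show inj: "inj_on \<phi> V" using homeomorphic_imp_injective_map[OF h] by simp
  show "\<phi> ` V \<subseteq> topspace X"
    using homeomorphic_imp_surjective_map[OF h]
    by (metis inf.cobounded1 topspace_subtopology topspace_euclidean_subtopology)
  show "continuous_map (top_of_set V) X \<phi>"
    using homeomorphic_imp_continuous_map[OF h] by (simp add: continuous_map_in_subtopology)
  obtain g where g: "homeomorphic_maps (top_of_set V) (subtopology X (\<phi> ` V)) \<phi> g"
    using h homeomorphic_map_maps by blast
  then have "continuous_map (subtopology X (\<phi> ` V)) (top_of_set V) g"
    by (simp add: homeomorphic_maps_def)
  then show "continuous_map (subtopology X (\<phi> ` V)) (top_of_set V) (inv_into V \<phi>)"
  proof (rule continuous_map_eq)
    fix p assume "p \<in> topspace (subtopology X (\<phi> ` V))"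
    then obtain x where "x \<in> V" "p = \<phi> x" by auto
    then show "g p = inv_into V \<phi> p"
      using g inj by (simp add: homeomorphic_maps_def)
  qed
qed (use assms in \<open>auto simp: emb_param_def\<close>)

text \<open>The asymmetry is deliberate. \<open>\<phi>\<close> may be a boundary chart of a piece;
  \<open>\<psi>\<close> has an open image, which makes \<open>dom\<close> open in
  \<open>V\<close>.\<close>

locale transition =
  fixes H :: "(real^'k) set" and X :: "'a topology" and F :: "'a \<Rightarrow> real^'n" and V \<phi> W \<psi>
  assumes H: "model_space H" and emb: "emb_param H X F V \<phi>" and loc: "local_param H X F W \<psi>"
begin

definition dom where "dom = V \<inter> \<phi> -` (\<psi> ` W)"
definition \<tau> where "\<tau> x = inv_into W \<psi> (\<phi> x)"

lemma emb': "emb_param H X F W \<psi>" using loc by (rule local_param_emb)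

lemma \<tau>: "x \<in> dom \<Longrightarrow> \<tau> x \<in> W" "x \<in> dom \<Longrightarrow> \<psi> (\<tau> x) = \<phi> x"
  unfolding dom_def \<tau>_def by (auto intro: inv_into_into f_inv_into_f)

lemma \<tau>_eq: "x \<in> V \<Longrightarrow> y \<in> W \<Longrightarrow> \<phi> x = \<psi> y \<Longrightarrow> x \<in> dom \<and> \<tau> x = y"
  unfolding dom_def \<tau>_def using emb_param_inj[OF emb'] by auto

lemma openin_dom: "openin (top_of_set V) dom"
proof -
  have "openin X (\<psi> ` W)" using loc by (simp add: local_param_def)
  from openin_continuous_map_preimage[OF emb_param_continuous[OF emb] this]
  show ?thesis unfolding dom_def by (simp add: Int_def vimage_def)
qed

lemma openin_dom_H: "openin (top_of_set H) dom"
  using openin_dom emb_param_openin[OF emb] openin_trans by blast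

lemma continuous_\<tau>: "continuous_on dom \<tau>"
proof -
  have "continuous_map (top_of_set V) X \<phi>" by (rule emb_param_continuous[OF emb])
  then have "continuous_map (subtopology (top_of_set V) dom) X \<phi>"
    by (rule continuous_map_from_subtopology)
  moreover have "subtopology (top_of_set V) dom = top_of_set dom"
    by (simp add: subtopology_subtopology dom_def Int_absorb1)
  ultimately have "continuous_map (top_of_set dom) (subtopology X (\<psi> ` W)) \<phi>"
    by (auto simp: continuous_map_in_subtopology dom_def)
  from continuous_map_compose[OF this emb_param_inv_continuous[OF emb']]
  have "continuous_on dom (inv_into W \<psi> \<circ> \<phi>)" by (simp add: continuous_map_in_subtopology)
  moreover have "inv_into W \<psi> \<circ> \<phi> = \<tau>" by (simp add: fun_eq_iff \<tau>_def)
  ultimately show ?thesis by simp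
qed

lemma inj_\<tau>: "inj_on \<tau> dom"
proof (rule inj_onI)
  fix x y assume "x \<in> dom" "y \<in> dom" "\<tau> x = \<tau> y"
  then have "x \<in> V" "y \<in> V" "\<phi> x = \<phi> y" using \<tau>(2)[of x] \<tau>(2)[of y] by (auto simp: dom_def)
  then show "x = y" using emb_param_inj[OF emb] by (auto dest: inj_onD)
qed

lemma at_dom: "x \<in> dom \<Longrightarrow> at x within dom = at x within V"
  using at_within_openin[OF openin_dom] .

text \<open>Used for the immersion and for the normal field with the same \<open>A\<close>: both
  derivatives transform by one linear map.\<close>

lemma D_via:
  assumes "x \<in> dom" "(\<tau> has_derivative A) (at x within V)" "(Z \<circ> \<psi>) differentiable (at (\<tau> x) within W)"
  shows "((Z \<circ> \<phi>) has_derivative (\<lambda>v. D W (Z \<circ> \<psi>) (\<tau> x) (A v))) (at x within V)"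
    and "D V (Z \<circ> \<phi>) x = (\<lambda>v. D W (Z \<circ> \<psi>) (\<tau> x) (A v))"
proof -
  have "(\<tau> has_derivative A) (at x within dom)" using assms(2) at_dom[OF assms(1)] by simp
  moreover have "((Z \<circ> \<psi>) has_derivative D W (Z \<circ> \<psi>) (\<tau> x)) (at (\<tau> x) within \<tau> ` dom)"
    using \<tau>(1) by (intro has_derivative_subset[OF differentiable_D[OF assms(3)]]) auto
  ultimately have "((Z \<circ> \<psi> \<circ> \<tau>) has_derivative (D W (Z \<circ> \<psi>) (\<tau> x) \<circ> A)) (at x within dom)"
    by (rule diff_chain_within)
  then have "((Z \<circ> \<phi>) has_derivative (D W (Z \<circ> \<psi>) (\<tau> x) \<circ> A)) (at x within dom)"
    by (rule has_derivative_transform_within[of _ _ _ _ 1]) (use assms(1) \<tau> in auto)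
  then show *: "((Z \<circ> \<phi>) has_derivative (\<lambda>v. D W (Z \<circ> \<psi>) (\<tau> x) (A v))) (at x within V)"
    using at_dom[OF assms(1)] by (simp add: o_def)
  show "D V (Z \<circ> \<phi>) x = (\<lambda>v. D W (Z \<circ> \<psi>) (\<tau> x) (A v))"
    by (rule D_eqI[OF H emb_param_openin[OF emb] _ *]) (use assms(1) in \<open>simp add: dom_def\<close>)
qed

text \<open>Since \<open>F \<circ> \<phi>\<close> factors through \<open>F \<circ> \<psi>\<close> by
  \<open>\<tau>\<close>, a linear left inverse of the derivative of \<open>F \<circ> \<psi>\<close>
  yields the derivative of \<open>\<tau>\<close>. It is injective because the derivative of
  \<open>F \<circ> \<phi>\<close> is, and bijective because both coordinate spaces have the same
  dimension.\<close>

lemma \<tau>_derivative: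
  assumes x: "x \<in> dom"
  obtains A where "(\<tau> has_derivative A) (at x within V)" "linear A" "bij A"
    "D V (F \<circ> \<phi>) x = (\<lambda>v. D W (F \<circ> \<psi>) (\<tau> x) (A v))"
proof -
  note sW = emb_param_smooth[OF emb'] and sV = emb_param_smooth[OF emb]
  have xV: "x \<in> V" using x by (simp add: dom_def)
  have dW: "((F \<circ> \<psi>) has_derivative D W (F \<circ> \<psi>) (\<tau> x)) (at (\<tau> x) within W)"
    by (rule smooth_on_has_derivative[OF sW \<tau>(1)[OF x]])
  have dV: "((F \<circ> \<phi>) has_derivative D V (F \<circ> \<phi>) x) (at x within dom)"
    using smooth_on_has_derivative[OF sV xV] at_dom[OF x] by simp
  obtain L where L: "linear L" "L \<circ> D W (F \<circ> \<psi>) (\<tau> x) = id"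
    using linear_injective_left_inverse[OF has_derivative_linear[OF dW] emb_param_imm[OF emb' \<tau>(1)[OF x]]] by blast
  have "(\<tau> has_derivative (\<lambda>v. L (D V (F \<circ> \<phi>) x v))) (at x within dom)"
  proof (rule has_derivative_factor[where t = \<tau> and x = x, OF dV dW])
    show "continuous (at x within dom) \<tau>"
      using continuous_\<tau> x by (simp add: continuous_on_eq_continuous_within)
  qed (use x \<tau> L in \<open>auto simp: linear_conv_bounded_linear fun_eq_iff\<close>)
  then have d: "(\<tau> has_derivative (\<lambda>v. L (D V (F \<circ> \<phi>) x v))) (at x within V)"
    using at_dom[OF x] by simp
  let ?A = "\<lambda>v. L (D V (F \<circ> \<phi>) x v)"
  have eq: "D V (F \<circ> \<phi>) x = (\<lambda>v. D W (F \<circ> \<psi>) (\<tau> x) (?A v))"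
    using D_via(2)[OF x d smooth_on_differentiable[OF sW \<tau>(1)[OF x]]] .
  have lin: "linear ?A" using d by (rule has_derivative_linear)
  have "inj ?A"
  proof (rule injI)
    fix a b assume "?A a = ?A b"
    then have "D V (F \<circ> \<phi>) x a = D V (F \<circ> \<phi>) x b" by (subst (1 2) eq) simp
    then show "a = b" using emb_param_imm[OF emb xV] by (simp add: inj_def)
  qed
  then have "bij ?A" using lin linear_injective_imp_surjective by (blast intro: bijI)
  with d lin eq that show thesis by blast
qed

text \<open>Locally \<open>\<tau>\<close> is the smooth left inverse of
  \<open>F \<circ> \<psi>\<close> applied to \<open>F \<circ> \<phi>\<close>. Openness of
  \<open>W\<close> is what lets the inverse function theorem supply this left inverse.\<close>

lemma smooth_\<tau>:
  assumes "open W"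
  shows "smooth_on dom \<tau>"
proof (rule smooth_on_local)
  fix x assume x: "x \<in> dom"
  obtain T P and h :: "real^'k \<Rightarrow> real^'k" and L :: "real^'n \<Rightarrow> real^'k"
    where *: "open T" "\<tau> x \<in> T" "T \<subseteq> W" "open P" "smooth_on P h" "linear L"
      "\<And>z. z \<in> T \<Longrightarrow> L ((F \<circ> \<psi>) z) \<in> P \<and> h (L ((F \<circ> \<psi>) z)) = z"
    using smooth_local_left_inverse[OF assms emb_param_smooth[OF emb'] \<tau>(1)[OF x] emb_param_imm[OF emb' \<tau>(1)[OF x]]]
    by blast
  let ?S = "dom \<inter> \<tau> -` T"
  have "openin (top_of_set dom) ?S"
    using continuous_\<tau> *(1) by (rule continuous_openin_preimage_gen)
  moreover have "smooth_on ?S \<tau>"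
  proof -
    have bL: "bounded_linear L" using *(6) linear_conv_bounded_linear by blast
    have "smooth_on ?S (F \<circ> \<phi>)"
      by (rule smooth_on_subset[OF emb_param_smooth[OF emb]]) (auto simp: dom_def)
    then have 1: "smooth_on ?S (\<lambda>z. L ((F \<circ> \<phi>) z))"
      by (rule smooth_on_compose_linear[OF bL])
    have 2: "L ((F \<circ> \<phi>) z) \<in> P" "h (L ((F \<circ> \<phi>) z)) = \<tau> z" if "z \<in> ?S" for z
      using *(7)[of "\<tau> z"] that \<tau>(2)[of z] by auto
    have "smooth_on ?S (\<lambda>z. h (L ((F \<circ> \<phi>) z)))"
      by (rule smooth_on_compose[OF *(5) 1]) (use 2(1) in blast)
    then show ?thesis using smooth_on_cong[of ?S "\<lambda>z. h (L ((F \<circ> \<phi>) z))" \<tau>] 2(2) by blast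
  qed
  ultimately show "\<exists>S'. openin (top_of_set dom) S' \<and> x \<in> S' \<and> smooth_on S' \<tau>"
    using x *(2) by (intro exI[of _ ?S]) auto
qed

lemma smooth_via:
  assumes "open W" "smooth_on W (Z \<circ> \<psi>)"
  shows "smooth_on dom (Z \<circ> \<phi>)"
proof -
  have "smooth_on dom (\<lambda>x. (Z \<circ> \<psi>) (\<tau> x))"
    by (rule smooth_on_compose[OF assms(2) smooth_\<tau>[OF assms(1)]]) (use \<tau> in auto)
  then show ?thesis using smooth_on_cong[of dom "\<lambda>x. (Z \<circ> \<psi>) (\<tau> x)" "Z \<circ> \<phi>"] \<tau> by auto
qed

end

subsection \<open>Gram determinants and change of variables\<close>

text \<open>Gram matrices transform by congruence with the matrix of \<open>A\<close>. After the
  square root the factor is the Jacobian of the change of variables.\<close>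

lemma gram_det_factor:
  fixes A :: "real^'k \<Rightarrow> real^'k" and f g :: "real^'k \<Rightarrow> real^'n"
  assumes "linear A" "linear G" "D V f x = (\<lambda>v. G (A v))" "D W g y = G"
  shows "gram_det V f x = (det (matrix A))\<^sup>2 * gram_det W g y"
proof -
  let ?M = "matrix A" and ?g = "\<chi> i j. G (axis i 1) \<bullet> G (axis j 1)"
  have GA: "G (A (axis i 1)) = (\<Sum>k\<in>UNIV. ?M $ k $ i *\<^sub>R G (axis k 1))" for i
  proof -
    have "A (axis i 1) = (\<Sum>k\<in>UNIV. ?M $ k $ i *\<^sub>R axis k 1)"
      by (simp add: matrix_def vec_eq_iff axis_def if_distrib cong: if_cong)
    then show ?thesis using assms(2) by (simp add: linear_sum linear_cmul)
  qed
  have "(\<chi> i j. D V f x (axis i 1) \<bullet> D V f x (axis j 1)) = transpose ?M ** ?g ** ?M"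
    unfolding assms(3)
    by (simp add: GA vec_eq_iff inner_sum_left inner_sum_right matrix_matrix_mult_def transpose_def
        sum_distrib_left sum_distrib_right mult_ac)
  then show ?thesis
    unfolding gram_det_def assms(4) by (simp add: det_mul power2_eq_square)
qed

lemma continuous_on_gram_det:
  assumes "model_space H" "openin (top_of_set H) V" "smooth_on V f"
  shows "continuous_on V (gram_det V f)"
  unfolding gram_det_def det_def
  by (simp, intro continuous_intros smooth_on_continuous_on smooth_on_D[OF assms])

text \<open>Translates between the extended nonnegative integral that defines the measures and the
  absolute integrability in which the change of variables is formulated.\<close>

lemma nonneg_integrable_iff:
  fixes f :: "'a::euclidean_space \<Rightarrow> real"
  assumes "S \<in> sets borel" "(\<lambda>x. indicator S x * f x) \<in> borel_measurable borel" "\<And>x. x \<in> S \<Longrightarrow> f x \<ge> 0"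
  shows "f absolutely_integrable_on S \<longleftrightarrow> (\<integral>\<^sup>+x\<in>S. ennreal (f x) \<partial>lborel) < \<infinity>"
    and "f absolutely_integrable_on S \<Longrightarrow> (\<integral>\<^sup>+x\<in>S. ennreal (f x) \<partial>lborel) = ennreal (integral S f)"
proof -
  let ?f = "\<lambda>x. indicator S x * f x"
  have nn: "?f x \<ge> 0" for x using assms(3) by (auto simp: indicator_def)
  have eq: "(\<integral>\<^sup>+x\<in>S. ennreal (f x) \<partial>lborel) = (\<integral>\<^sup>+x. ennreal (?f x) \<partial>lebesgue)"
    unfolding nn_integral_completion by (intro nn_integral_cong) (auto simp: indicator_def)
  have m: "?f \<in> borel_measurable lebesgue" using assms(2) by (simp add: measurable_completion)
  have ai: "f absolutely_integrable_on S \<longleftrightarrow> integrable lebesgue ?f"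
    by (simp add: set_integrable_def)
  show "f absolutely_integrable_on S \<longleftrightarrow> (\<integral>\<^sup>+x\<in>S. ennreal (f x) \<partial>lborel) < \<infinity>"
    unfolding ai eq integrable_iff_bounded using m nn by simp
  assume a: "f absolutely_integrable_on S"
  then have "(\<integral>\<^sup>+x. ennreal (?f x) \<partial>lebesgue) = ennreal (integral\<^sup>L lebesgue ?f)"
    using ai nn by (intro nn_integral_eq_integral) auto
  also have "integral\<^sup>L lebesgue ?f = integral S f"
    using set_lebesgue_integral_eq_integral(2)[OF a] by (simp add: set_lebesgue_integral_def)
  finally show "(\<integral>\<^sup>+x\<in>S. ennreal (f x) \<partial>lborel) = ennreal (integral S f)" using eq by simp
qed

text \<open>Integrability is equivalent on the two sides, with equal integrals. For nonnegative
  integrands the other case means that both integrals are infinite, so equality holds without any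
  finiteness assumption.\<close>

lemma nn_integral_change_of_variables:
  fixes g :: "real^'k::{finite,wellorder} \<Rightarrow> real^'k::_" and h :: "real^'k::_ \<Rightarrow> real"
  assumes S: "S \<in> sets borel" and gS: "g ` S \<in> sets borel"
    and dg: "\<And>x. x \<in> S \<Longrightarrow> (g has_derivative g' x) (at x within S)" and inj: "inj_on g S"
    and h: "(\<lambda>y. indicator (g ` S) y * h y) \<in> borel_measurable borel" "\<And>y. y \<in> g ` S \<Longrightarrow> h y \<ge> 0"
    and hg: "(\<lambda>x. indicator S x * (\<bar>det (matrix (g' x))\<bar> * h (g x))) \<in> borel_measurable borel"
  shows "(\<integral>\<^sup>+y\<in>g ` S. ennreal (h y) \<partial>lborel) = (\<integral>\<^sup>+x\<in>S. ennreal (\<bar>det (matrix (g' x))\<bar> * h (g x)) \<partial>lborel)"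
proof -
  let ?D = "\<lambda>x. \<bar>det (matrix (g' x))\<bar> * h (g x)"
  have SL: "S \<in> sets lebesgue" using S by simp
  have *: "(\<lambda>x. \<bar>det (matrix (g' x))\<bar> *\<^sub>R (vec (h (g x)) :: real^1)) = (\<lambda>x. vec (?D x))"
    by (simp add: vec_eq_iff fun_eq_iff)
  have cov: "?D absolutely_integrable_on S \<and> integral S ?D = b \<longleftrightarrow>
        h absolutely_integrable_on (g ` S) \<and> integral (g ` S) h = b" for b
    using has_absolute_integral_change_of_variables[OF SL dg inj, of "\<lambda>y. vec (h y) :: real^1" "vec b"]
    unfolding * by (simp add: absolutely_integrable_on_1_iff integral_on_1_eq vec_eq_iff)
  have nD: "\<And>x. x \<in> S \<Longrightarrow> ?D x \<ge> 0" using h(2) by simp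
  note i1 = nonneg_integrable_iff[OF gS h(1), OF h(2)] and i2 = nonneg_integrable_iff[OF S hg, OF nD]
  show ?thesis
  proof (cases "h absolutely_integrable_on (g ` S)")
    case True
    then have "?D absolutely_integrable_on S" "integral S ?D = integral (g ` S) h" using cov by blast+
    then show ?thesis using i1(2) i2(2) True by simp
  next
    case False
    then have "\<not> ?D absolutely_integrable_on S" using cov by blast
    then have "(\<integral>\<^sup>+x\<in>S. ennreal (?D x) \<partial>lborel) = \<infinity>" using i2(1) by (simp add: less_top[symmetric])
    moreover have "(\<integral>\<^sup>+y\<in>g ` S. ennreal (h y) \<partial>lborel) = \<infinity>" using False i1(1) by (simp add: less_top[symmetric])
    ultimately show ?thesis by simp
  qed
qed

section \<open>The measure induced by a single parametrization\<close>

abbreviation borel_sets :: "'a topology \<Rightarrow> 'a set set" where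
  "borel_sets X \<equiv> sigma_sets (topspace X) {U. openin X U}"

definition chart_measure :: "('a \<Rightarrow> real^'n) \<Rightarrow> (real^'k) set \<Rightarrow> (real^'k \<Rightarrow> 'a) \<Rightarrow> 'a set \<Rightarrow> ennreal" where
  "chart_measure F V \<phi> A = (\<integral>\<^sup>+ x \<in> V \<inter> \<phi> -` A. ennreal (sqrt (gram_det V (F \<circ> \<phi>) x)) \<partial>lborel)"

lemma sigma_algebra_borel_sets: "sigma_algebra (topspace X) (borel_sets X)"
  by (rule sigma_algebra_sigma_sets) (auto dest: openin_subset)

lemma emb_param_vimage_borel:
  assumes "model_space H" "emb_param H X F V \<phi>" "A \<in> borel_sets X"
  shows "V \<inter> \<phi> -` A \<in> sets borel"
  using assms(3)
proof induction
  case (Basic U)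
  then have "openin (top_of_set V) {x \<in> topspace (top_of_set V). \<phi> x \<in> U}"
    using openin_continuous_map_preimage[OF emb_param_continuous[OF assms(2)]] by blast
  then have "openin (top_of_set V) (V \<inter> \<phi> -` U)" by (simp add: Int_def vimage_def)
  then show ?case
    using openin_trans[OF _ emb_param_openin[OF assms(2)]] openin_model_borel[OF assms(1)] by blast
next
  case (Compl U)
  have "V \<inter> \<phi> -` (topspace X - U) = V - (V \<inter> \<phi> -` U)"
    using emb_param_subset[OF assms(2)] by auto
  then show ?case
    using Compl.IH openin_model_borel[OF assms(1) emb_param_openin[OF assms(2)]] by auto
next
  case (Union U)
  have "V \<inter> \<phi> -` (\<Union>i. U i) = (\<Union>i. V \<inter> \<phi> -` U i)" by auto
  moreover have "(\<Union>i. V \<inter> \<phi> -` U i) \<in> sets borel" by (intro sets.countable_UN) (use Union.IH in auto)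
  ultimately show ?case by simp
qed simp

lemma gram_sqrt_measurable:
  assumes "model_space H" "emb_param H X F V \<phi>" "S \<in> sets borel" "S \<subseteq> V"
  shows "(\<lambda>x. indicator S x * sqrt (gram_det V (F \<circ> \<phi>) x)) \<in> borel_measurable borel"
proof -
  have "continuous_on S (\<lambda>x. sqrt (gram_det V (F \<circ> \<phi>) x))"
    using continuous_on_gram_det[OF assms(1) emb_param_openin[OF assms(2)] emb_param_smooth[OF assms(2)]] assms(4)
    by (intro continuous_intros) (rule continuous_on_subset)
  from borel_measurable_continuous_on_indicator[OF assms(3) this] show ?thesis by simp
qed

text \<open>A genuine measure on the coordinate space, from which \<open>chart_measure\<close>
  inherits countable additivity.\<close>

definition chart_density :: "('a \<Rightarrow> real^'n) \<Rightarrow> (real^'k) set \<Rightarrow> (real^'k \<Rightarrow> 'a) \<Rightarrow> (real^'k) measure" where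
  "chart_density F V \<phi> = density lborel (\<lambda>x. ennreal (indicator V x * sqrt (gram_det V (F \<circ> \<phi>) x)))"

lemma emeasure_chart_density:
  assumes "model_space H" "emb_param H X F V \<phi>" "A \<in> borel_sets X"
  shows "emeasure (chart_density F V \<phi>) (V \<inter> \<phi> -` A) = chart_measure F V \<phi> A"
proof -
  have V: "V \<in> sets borel" by (rule openin_model_borel[OF assms(1) emb_param_openin[OF assms(2)]])
  have "emeasure (chart_density F V \<phi>) (V \<inter> \<phi> -` A) =
      (\<integral>\<^sup>+ x \<in> V \<inter> \<phi> -` A. ennreal (indicator V x * sqrt (gram_det V (F \<circ> \<phi>) x)) \<partial>lborel)"
    unfolding chart_density_def
    using gram_sqrt_measurable[OF assms(1,2) V] emb_param_vimage_borel[OF assms]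
    by (intro emeasure_density) auto
  also have "\<dots> = chart_measure F V \<phi> A"
    unfolding chart_measure_def by (intro nn_integral_cong) (auto simp: indicator_def)
  finally show ?thesis .
qed

lemma chart_measure_suminf:
  assumes "model_space H" "emb_param H X F V \<phi>" "\<And>i. A i \<in> borel_sets X" "disjoint_family A"
  shows "(\<Sum>i. chart_measure F V \<phi> (A i)) = chart_measure F V \<phi> (\<Union>i::nat. A i)"
proof -
  have "(\<Sum>i. emeasure (chart_density F V \<phi>) (V \<inter> \<phi> -` A i)) =
      emeasure (chart_density F V \<phi>) (\<Union>i. V \<inter> \<phi> -` A i)"
    using emb_param_vimage_borel[OF assms(1-3)] assms(4)
    by (intro suminf_emeasure) (auto simp: chart_density_def disjoint_family_on_def)
  also have "(\<Union>i. V \<inter> \<phi> -` A i) = V \<inter> \<phi> -` (\<Union>i. A i)" by auto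
  finally show ?thesis
    using assms(3) by (simp add: emeasure_chart_density[OF assms(1,2)] sigma_sets.Union)
qed

lemma ennreal_max_zero: "ennreal (max 0 r) = ennreal r"
  by (auto simp: max_def ennreal_neg)

text \<open>Change of variables along \<open>\<tau>\<close>: it maps the coordinates of
  \<open>A\<close> under \<open>\<phi>\<close> onto those under \<open>\<psi>\<close>, and its
  Jacobian is exactly the ratio of the two Gram densities.\<close>

lemma chart_measure_transition:
  fixes H :: "(real^'k::{finite,wellorder}) set" and F :: "'a \<Rightarrow> real^'n"
  assumes H: "model_space H" and emb: "emb_param H X F V \<phi>" and loc: "local_param H X F W \<psi>"
    and A: "A \<in> borel_sets X" "A \<subseteq> \<phi> ` V" "A \<subseteq> \<psi> ` W"
  shows "chart_measure F V \<phi> A = chart_measure F W \<psi> A"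
proof -
  interpret transition H X F V \<phi> W \<psi> using H emb loc by unfold_locales
  define S where "S = V \<inter> \<phi> -` A"
  have Sdom: "S \<subseteq> dom" using A(3) by (auto simp: S_def dom_def)
  have img: "\<tau> ` S = W \<inter> \<psi> -` A"
  proof (intro equalityI subsetI)
    fix y assume "y \<in> \<tau> ` S"
    then obtain x where "x \<in> S" "y = \<tau> x" by auto
    then show "y \<in> W \<inter> \<psi> -` A" using \<tau>[of x] Sdom by (auto simp: S_def)
  next
    fix y assume y: "y \<in> W \<inter> \<psi> -` A"
    then obtain x where "x \<in> V" "\<psi> y = \<phi> x" using A(2) by auto
    then show "y \<in> \<tau> ` S" using \<tau>_eq[of x y] y by (auto simp: S_def)
  qed
  define A' where "A' x = (SOME A. (\<tau> has_derivative A) (at x within V) \<and> linear A \<and>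
     D V (F \<circ> \<phi>) x = (\<lambda>v. D W (F \<circ> \<psi>) (\<tau> x) (A v)))" for x
  have A': "(\<tau> has_derivative A' x) (at x within V)" "linear (A' x)"
     "D V (F \<circ> \<phi>) x = (\<lambda>v. D W (F \<circ> \<psi>) (\<tau> x) (A' x v))" if "x \<in> S" for x
  proof -
    have "x \<in> dom" using that Sdom by auto
    then have "\<exists>A. (\<tau> has_derivative A) (at x within V) \<and> linear A \<and>
       D V (F \<circ> \<phi>) x = (\<lambda>v. D W (F \<circ> \<psi>) (\<tau> x) (A v))"
      using \<tau>_derivative by metis
    from someI_ex[OF this] show "(\<tau> has_derivative A' x) (at x within V)" "linear (A' x)"
       "D V (F \<circ> \<phi>) x = (\<lambda>v. D W (F \<circ> \<psi>) (\<tau> x) (A' x v))"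
      by (simp_all add: A'_def)
  qed
  have gram: "\<bar>det (matrix (A' x))\<bar> * sqrt (gram_det W (F \<circ> \<psi>) (\<tau> x)) = sqrt (gram_det V (F \<circ> \<phi>) x)"
    if "x \<in> S" for x
  proof -
    have "linear (D W (F \<circ> \<psi>) (\<tau> x))"
      using smooth_on_has_derivative[OF emb_param_smooth[OF emb'] \<tau>(1)] that Sdom has_derivative_linear by blast
    from gram_det_factor[OF A'(2)[OF that] this A'(3)[OF that] refl]
    show ?thesis by (simp add: real_sqrt_mult)
  qed
  let ?g = "\<lambda>y. sqrt (gram_det W (F \<circ> \<psi>) y)"
  have Sb: "S \<in> sets borel" unfolding S_def by (rule emb_param_vimage_borel[OF H emb A(1)])
  have Tb: "\<tau> ` S \<in> sets borel" unfolding img by (rule emb_param_vimage_borel[OF H emb' A(1)])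
  \<comment> \<open>In HOL \<open>sqrt\<close> takes negative values at negative arguments.
    Truncating with \<open>max 0\<close> provides the nonnegativity that the change of variables
    asks for, and \<open>ennreal\<close> does not see the difference.\<close>
  have "chart_measure F W \<psi> A = (\<integral>\<^sup>+y\<in>\<tau> ` S. ennreal (max 0 (?g y)) \<partial>lborel)"
    by (simp only: chart_measure_def img ennreal_max_zero)
  also have "\<dots> = (\<integral>\<^sup>+x\<in>S. ennreal (\<bar>det (matrix (A' x))\<bar> * max 0 (?g (\<tau> x))) \<partial>lborel)"
  proof (rule nn_integral_change_of_variables[OF Sb Tb])
    show "(\<tau> has_derivative A' x) (at x within S)" if "x \<in> S" for x
      by (rule has_derivative_subset[OF A'(1)[OF that]]) (auto simp: S_def)
    show "inj_on \<tau> S" using inj_\<tau> Sdom by (rule inj_on_subset)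
    have m: "(\<lambda>y. max 0 (indicator (\<tau> ` S) y * ?g y)) \<in> borel_measurable borel"
      using gram_sqrt_measurable[OF H emb' Tb] by (intro borel_measurable_max) (auto simp: img)
    have "(\<lambda>y. max 0 (indicator (\<tau> ` S) y * ?g y)) = (\<lambda>y. indicator (\<tau> ` S) y * max 0 (?g y))"
      by (auto simp: fun_eq_iff indicator_def)
    with m show "(\<lambda>y. indicator (\<tau> ` S) y * max 0 (?g y)) \<in> borel_measurable borel" by simp
    have m: "(\<lambda>x. max 0 (indicator S x * sqrt (gram_det V (F \<circ> \<phi>) x))) \<in> borel_measurable borel"
      using gram_sqrt_measurable[OF H emb Sb] by (intro borel_measurable_max) (auto simp: S_def)
    have "(\<lambda>x. max 0 (indicator S x * sqrt (gram_det V (F \<circ> \<phi>) x))) =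
        (\<lambda>x. indicator S x * (\<bar>det (matrix (A' x))\<bar> * max 0 (?g (\<tau> x))))"
      by (auto simp: fun_eq_iff indicator_def max_mult_distrib_left simp flip: gram)
    with m show "(\<lambda>x. indicator S x * (\<bar>det (matrix (A' x))\<bar> * max 0 (?g (\<tau> x)))) \<in> borel_measurable borel"
      by simp
  qed simp
  also have "\<dots> = chart_measure F V \<phi> A"
    unfolding chart_measure_def S_def[symmetric]
  proof (intro nn_integral_cong)
    fix x
    have "\<bar>det (matrix (A' x))\<bar> * max 0 (?g (\<tau> x)) = max 0 (sqrt (gram_det V (F \<circ> \<phi>) x))" if "x \<in> S"
      using gram[OF that] by (simp add: max_mult_distrib_left)
    then have "ennreal (\<bar>det (matrix (A' x))\<bar> * max 0 (?g (\<tau> x))) = ennreal (sqrt (gram_det V (F \<circ> \<phi>) x))" if "x \<in> S"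
      using that ennreal_max_zero by metis
    then show "ennreal (\<bar>det (matrix (A' x))\<bar> * max 0 (?g (\<tau> x))) * indicator S x =
        ennreal (sqrt (gram_det V (F \<circ> \<phi>) x)) * indicator S x"
      by (cases "x \<in> S") simp_all
  qed
  finally show ?thesis ..
qed

subsection \<open>The Riemannian measure\<close>

definition atlas_seq ::
  "(real^'k) set \<Rightarrow> 'a topology \<Rightarrow> ('a \<Rightarrow> real^'n) \<Rightarrow> (nat \<Rightarrow> (real^'k) set) \<Rightarrow> (nat \<Rightarrow> real^'k \<Rightarrow> 'a) \<Rightarrow> bool" where
  "atlas_seq H X F Vs \<phi>s \<longleftrightarrow>
     (\<forall>n. local_param H X F (Vs n) (\<phi>s n)) \<and> (\<Union>n. \<phi>s n ` Vs n) = topspace X"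

text \<open>The empty chart pads a countable atlas that might itself be empty, so that it can be
  enumerated as a sequence.\<close>

lemma local_param_empty: "local_param H X F {} \<phi>"
  by (auto simp: local_param_def smooth_on_def homeomorphic_map_def quotient_map_def)

text \<open>A second countable space is Lindelof, so countably many of the open chart images cover
  it.\<close>

lemma immersed_atlas:
  assumes "immersed H X F"
  obtains Vs \<phi>s where "atlas_seq H X F Vs \<phi>s"
proof -
  let ?P = "\<lambda>U. \<exists>V \<phi>. local_param H X F V \<phi> \<and> U = \<phi> ` V"
  have op: "openin X U" if "?P U" for U using that by (auto simp: local_param_def)
  have "\<Union>{U. ?P U} = topspace X"
  proof (intro equalityI subsetI)
    fix p assume "p \<in> topspace X"
    then obtain V \<phi> where "local_param H X F V \<phi>" "p \<in> \<phi> ` V" using assms by (auto simp: immersed_def)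
    then show "p \<in> \<Union>{U. ?P U}" by blast
  qed (use op openin_subset in blast)
  moreover have "Lindelof_space X"
    using assms by (simp add: immersed_def second_countable_imp_Lindelof_space)
  moreover have "\<forall>U\<in>{U. ?P U}. openin X U" using op by blast
  ultimately have "\<exists>\<U>. countable \<U> \<and> \<U> \<subseteq> {U. ?P U} \<and> \<Union>\<U> = topspace X"
    unfolding Lindelof_space_def by presburger
  then obtain \<U> where U: "countable \<U>" "\<U> \<subseteq> {U. ?P U}" "\<Union>\<U> = topspace X" by (elim exE conjE)
  define \<V> where "\<V> = insert {} \<U>"
  have "?P {}" by (intro exI[of _ "{}"] exI[of _ "\<lambda>x. undefined"]) (simp add: local_param_empty)
  then have P: "?P U" if "U \<in> \<V>" for U using that U(2) by (auto simp only: \<V>_def insert_iff mem_Collect_eq subset_iff)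
  have V: "countable \<V>" "\<V> \<noteq> {}" "\<Union>\<V> = topspace X"
    using U(1,3) by (auto simp: \<V>_def)
  have "?P (from_nat_into \<V> n)" for n using P from_nat_into[OF V(2), of n] .
  then obtain Vs \<phi>s where *: "\<And>n. local_param H X F (Vs n) (\<phi>s n) \<and> from_nat_into \<V> n = \<phi>s n ` Vs n"
    by metis
  have "(\<Union>n. \<phi>s n ` Vs n) = (\<Union>n. from_nat_into \<V> n)" using * by simp
  also have "\<dots> = topspace X" using V(3) range_from_nat_into[OF V(2,1)] by simp
  finally have "atlas_seq H X F Vs \<phi>s" using * by (simp add: atlas_seq_def)
  then show thesis by (rule that)
qed

lemma openin_borel_sets: "openin X U \<Longrightarrow> U \<in> borel_sets X"
  by (auto intro: sigma_sets.Basic)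

lemma closedin_borel_sets: "closedin X C \<Longrightarrow> C \<in> borel_sets X"
proof -
  assume C: "closedin X C"
  then have "topspace X - (topspace X - C) \<in> borel_sets X"
    by (intro sigma_sets.Compl openin_borel_sets) (auto simp: closedin_def)
  moreover have "topspace X - (topspace X - C) = C" using closedin_subset[OF C] by auto
  ultimately show ?thesis by simp
qed

context
  fixes H :: "(real^'k::{finite,wellorder}) set" and X :: "'a topology" and F :: "'a \<Rightarrow> real^'n"
    and Vs :: "nat \<Rightarrow> (real^'k::_) set" and \<phi>s :: "nat \<Rightarrow> real^'k::_ \<Rightarrow> 'a"
  assumes H: "model_space H" and atlas: "atlas_seq H X F Vs \<phi>s"
begin

text \<open>Disjoint Borel sets, each inside one chart, on which a measure can be prescribed chart
  by chart. They are unrelated to the two pieces cut out by the ball.\<close>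

definition piece :: "nat \<Rightarrow> 'a set" where
  "piece = disjointed (\<lambda>n. \<phi>s n ` Vs n)"

lemma atlas_local_param: "local_param H X F (Vs n) (\<phi>s n)"
  using atlas by (simp add: atlas_seq_def)

lemma piece: "disjoint_family piece" "(\<Union>n. piece n) = topspace X" "piece n \<subseteq> \<phi>s n ` Vs n" "piece n \<in> borel_sets X"
proof -
  show "disjoint_family piece" unfolding piece_def by (rule disjoint_family_disjointed)
  show "(\<Union>n. piece n) = topspace X"
    using atlas by (simp add: piece_def UN_disjointed_eq atlas_seq_def)
  show "piece n \<subseteq> \<phi>s n ` Vs n" unfolding piece_def by (rule disjointed_subset)
  interpret sigma_algebra "topspace X" "borel_sets X" by (rule sigma_algebra_borel_sets)
  have "range (\<lambda>n. \<phi>s n ` Vs n) \<subseteq> borel_sets X"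
    using atlas_local_param by (auto simp: local_param_def intro!: openin_borel_sets)
  from range_disjointed_sets[OF this] show "piece n \<in> borel_sets X" by (auto simp: piece_def)
qed

lemma piece_decomp:
  assumes "A \<in> borel_sets X"
  shows "A = (\<Union>n. A \<inter> piece n)" "A \<inter> piece n \<in> borel_sets X" "disjoint_family (\<lambda>n. A \<inter> piece n)"
proof -
  interpret sigma_algebra "topspace X" "borel_sets X" by (rule sigma_algebra_borel_sets)
  have "A \<subseteq> topspace X" using assms sets_into_space by blast
  then show "A = (\<Union>n. A \<inter> piece n)" using piece(2) by auto
  show "A \<inter> piece n \<in> borel_sets X" using assms piece(4) by auto
  show "disjoint_family (\<lambda>n. A \<inter> piece n)" using piece(1) by (auto simp: disjoint_family_on_def)
qed

lemma emeasure_pieces: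
  assumes "sets M = borel_sets X" "A \<in> borel_sets X"
  shows "emeasure M A = (\<Sum>n. emeasure M (A \<inter> piece n))"
proof -
  have "(\<Sum>n. emeasure M (A \<inter> piece n)) = emeasure M (\<Union>n. A \<inter> piece n)"
    using piece_decomp[OF assms(2)] assms(1) by (intro suminf_emeasure) auto
  then show ?thesis using piece_decomp(1)[OF assms(2)] by simp
qed

text \<open>On each disjoint part \<open>\<phi>\<close> may be exchanged for the chart of the atlas,
  and countable additivity reassembles \<open>A\<close>. As \<open>\<phi>\<close> is only embedded,
  this covers boundary charts of a piece.\<close>

lemma emeasure_emb_param:
  assumes M: "sets M = borel_sets X"
    and spec: "\<And>n A. A \<in> borel_sets X \<Longrightarrow> A \<subseteq> piece n \<Longrightarrow> emeasure M A = chart_measure F (Vs n) (\<phi>s n) A"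
    and emb: "emb_param H X F V \<phi>" and A: "A \<in> borel_sets X" "A \<subseteq> \<phi> ` V"
  shows "emeasure M A = chart_measure F V \<phi> A"
proof -
  note d = piece_decomp[OF A(1)]
  have "emeasure M (A \<inter> piece n) = chart_measure F V \<phi> (A \<inter> piece n)" for n
  proof -
    have "A \<inter> piece n \<subseteq> \<phi> ` V" "A \<inter> piece n \<subseteq> \<phi>s n ` Vs n" using A(2) piece(3)[of n] by blast+
    then show ?thesis
      using spec[OF d(2), of n n] chart_measure_transition[OF H emb atlas_local_param d(2), of n n] by simp
  qed
  then have "emeasure M A = (\<Sum>n. chart_measure F V \<phi> (A \<inter> piece n))"
    using emeasure_pieces[OF M A(1)] by simp
  also have "\<dots> = chart_measure F V \<phi> (\<Union>n. A \<inter> piece n)"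
    by (rule chart_measure_suminf[OF H emb d(2,3)])
  also have "(\<Union>n. A \<inter> piece n) = A" using d(1) by simp
  finally show ?thesis .
qed

definition glued :: "'a set \<Rightarrow> ennreal" where
  "glued A = (\<Sum>n. chart_measure F (Vs n) (\<phi>s n) (A \<inter> piece n))"

definition glued_measure :: "'a measure" where
  "glued_measure = measure_of (topspace X) (borel_sets X) glued"

lemma glued_measure_sets: "space glued_measure = topspace X" "sets glued_measure = borel_sets X"
proof -
  have "borel_sets X \<subseteq> Pow (topspace X)"
    using sigma_algebra_borel_sets[of X] by (simp add: sigma_algebra_iff2)
  then show "space glued_measure = topspace X" "sets glued_measure = borel_sets X"
    unfolding glued_measure_def using sigma_algebra.sigma_sets_eq[OF sigma_algebra_borel_sets, of X]
    by (auto simp: space_measure_of_conv)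
qed

lemma emeasure_glued_measure:
  assumes "A \<in> borel_sets X"
  shows "emeasure glued_measure A = glued A"
  unfolding glued_measure_def
proof (rule emeasure_measure_of_sigma[OF sigma_algebra_borel_sets _ _ assms])
  show "positive (borel_sets X) glued" by (simp add: positive_def glued_def chart_measure_def)
  show "countably_additive (borel_sets X) glued"
    unfolding countably_additive_def
  proof (intro allI impI)
    fix A :: "nat \<Rightarrow> 'a set"
    assume A: "range A \<subseteq> borel_sets X" "disjoint_family A"
    let ?c = "\<lambda>n. chart_measure F (Vs n) (\<phi>s n)"
    \<comment> \<open>The double series of nonnegative terms is rearranged by reading the outer sum
      as an integral over the counting measure.\<close>
    have "(\<Sum>i. glued (A i)) = (\<integral>\<^sup>+i. (\<Sum>n. ?c n (A i \<inter> piece n)) \<partial>count_space UNIV)"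
      by (simp add: nn_integral_count_space_nat glued_def)
    also have "\<dots> = (\<Sum>n. \<integral>\<^sup>+i. ?c n (A i \<inter> piece n) \<partial>count_space UNIV)"
      by (rule nn_integral_suminf) simp
    also have "\<dots> = (\<Sum>n. \<Sum>i. ?c n (A i \<inter> piece n))"
      by (simp add: nn_integral_count_space_nat)
    also have "\<dots> = (\<Sum>n. ?c n (\<Union>i. A i \<inter> piece n))"
    proof -
      have "(\<Sum>i. ?c n (A i \<inter> piece n)) = ?c n (\<Union>i. A i \<inter> piece n)" for n
        by (rule chart_measure_suminf[OF H local_param_emb[OF atlas_local_param]])
           (use A in \<open>auto simp: disjoint_family_on_def image_subset_iff intro: piece_decomp(2)\<close>)
      then show ?thesis by simp
    qed
    also have "\<dots> = glued (\<Union>i. A i)" by (simp add: glued_def)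
    finally show "(\<Sum>i. glued (A i)) = glued (\<Union>i. A i)" .
  qed
qed

lemma emeasure_glued_piece:
  assumes "A \<in> borel_sets X" "A \<subseteq> piece n"
  shows "emeasure glued_measure A = chart_measure F (Vs n) (\<phi>s n) A"
proof -
  have "A \<inter> piece m = {}" if "m \<noteq> n" for m
    using assms(2) piece(1) that by (fastforce simp: disjoint_family_on_def)
  then have "glued A = (\<Sum>m\<in>{n}. chart_measure F (Vs m) (\<phi>s m) (A \<inter> piece m))"
    unfolding glued_def by (intro suminf_finite) (auto simp: chart_measure_def)
  then show ?thesis using emeasure_glued_measure[OF assms(1)] by (simp add: Int_absorb2[OF assms(2)])
qed

end

section \<open>Existence, uniqueness and restriction of the Riemannian measure\<close>

definition volume_spec :: "(real^'k) set \<Rightarrow> 'a topology \<Rightarrow> ('a \<Rightarrow> real^'n) \<Rightarrow> 'a measure \<Rightarrow> bool" where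
  "volume_spec H X F M \<longleftrightarrow>
     space M = topspace X \<and> sets M = sigma_sets (topspace X) {U. openin X U} \<and>
     (\<forall>V \<phi> A. local_param H X F V \<phi> \<and> A \<in> sets M \<and> A \<subseteq> \<phi> ` V \<longrightarrow> emeasure M A = chart_measure F V \<phi> A)"

lemma volume_specD:
  assumes "volume_spec H X F M" "local_param H X F V \<phi>" "A \<in> borel_sets X" "A \<subseteq> \<phi> ` V"
  shows "emeasure M A = chart_measure F V \<phi> A"
proof -
  have "A \<in> sets M" using assms(1,3) unfolding volume_spec_def by simp
  then show ?thesis using assms unfolding volume_spec_def by blast
qed

lemma volume_spec_unique:
  fixes H :: "(real^'k::{finite,wellorder}) set"
  assumes "model_space H" "immersed H X F" "volume_spec H X F M" "volume_spec H X F N"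
  shows "M = N"
proof -
  obtain Vs \<phi>s where at: "atlas_seq H X F Vs \<phi>s" using immersed_atlas[OF assms(2)] by blast
  note H = assms(1) and M = assms(3) and N = assms(4)
  have s: "sets M = borel_sets X" "sets N = borel_sets X" using M N by (simp_all add: volume_spec_def)
  show ?thesis
  proof (rule measure_eqI)
    fix A assume "A \<in> sets M"
    then have A: "A \<in> borel_sets X" using s by simp
    have "emeasure M (A \<inter> piece Vs \<phi>s n) = emeasure N (A \<inter> piece Vs \<phi>s n)" for n
    proof -
      have "A \<inter> piece Vs \<phi>s n \<in> borel_sets X" "A \<inter> piece Vs \<phi>s n \<subseteq> \<phi>s n ` Vs n"
        using piece_decomp(2)[OF H at A] piece(3)[OF H at] by blast+
      then show ?thesis
        using volume_specD[OF M atlas_local_param[OF H at]] volume_specD[OF N atlas_local_param[OF H at]] by simp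
    qed
    then show "emeasure M A = emeasure N A"
      using emeasure_pieces[OF H at s(1) A] emeasure_pieces[OF H at s(2) A] by simp
  qed (use s in simp)
qed

text \<open>Gluing shows existence and the disjoint decomposition shows uniqueness; together they
  unlock the definite description in \<open>volume_measure\<close>.\<close>

lemma volume_measure_spec:
  fixes H :: "(real^'k::{finite,wellorder}) set"
  assumes "model_space H" "immersed H X F"
  shows "volume_spec H X F (volume_measure H X F)"
proof -
  obtain Vs \<phi>s where at: "atlas_seq H X F Vs \<phi>s" using immersed_atlas[OF assms(2)] by blast
  let ?M = "glued_measure X F Vs \<phi>s"
  have vs: "volume_spec H X F ?M"
    unfolding volume_spec_def
  proof (intro conjI allI impI)
    note sp = glued_measure_sets[OF assms(1) at]
    show "space ?M = topspace X" "sets ?M = borel_sets X" by (fact sp)+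
    fix V \<phi> A assume "local_param H X F V \<phi> \<and> A \<in> sets ?M \<and> A \<subseteq> \<phi> ` V"
    then have "emb_param H X F V \<phi>" "A \<in> borel_sets X" "A \<subseteq> \<phi> ` V"
      using sp(2) by (auto simp: local_param_emb)
    then show "emeasure ?M A = chart_measure F V \<phi> A"
      using emeasure_emb_param[OF assms(1) at sp(2) emeasure_glued_piece[OF assms(1) at]] by blast
  qed
  then have "\<exists>!M. volume_spec H X F M" by (rule ex1I) (rule volume_spec_unique[OF assms _ vs])
  from theI'[OF this] show ?thesis
    unfolding volume_measure_def volume_spec_def chart_measure_def .
qed

lemma volume_measure_eqI:
  fixes H :: "(real^'k::{finite,wellorder}) set"
  assumes "model_space H" "immersed H X F" "volume_spec H X F M"
  shows "volume_measure H X F = M"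
  using volume_spec_unique[OF assms(1,2) volume_measure_spec[OF assms(1,2)] assms(3)] .

lemma volume_measure_sets:
  fixes H :: "(real^'k::{finite,wellorder}) set"
  assumes "model_space H" "immersed H X F"
  shows "space (volume_measure H X F) = topspace X" "sets (volume_measure H X F) = borel_sets X"
  using volume_measure_spec[OF assms] by (simp_all add: volume_spec_def)

lemma emeasure_volume_emb:
  fixes H :: "(real^'k::{finite,wellorder}) set"
  assumes "model_space H" "immersed H X F" "emb_param H X F V \<phi>" "A \<in> borel_sets X" "A \<subseteq> \<phi> ` V"
  shows "emeasure (volume_measure H X F) A = chart_measure F V \<phi> A"
proof -
  obtain Vs \<phi>s where at: "atlas_seq H X F Vs \<phi>s" using immersed_atlas[OF assms(2)] by blast
  show ?thesis
  proof (rule emeasure_emb_param[OF assms(1) at volume_measure_sets(2)[OF assms(1,2)] _ assms(3-5)])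
    fix n B assume B: "B \<in> borel_sets X" "B \<subseteq> piece Vs \<phi>s n"
    then show "emeasure (volume_measure H X F) B = chart_measure F (Vs n) (\<phi>s n) B"
      using piece(3)[OF assms(1) at, of n]
      by (intro volume_specD[OF volume_measure_spec[OF assms(1,2)] atlas_local_param[OF assms(1) at]]) auto
  qed
qed

lemma borel_sets_subtopology:
  assumes "topspace X \<inter> S \<in> borel_sets X"
  shows "borel_sets (subtopology X S) = (\<inter>) (topspace X \<inter> S) ` borel_sets X"
proof -
  have "{U. openin (subtopology X S) U} = (\<inter>) (topspace X \<inter> S) ` {U. openin X U}"
    by (auto simp: openin_subtopology image_iff dest: openin_subset)
  then show ?thesis using sigma_sets_Int[OF assms] by simp
qed

text \<open>The restricted measure satisfies the specification for the subspace, because the charts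
  of the subspace are embedded parametrizations of \<open>X\<close> and the measure of
  \<open>X\<close> is already known to be given by the Gram density there.\<close>

lemma volume_measure_subtopology:
  fixes H :: "(real^'k::{finite,wellorder}) set"
  assumes "model_space H" "immersed H X F" "immersed H (subtopology X S) F" "topspace X \<inter> S \<in> borel_sets X"
  shows "volume_measure H (subtopology X S) F = restrict_space (volume_measure H X F) (topspace X \<inter> S)"
proof (rule volume_measure_eqI[OF assms(1,3)])
  let ?M = "volume_measure H X F" and ?S = "topspace X \<inter> S"
  note s = volume_measure_sets[OF assms(1,2)]
  interpret sigma_algebra "topspace X" "borel_sets X" by (rule sigma_algebra_borel_sets)
  have sets: "sets (restrict_space ?M ?S) = borel_sets (subtopology X S)"
    using borel_sets_subtopology[OF assms(4)] s by (simp add: sets_restrict_space)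
  show "volume_spec H (subtopology X S) F (restrict_space ?M ?S)"
    unfolding volume_spec_def
  proof (intro conjI allI impI)
    show "space (restrict_space ?M ?S) = topspace (subtopology X S)"
      using s by (auto simp: space_restrict_space)
    show "sets (restrict_space ?M ?S) = borel_sets (subtopology X S)" by (rule sets)
    fix V \<phi> A assume *: "local_param H (subtopology X S) F V \<phi> \<and> A \<in> sets (restrict_space ?M ?S) \<and> A \<subseteq> \<phi> ` V"
    then have "A \<in> (\<inter>) ?S ` borel_sets X" using s by (simp add: sets_restrict_space)
    then have A: "A \<in> borel_sets X" "A \<subseteq> ?S" using assms(4) by auto
    have "emeasure (restrict_space ?M ?S) A = emeasure ?M A"
      using A assms(4) s by (intro emeasure_restrict_space) auto
    also have "\<dots> = chart_measure F V \<phi> A"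
      using * A by (intro emeasure_volume_emb[OF assms(1,2)] local_param_subtopology_emb[of H X S]) auto
    finally show "emeasure (restrict_space ?M ?S) A = chart_measure F V \<phi> A" .
  qed
qed

section \<open>Local finiteness and integrability of continuous functions with compact
  support\<close>

lemma local_param_open_image:
  assumes "local_param H X F V \<phi>" "openin (top_of_set V) V'"
  shows "openin X (\<phi> ` V')"
proof -
  have h: "homeomorphic_map (top_of_set V) (subtopology X (\<phi> ` V)) \<phi>" "openin X (\<phi> ` V)"
    using assms(1) by (simp_all add: local_param_def)
  have "openin (subtopology X (\<phi> ` V)) (\<phi> ` V')"
    using homeomorphic_imp_open_map[OF h(1)] assms(2) by (simp add: open_map_def)
  then show ?thesis using h(2) by (rule openin_trans_full)
qed

text \<open>The density is continuous in coordinates, hence bounded on the part of a small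
  coordinate ball inside the chart.\<close>

lemma volume_measure_locally_finite:
  fixes H :: "(real^'k::{finite,wellorder}) set"
  assumes H: "model_space H" and X: "immersed H X F" and p: "p \<in> topspace X"
  obtains U where "openin X U" "p \<in> U" "emeasure (volume_measure H X F) U < \<infinity>"
proof -
  obtain V \<phi> where lp: "local_param H X F V \<phi>" and "p \<in> \<phi> ` V"
    using X p by (auto simp: immersed_def)
  then obtain x where x: "x \<in> V" "p = \<phi> x" by auto
  note emb = local_param_emb[OF lp]
  let ?g = "\<lambda>x. sqrt (gram_det V (F \<circ> \<phi>) x)"
  have "continuous_on V ?g"
    using continuous_on_gram_det[OF H emb_param_openin[OF emb] emb_param_smooth[OF emb]]
    by (intro continuous_intros)
  then obtain d where d: "d > 0" "\<And>y. y \<in> V \<Longrightarrow> dist y x < d \<Longrightarrow> dist (?g y) (?g x) < 1"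
    using x(1) unfolding continuous_on_iff by (metis zero_less_one)
  let ?V = "V \<inter> ball x d" and ?U = "\<phi> ` (V \<inter> ball x d)"
  have U: "openin X ?U"
    by (rule local_param_open_image[OF lp]) (auto simp: openin_open)
  have "V \<inter> \<phi> -` ?U = ?V"
    using emb_param_inj[OF emb] by (auto dest: inj_onD)
  then have "emeasure (volume_measure H X F) ?U = (\<integral>\<^sup>+ y \<in> ?V. ennreal (?g y) \<partial>lborel)"
    using emeasure_volume_emb[OF H X emb openin_borel_sets[OF U]] by (auto simp: chart_measure_def)
  also have "\<dots> \<le> (\<integral>\<^sup>+ y. ennreal (?g x + 1) * indicator (ball x d) y \<partial>lborel)"
  proof (intro nn_integral_mono)
    fix y
    have "?g y \<le> ?g x + 1" if "y \<in> ?V"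
      using d(2)[of y] that by (auto simp: dist_real_def dist_commute)
    then show "ennreal (?g y) * indicator ?V y \<le> ennreal (?g x + 1) * indicator (ball x d) y"
      by (auto simp: indicator_def intro!: ennreal_leI)
  qed
  also have "\<dots> = ennreal (?g x + 1) * emeasure lborel (ball x d)"
    by (intro nn_integral_cmult_indicator) simp
  also have "\<dots> < \<infinity>"
    using emeasure_bounded_finite[of "ball x d"] by (simp add: ennreal_mult_less_top)
  finally have fin: "emeasure (volume_measure H X F) ?U < \<infinity>" .
  show thesis by (rule that[OF U _ fin]) (use x d(1) in auto)
qed

text \<open>Finitely many open sets of finite measure cover \<open>K\<close>, and a continuous
  function is bounded on \<open>K\<close>.\<close>

lemma integrable_volume_measure:
  fixes H :: "(real^'k::{finite,wellorder}) set" and h :: "'a \<Rightarrow> real"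
  assumes H: "model_space H" and X: "immersed H X F"
    and h: "continuous_map X euclidean h" and K: "compactin X K" and h0: "\<And>p. p \<in> topspace X - K \<Longrightarrow> h p = 0"
  shows "integrable (volume_measure H X F) h"
proof -
  let ?M = "volume_measure H X F"
  note s = volume_measure_sets[OF H X]
  have "closedin X K" using X K by (auto simp: immersed_def intro: compactin_imp_closedin)
  then have Ks: "K \<in> sets ?M" using closedin_borel_sets s by blast
  have fin: "\<exists>U. openin X U \<and> p \<in> U \<and> emeasure ?M U < \<infinity>" if "p \<in> topspace X" for p
    using volume_measure_locally_finite[OF H X that] by blast
  have "\<exists>\<F>. finite \<F> \<and> \<F> \<subseteq> {U. openin X U \<and> emeasure ?M U < \<infinity>} \<and> K \<subseteq> \<Union>\<F>"
  proof (rule compactinD[OF K])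
    show "K \<subseteq> \<Union>{U. openin X U \<and> emeasure ?M U < \<infinity>}"
      using fin compactin_subset_topspace[OF K] by blast
  qed auto
  then obtain \<F> where \<F>: "finite \<F>" "\<And>U. U \<in> \<F> \<Longrightarrow> openin X U \<and> emeasure ?M U < \<infinity>" "K \<subseteq> \<Union>\<F>"
    by blast
  have Fs: "\<F> \<subseteq> sets ?M" using \<F>(2) openin_borel_sets s by blast
  have "emeasure ?M K \<le> emeasure ?M (\<Union>\<F>)"
    using \<F>(1,3) Fs by (intro emeasure_mono) auto
  also have "\<dots> \<le> (\<Sum>U\<in>\<F>. emeasure ?M U)"
    using emeasure_subadditive_finite[of \<F> id ?M] \<F>(1) Fs by simp
  also have "\<dots> < \<infinity>" using \<F>(1,2) by simp
  finally have Kfin: "emeasure ?M K < \<infinity>" .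
  have meas: "h \<in> borel_measurable ?M"
  proof (rule borel_measurableI)
    fix S :: "real set" assume "open S"
    then have "openin X {p \<in> topspace X. h p \<in> S}"
      using h by (intro openin_continuous_map_preimage) auto
    then show "h -` S \<inter> space ?M \<in> sets ?M"
      using openin_borel_sets[of X "{p \<in> topspace X. h p \<in> S}"] s
      by (simp add: vimage_def Int_def conj_commute)
  qed
  have "compact (h ` K)" using image_compactin[OF K h] by simp
  then have "bounded (h ` K)" by (rule compact_imp_bounded)
  then obtain B where "\<forall>y\<in>h ` K. norm y \<le> B" unfolding bounded_iff ..
  then have B: "\<And>p. p \<in> K \<Longrightarrow> norm (h p) \<le> B" by auto
  show ?thesis
    by (rule integrableI_bounded_set[OF Ks meas Kfin, of B]) (use B h0 s in auto)
qed

subsection \<open>Orthonormal frames\<close>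

definition on_frame :: "(real^2 \<Rightarrow> real^'n) \<Rightarrow> (2 \<Rightarrow> real^2) \<Rightarrow> bool" where
  "on_frame T w \<longleftrightarrow> (\<forall>i j. T (w i) \<bullet> T (w j) = (if i = j then 1 else 0))"

lemma inj_linear_2_nonzero:
  fixes T :: "real^2 \<Rightarrow> real^'n"
  assumes "linear T" "inj T" "v \<noteq> 0"
  shows "T v \<bullet> T v > 0"
  using assms by (metis inner_gt_zero_iff linear_injective_0)

text \<open>Gram-Schmidt applied to the coordinate frame \<open>a\<close>, \<open>b\<close>. All
  normalizing factors are powers of positive smooth functions, so the frame is smooth.\<close>

lemma smooth_on_frame_exists:
  fixes f :: "real^2 \<Rightarrow> real^'n"
  assumes H: "model_space H" "openin (top_of_set H) V" and f: "smooth_on V f" and inj: "\<And>x. x \<in> V \<Longrightarrow> inj (D V f x)"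
  obtains u where "\<And>i. smooth_on V (u i)" "\<And>x. x \<in> V \<Longrightarrow> on_frame (D V f x) (\<lambda>i. u i x)"
proof -
  define a b where "a x = D V f x (axis 1 1)" and "b x = D V f x (axis 2 1)" for x
  define E K G \<Delta> where "E x = a x \<bullet> a x" and "K x = a x \<bullet> b x" and "G x = b x \<bullet> b x"
    and "\<Delta> x = E x * G x - K x * K x" for x
  have sab: "smooth_on V a" "smooth_on V b" unfolding a_def[abs_def] b_def[abs_def] by (rule smooth_on_D[OF H f])+
  then have sE: "smooth_on V E" "smooth_on V K" "smooth_on V G"
    unfolding E_def[abs_def] K_def[abs_def] G_def[abs_def] by (auto intro: smooth_on_inner)
  then have s\<Delta>: "smooth_on V \<Delta>" unfolding \<Delta>_def[abs_def] by (intro smooth_on_diff smooth_on_mult)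
  have lin: "linear (D V f x)" if "x \<in> V" for x
    using smooth_on_has_derivative[OF f that] by (rule has_derivative_linear)
  have E: "E x > 0" if "x \<in> V" for x
    unfolding E_def a_def using inj_linear_2_nonzero[OF lin[OF that] inj[OF that], of "axis 1 1"]
    by (simp add: axis_eq_0_iff)
  have \<Delta>: "\<Delta> x > 0" if x: "x \<in> V" for x
  proof -
    \<comment> \<open>Its image \<open>E b - K a\<close> is orthogonal to \<open>a\<close> and has
      squared length \<open>E * \<Delta>\<close>. Injectivity therefore forces
      \<open>\<Delta> > 0\<close>, and the same vector, normalized, is the second frame
      vector.\<close>
    let ?v = "E x *\<^sub>R axis 2 1 - K x *\<^sub>R axis 1 1 :: real^2"
    have "?v $ 2 = E x" by (simp add: axis_def)
    then have "?v \<noteq> 0" using E[OF x] by (metis less_irrefl zero_index)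
    then have "0 < D V f x ?v \<bullet> D V f x ?v" by (rule inj_linear_2_nonzero[OF lin[OF x] inj[OF x]])
    also have "D V f x ?v = E x *\<^sub>R b x - K x *\<^sub>R a x"
      using lin[OF x] by (simp add: linear_diff linear_cmul a_def b_def)
    also have "(E x *\<^sub>R b x - K x *\<^sub>R a x) \<bullet> (E x *\<^sub>R b x - K x *\<^sub>R a x) = E x * \<Delta> x"
      by (simp add: E_def K_def G_def \<Delta>_def inner_diff_left inner_diff_right inner_commute algebra_simps)
    finally show ?thesis using E[OF x] by (simp add: zero_less_mult_iff)
  qed
  define u :: "2 \<Rightarrow> real^2 \<Rightarrow> real^2" where
    "u i x = (if i = 1 then E x powr (-1/2) *\<^sub>R axis 1 1
       else (E x * \<Delta> x) powr (-1/2) *\<^sub>R (E x *\<^sub>R axis 2 1 - K x *\<^sub>R axis 1 1))" for i x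
  show thesis
  proof (rule that)
    have "smooth_on V (\<lambda>x. E x powr (-1/2))" "smooth_on V (\<lambda>x. (E x * \<Delta> x) powr (-1/2))"
      using sE s\<Delta> E \<Delta> by (auto intro!: smooth_on_powr smooth_on_mult mult_pos_pos)
    then show "smooth_on V (u i)" for i
      unfolding u_def[abs_def] using sE
      by (cases "i = 1") (auto intro!: smooth_on_scaleR smooth_on_diff smooth_on_const)
    fix x assume x: "x \<in> V"
    let ?e = "E x powr (-1/2)" and ?d = "(E x * \<Delta> x) powr (-1/2)"
    have u1: "D V f x (u 1 x) = ?e *\<^sub>R a x"
      using lin[OF x] by (simp add: u_def linear_cmul a_def)
    have u2: "D V f x (u 2 x) = ?d *\<^sub>R (E x *\<^sub>R b x - K x *\<^sub>R a x)"
      using lin[OF x] by (simp add: u_def linear_cmul linear_diff a_def b_def)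
    have pp: "t powr (-1/2) * t powr (-1/2) * t = 1" if "t > 0" for t :: real
      using that by (simp add: powr_add[symmetric] powr_minus field_simps)
    have "?e * ?e * E x = 1" using pp[OF E[OF x]] .
    moreover have "?d * ?d * (E x * \<Delta> x) = 1" using pp E[OF x] \<Delta>[OF x] by simp
    moreover have "(E x *\<^sub>R b x - K x *\<^sub>R a x) \<bullet> (E x *\<^sub>R b x - K x *\<^sub>R a x) = E x * \<Delta> x"
      by (simp add: E_def K_def G_def \<Delta>_def inner_diff_left inner_diff_right inner_commute algebra_simps)
    moreover have "a x \<bullet> (E x *\<^sub>R b x - K x *\<^sub>R a x) = 0" "(E x *\<^sub>R b x - K x *\<^sub>R a x) \<bullet> a x = 0"
      by (simp_all add: E_def K_def inner_diff_right inner_diff_left inner_commute)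
    ultimately show "on_frame (D V f x) (\<lambda>i. u i x)"
      unfolding on_frame_def by (simp add: forall_2 u1 u2 E_def mult.assoc)
  qed
qed

text \<open>\<open>T\<close> stands for the derivative of the immersion, \<open>L\<close> for that
  of a normal field. The tangential part of \<open>L\<close> is subtracted twice: once in passing to
  the normal derivative, once for the term with \<open>simons_op\<close>.\<close>

definition shape_energy :: "(real^2 \<Rightarrow> real^'n) \<Rightarrow> (real^2 \<Rightarrow> real^'n) \<Rightarrow> (2 \<Rightarrow> real^2) \<Rightarrow> real" where
  "shape_energy T L w = (\<Sum>i\<in>UNIV. (norm (L (w i)))\<^sup>2 - 2 * (\<Sum>j\<in>UNIV. (L (w i) \<bullet> T (w j))\<^sup>2))"

text \<open>\<open>t\<close> is an orthogonal matrix. Orthonormality of the two frames gives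
  orthonormal rows, and a square matrix with orthonormal rows has orthonormal columns, which is the
  form needed for sums over \<open>i\<close>.\<close>

lemma on_frame_transition:
  fixes T :: "real^2 \<Rightarrow> real^'n"
  assumes "linear T" "on_frame T u" "on_frame T w"
  obtains t :: "2 \<Rightarrow> 2 \<Rightarrow> real" where "\<And>i. u i = (\<Sum>j\<in>UNIV. t i j *\<^sub>R w j)"
    "\<And>j k. (\<Sum>i\<in>UNIV. t i j * t i k) = (if j = k then 1 else 0)"
proof -
  let ?W = "\<lambda>v::real^2. \<Sum>j\<in>UNIV. v $ j *\<^sub>R w j"
  have lin: "linear ?W"
    by (rule linearI) (simp_all add: algebra_simps sum.distrib scaleR_sum_right)
  have T: "T (?W v) \<bullet> T (?W z) = v \<bullet> z" for v z
  proof -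
    have "T (w 1) \<bullet> T (w 1) = 1" "T (w 2) \<bullet> T (w 2) = 1" "T (w 1) \<bullet> T (w 2) = 0" "T (w 2) \<bullet> T (w 1) = 0"
      using assms(3) by (simp_all add: on_frame_def)
    moreover have "v \<bullet> z = v $ 1 * z $ 1 + v $ 2 * z $ 2" by (simp add: inner_vec_def sum_2)
    ultimately show ?thesis
      using assms(1) by (simp add: sum_2 linear_add linear_cmul inner_add_left inner_add_right)
  qed
  have "inj ?W"
    unfolding linear_injective_0[OF lin]
  proof (intro allI impI)
    fix v assume "?W v = 0"
    then have "v \<bullet> v = 0" using T[of v v] linear_0[OF assms(1)] by simp
    then show "v = 0" by simp
  qed
  then have "surj ?W" using linear_injective_imp_surjective[OF lin] by blast
  then have "\<forall>i. \<exists>v. u i = ?W v" by (intro allI surjD)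
  then obtain v where v: "\<And>i. u i = ?W (v i)" using choice[of "\<lambda>i v. u i = ?W v"] by blast
  let ?P = "(\<chi> i j. v i $ j) :: real^2^2"
  have "?P ** transpose ?P = mat 1"
  proof -
    have "v i \<bullet> v j = (if i = j then 1 else 0)" for i j
      using assms(2) T[of "v i" "v j"] unfolding v[symmetric] on_frame_def by simp
    then show ?thesis
      by (simp add: vec_eq_iff matrix_matrix_mult_def transpose_def mat_def inner_vec_def)
  qed
  then have "transpose ?P ** ?P = mat 1" by (simp add: matrix_left_right_inverse)
  then have "(\<Sum>i\<in>UNIV. v i $ j * v i $ k) = (if j = k then 1 else 0)" for j k
    by (simp add: vec_eq_iff matrix_matrix_mult_def transpose_def mat_def)
  then show thesis by (rule that[of "\<lambda>i j. v i $ j", OF v])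
qed

lemma shape_energy_unique:
  fixes T L :: "real^2 \<Rightarrow> real^'n"
  assumes T: "linear T" and L: "linear L" and u: "on_frame T u" and w: "on_frame T w"
  shows "shape_energy T L u = shape_energy T L w"
proof -
  obtain t :: "2 \<Rightarrow> 2 \<Rightarrow> real" where ut: "\<And>i. u i = (\<Sum>j\<in>UNIV. t i j *\<^sub>R w j)"
    and t: "\<And>j k. (\<Sum>i\<in>UNIV. t i j * t i k) = (if j = k then 1 else 0)"
    using on_frame_transition[OF T u w] by blast
  have t': "t 1 1 * t 1 1 + t 2 1 * t 2 1 = 1" "t 1 2 * t 1 2 + t 2 2 * t 2 2 = 1"
    "t 1 1 * t 1 2 + t 2 1 * t 2 2 = 0"
    using t[of 1 1] t[of 2 2] t[of 1 2] by (simp_all add: sum_2)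
  \<comment> \<open>A sum of squared lengths is invariant under an orthogonal matrix. This is
    applied to \<open>L\<close>, to the index of \<open>T\<close>, and to the index of
    \<open>L\<close> inside the mixed term.\<close>
  have inv: "(\<Sum>l\<in>UNIV. (\<Sum>k\<in>UNIV. t l k *\<^sub>R x k) \<bullet> (\<Sum>k\<in>UNIV. t l k *\<^sub>R x k)) = (\<Sum>k\<in>UNIV. x k \<bullet> x k)"
    for x :: "2 \<Rightarrow> 'v::real_inner"
  proof -
    have "(\<Sum>l\<in>UNIV. (\<Sum>k\<in>UNIV. t l k *\<^sub>R x k) \<bullet> (\<Sum>k\<in>UNIV. t l k *\<^sub>R x k)) =
      (t 1 1 * t 1 1 + t 2 1 * t 2 1) * (x 1 \<bullet> x 1) + (t 1 2 * t 1 2 + t 2 2 * t 2 2) * (x 2 \<bullet> x 2)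
      + 2 * (t 1 1 * t 1 2 + t 2 1 * t 2 2) * (x 1 \<bullet> x 2)"
      by (simp add: sum_2 inner_add_left inner_add_right inner_commute algebra_simps)
    then show ?thesis using t' by (simp add: sum_2)
  qed
  have Lu: "L (u i) = (\<Sum>j\<in>UNIV. t i j *\<^sub>R L (w j))" and Tu: "T (u i) = (\<Sum>j\<in>UNIV. t i j *\<^sub>R T (w j))" for i
    using L T by (simp_all add: ut linear_sum linear_cmul)
  have 1: "(\<Sum>i\<in>UNIV. (norm (L (u i)))\<^sup>2) = (\<Sum>i\<in>UNIV. (norm (L (w i)))\<^sup>2)"
    using inv[of "\<lambda>j. L (w j)"] by (simp add: Lu power2_norm_eq_inner)
  have "(\<Sum>j\<in>UNIV. (z \<bullet> T (u j))\<^sup>2) = (\<Sum>j\<in>UNIV. (z \<bullet> T (w j))\<^sup>2)" for z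
    using inv[of "\<lambda>j. z \<bullet> T (w j)"] by (simp add: Tu inner_sum_right power2_eq_square)
  then have "(\<Sum>i\<in>UNIV. \<Sum>j\<in>UNIV. (L (u i) \<bullet> T (u j))\<^sup>2) = (\<Sum>i\<in>UNIV. \<Sum>j\<in>UNIV. (L (u i) \<bullet> T (w j))\<^sup>2)"
    by simp
  also have "\<dots> = (\<Sum>j\<in>UNIV. \<Sum>i\<in>UNIV. (L (u i) \<bullet> T (w j))\<^sup>2)" by (rule sum.swap)
  also have "\<dots> = (\<Sum>j\<in>UNIV. \<Sum>i\<in>UNIV. (L (w i) \<bullet> T (w j))\<^sup>2)"
  proof -
    have "(\<Sum>i\<in>UNIV. (L (u i) \<bullet> z)\<^sup>2) = (\<Sum>i\<in>UNIV. (L (w i) \<bullet> z)\<^sup>2)" for z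
      using inv[of "\<lambda>j. L (w j) \<bullet> z"] by (simp add: Lu inner_sum_left power2_eq_square)
    then show ?thesis by simp
  qed
  also have "\<dots> = (\<Sum>i\<in>UNIV. \<Sum>j\<in>UNIV. (L (w i) \<bullet> T (w j))\<^sup>2)" by (rule sum.swap)
  finally show ?thesis
    unfolding shape_energy_def sum_subtractf sum_distrib_left[symmetric] using 1 by simp
qed

text \<open>For a normal field \<open>Y\<close> one has \<open>b\<^sub>i\<^sub>j \<bullet> Y = - (e\<^sub>j \<bullet> D\<^sub>i Y)\<close>, so the integrand of the second
  variation only depends on first derivatives of \<open>Y\<close>.\<close>

lemma variation_integrand_eq_shape_energy:
  fixes f Y :: "real^2 \<Rightarrow> real^'n"
  assumes H: "model_space H" "openin (top_of_set H) V" and f: "smooth_on V f" and u: "\<And>i. smooth_on V (u i)"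
    and fr: "\<And>x. x \<in> V \<Longrightarrow> on_frame (D V f x) (\<lambda>i. u i x)"
    and Y: "smooth_on V Y" and normal: "\<And>x v. x \<in> V \<Longrightarrow> Y x \<bullet> D V f x v = 0" and x: "x \<in> V"
  shows "(\<Sum>i\<in>UNIV. (norm (normal_deriv V f u Y i x))\<^sup>2) - simons_op V f u x (Y x) \<bullet> Y x
    = shape_energy (D V f x) (D V Y x) (\<lambda>i. u i x)"
proof -
  define e where "e i = frame V f u i x" for i
  define d where "d i = D V Y x (u i x)" for i
  have e: "e i \<bullet> e j = (if i = j then 1 else 0)" for i j
    using fr[OF x] by (simp add: on_frame_def e_def frame_def)
  have Ye: "Y x \<bullet> e i = 0" for i using normal[OF x] by (simp add: e_def frame_def)
  have nd: "(norm (normal_deriv V f u Y i x))\<^sup>2 = (norm (d i))\<^sup>2 - (\<Sum>j\<in>UNIV. (d i \<bullet> e j)\<^sup>2)" for i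
    unfolding normal_deriv_def normal_part_def d_def[symmetric] e_def[symmetric] power2_norm_eq_inner
    by (simp add: sum_2 inner_diff_left inner_diff_right inner_add_left inner_add_right e inner_commute
        power2_eq_square algebra_simps)
  have b: "second_ff V f u i j x \<bullet> Y x = - (d i \<bullet> e j)" for i j
  proof -
    have lin: "linear (D V f z)" if "z \<in> V" for z
      using smooth_on_has_derivative[OF f that] by (rule has_derivative_linear)
    have sf: "smooth_on V (frame V f u j)"
    proof -
      have "smooth_on V (\<lambda>z. \<Sum>k\<in>UNIV. (u j z $ k) *\<^sub>R D V f z (axis k 1))"
        by (intro smooth_on_sum smooth_on_scaleR smooth_on_D[OF H f] smooth_on_compose_linear[OF bounded_linear_vec_nth] u)
      moreover have "(\<Sum>k\<in>UNIV. (u j z $ k) *\<^sub>R D V f z (axis k 1)) = frame V f u j z" if "z \<in> V" for z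
      proof -
        have "u j z = (\<Sum>k\<in>UNIV. (u j z $ k) *\<^sub>R axis k 1)"
          by (simp add: vec_eq_iff axis_def if_distrib cong: if_cong)
        then have "D V f z (u j z) = D V f z (\<Sum>k\<in>UNIV. (u j z $ k) *\<^sub>R axis k 1)" by simp
        then show ?thesis using lin[OF that] by (simp add: frame_def linear_sum linear_cmul)
      qed
      ultimately show ?thesis using smooth_on_cong by (metis (no_types, lifting))
    qed
    \<comment> \<open>The product of a tangent frame vector with \<open>Y\<close> vanishes on all of
      \<open>V\<close>. Its derivative is computed by the product rule and as the derivative of 0;
      comparing them moves the derivative from the frame to \<open>Y\<close>.\<close>
    have d1: "((\<lambda>z. frame V f u j z \<bullet> Y z) has_derivative
        (\<lambda>h. frame V f u j x \<bullet> D V Y x h + D V (frame V f u j) x h \<bullet> Y x)) (at x within V)"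
      by (rule has_derivative_inner[OF smooth_on_has_derivative[OF sf x] smooth_on_has_derivative[OF Y x]])
    have d2: "((\<lambda>z. frame V f u j z \<bullet> Y z) has_derivative (\<lambda>h. 0)) (at x within V)"
      by (rule has_derivative_transform[OF x _ has_derivative_const[of 0]])
         (use normal in \<open>simp add: frame_def inner_commute\<close>)
    have "e j \<bullet> d i + D V (frame V f u j) x (u i x) \<bullet> Y x = 0"
      unfolding e_def d_def
      by (rule fun_cong[OF trans[OF D_eqI[OF H x d1, symmetric] D_eqI[OF H x d2]]])
    then show ?thesis
      unfolding second_ff_def normal_part_def e_def[symmetric]
      using Ye by (simp add: inner_diff_right inner_sum_right inner_commute)
  qed
  have "simons_op V f u x (Y x) \<bullet> Y x = (\<Sum>i\<in>UNIV. \<Sum>j\<in>UNIV. (d i \<bullet> e j)\<^sup>2)"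
    unfolding simons_op_def by (simp add: inner_sum_left b power2_eq_square)
  then show ?thesis
    unfolding shape_energy_def nd d_def[symmetric]
    by (simp add: sum_subtractf e_def frame_def flip: sum_distrib_left)
qed

subsection \<open>The integrand of the second variation\<close>

definition smooth_normal_field :: "'a topology \<Rightarrow> ('a \<Rightarrow> real^'n) \<Rightarrow> ('a \<Rightarrow> real^'n) \<Rightarrow> bool" where
  "smooth_normal_field X F Y \<longleftrightarrow>
     (\<forall>p\<in>topspace X. Y p \<in> normal_space X F p) \<and>
     (\<forall>V \<phi>. local_param half_plane X F V \<phi> \<longrightarrow> smooth_on V (Y \<circ> \<phi>))"

lemma normal_space_orthogonal:
  assumes "y \<in> normal_space X F (\<phi> x)" "local_param half_plane X F V \<phi>" "x \<in> V"
  shows "y \<bullet> D V (F \<circ> \<phi>) x v = 0"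
proof -
  have "D V (F \<circ> \<phi>) x v \<in> tangent_space X F (\<phi> x)"
    unfolding tangent_space_def using assms(2,3) by blast
  then have "D V (F \<circ> \<phi>) x v \<bullet> y = 0"
    using assms(1) by (simp add: normal_space_def orthogonal_comp_def orthogonal_def)
  then show ?thesis by (simp only: inner_commute)
qed

lemma framed_param_iff:
  "framed_param X F V \<phi> u \<longleftrightarrow> local_param half_plane X F V \<phi> \<and> (\<forall>i. smooth_on V (u i)) \<and>
     (\<forall>x\<in>V. on_frame (D V (F \<circ> \<phi>) x) (\<lambda>i. u i x))"
  by (auto simp: framed_param_def on_frame_def frame_def)

lemma framed_param_exists:
  assumes "immersed half_plane X F" "p \<in> topspace X"
  obtains V \<phi> u where "framed_param X F V \<phi> u" "p \<in> \<phi> ` V"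
proof -
  obtain V \<phi> where lp: "local_param half_plane X F V \<phi>" and p: "p \<in> \<phi> ` V"
    using assms by (auto simp: immersed_def)
  note emb = local_param_emb[OF lp]
  obtain u where "\<And>i. smooth_on V (u i)" "\<And>x. x \<in> V \<Longrightarrow> on_frame (D V (F \<circ> \<phi>) x) (\<lambda>i. u i x)"
    using smooth_on_frame_exists[OF model_space_half_plane emb_param_openin[OF emb] emb_param_smooth[OF emb] emb_param_imm[OF emb]]
    by blast
  then have "framed_param X F V \<phi> u" using lp by (simp add: framed_param_iff)
  then show thesis using p by (rule that)
qed

lemma shape_energy_compose: "shape_energy (\<lambda>v. T (A v)) (\<lambda>v. L (A v)) w = shape_energy T L (\<lambda>i. A (w i))"
  by (simp add: shape_energy_def)

text \<open>First the integrand is rewritten in the chart picked by \<open>SOME\<close>, then the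
  transition map carries it to \<open>\<phi>\<close>. Only first derivatives remain, so
  \<open>w\<close> has to be orthonormal at the single point \<open>x\<close>, and
  \<open>\<phi>\<close> may be a boundary chart of a piece.\<close>

lemma variation_density_eq:
  assumes X: "immersed half_plane X F" and Y: "smooth_normal_field X F Y"
    and emb: "emb_param half_plane X F V \<phi>" and x: "x \<in> V" and w: "on_frame (D V (F \<circ> \<phi>) x) w"
  shows "variation_density X F Y (\<phi> x) = shape_energy (D V (F \<circ> \<phi>) x) (D V (Y \<circ> \<phi>) x) w"
proof -
  let ?P = "\<lambda>(V, \<psi>, u). framed_param X F V \<psi> u \<and> \<phi> x \<in> \<psi> ` V"
  have "\<phi> x \<in> topspace X" using emb_param_subset[OF emb] x by blast
  then obtain V1 \<phi>1 u1 where "framed_param X F V1 \<phi>1 u1" "\<phi> x \<in> \<phi>1 ` V1"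
    using framed_param_exists[OF X] by blast
  then have "?P (V1, \<phi>1, u1)" by simp
  then have P: "?P (SOME z. ?P z)" by (rule someI)
  obtain W \<psi> u where some: "(SOME z. ?P z) = (W, \<psi>, u)" by (rule prod_cases3)
  have fp: "framed_param X F W \<psi> u" and pW: "\<phi> x \<in> \<psi> ` W" using P unfolding some by auto
  have loc: "local_param half_plane X F W \<psi>" and u: "\<And>i. smooth_on W (u i)"
    and fr: "\<And>z. z \<in> W \<Longrightarrow> on_frame (D W (F \<circ> \<psi>) z) (\<lambda>i. u i z)"
    using fp by (auto simp: framed_param_iff)
  interpret transition half_plane X F V \<phi> W \<psi>
    using model_space_half_plane emb loc by unfold_locales
  define y where "y = inv_into W \<psi> (\<phi> x)"
  have y: "y \<in> W" "\<psi> y = \<phi> x" using pW by (auto simp: y_def inv_into_into f_inv_into_f)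
  have xdom: "x \<in> dom" and \<tau>x: "\<tau> x = y" using \<tau>_eq[OF x y(1) y(2)[symmetric]] by auto
  have sY: "smooth_on W (Y \<circ> \<psi>)" using Y loc by (simp add: smooth_normal_field_def)
  have lin: "linear (D W (F \<circ> \<psi>) y)" "linear (D W (Y \<circ> \<psi>) y)"
    using smooth_on_has_derivative[OF emb_param_smooth[OF emb'] y(1)] smooth_on_has_derivative[OF sY y(1)]
    by (auto dest: has_derivative_linear)
  have normal: "(Y \<circ> \<psi>) z \<bullet> D W (F \<circ> \<psi>) z v = 0" if "z \<in> W" for z v
  proof -
    have "\<psi> z \<in> topspace X" using emb_param_subset[OF emb'] that by blast
    then show ?thesis
      using normal_space_orthogonal[OF _ loc that] Y by (simp add: smooth_normal_field_def)
  qed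
  have Yx: "Y (\<phi> x) = (Y \<circ> \<psi>) y" by (simp add: y(2))
  have "variation_density X F Y (\<phi> x) =
      (\<Sum>i\<in>UNIV. (norm (normal_deriv W (F \<circ> \<psi>) u (Y \<circ> \<psi>) i y))\<^sup>2)
         - simons_op W (F \<circ> \<psi>) u y ((Y \<circ> \<psi>) y) \<bullet> (Y \<circ> \<psi>) y"
    unfolding variation_density_def some Yx[symmetric] by (simp add: y_def Let_def)
  also have "\<dots> = shape_energy (D W (F \<circ> \<psi>) y) (D W (Y \<circ> \<psi>) y) (\<lambda>i. u i y)"
    by (rule variation_integrand_eq_shape_energy[OF model_space_half_plane emb_param_openin[OF emb']
        emb_param_smooth[OF emb'] u fr sY normal y(1)])
  also have "\<dots> = shape_energy (D V (F \<circ> \<phi>) x) (D V (Y \<circ> \<phi>) x) w"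
  proof -
    obtain A where A: "(\<tau> has_derivative A) (at x within V)"
      and DF: "D V (F \<circ> \<phi>) x = (\<lambda>v. D W (F \<circ> \<psi>) y (A v))"
      using \<tau>_derivative[OF xdom] unfolding \<tau>x by blast
    have DY: "D V (Y \<circ> \<phi>) x = (\<lambda>v. D W (Y \<circ> \<psi>) y (A v))"
      using D_via(2)[OF xdom A, of Y] smooth_on_differentiable[OF sY y(1)] by (simp add: \<tau>x)
    have "on_frame (D W (F \<circ> \<psi>) y) (\<lambda>i. A (w i))"
      using w unfolding DF by (simp add: on_frame_def)
    from shape_energy_unique[OF lin fr[OF y(1)] this] show ?thesis
      unfolding DF DY shape_energy_compose .
  qed
  finally show ?thesis .
qed

text \<open>In a framed chart the density is \<open>shape_energy\<close> of smooth data; the chart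
  images are open, so local continuity suffices.\<close>

lemma continuous_map_variation_density:
  assumes X: "immersed half_plane X F" and Y: "smooth_normal_field X F Y"
  shows "continuous_map X euclidean (variation_density X F Y)"
proof (rule pasting_lemma[where I = "{(V, \<phi>, u). framed_param X F V \<phi> u}" and
      T = "\<lambda>(V, \<phi>, u). \<phi> ` V" and f = "\<lambda>_. variation_density X F Y"])
  fix i assume "i \<in> {(V, \<phi>, u). framed_param X F V \<phi> u}"
  then obtain V \<phi> u where i: "i = (V, \<phi>, u)" and fp: "framed_param X F V \<phi> u" by auto
  then have lp: "local_param half_plane X F V \<phi>" and u: "\<And>i. smooth_on V (u i)"
    and fr: "\<And>z. z \<in> V \<Longrightarrow> on_frame (D V (F \<circ> \<phi>) z) (\<lambda>i. u i z)"
    by (auto simp: framed_param_iff)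
  note emb = local_param_emb[OF lp]
  note mV = model_space_half_plane emb_param_openin[OF emb]
  show "openin X (case i of (V, \<phi>, u) \<Rightarrow> \<phi> ` V)" using lp by (simp add: i local_param_def)
  have sY: "smooth_on V (Y \<circ> \<phi>)" using Y lp by (simp add: smooth_normal_field_def)
  let ?h = "\<lambda>x. shape_energy (D V (F \<circ> \<phi>) x) (D V (Y \<circ> \<phi>) x) (\<lambda>i. u i x)"
  have cD: "continuous_on V (\<lambda>x. D V f x (u i x))" if f: "smooth_on V f" for f :: "real^2 \<Rightarrow> real^'b" and i
  proof -
    have "continuous_on V (\<lambda>x. \<Sum>k\<in>UNIV. (u i x $ k) *\<^sub>R D V f x (axis k 1))"
      by (intro continuous_intros smooth_on_continuous_on smooth_on_D[OF mV f] u)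
    moreover have "(\<Sum>k\<in>UNIV. (u i x $ k) *\<^sub>R D V f x (axis k 1)) = D V f x (u i x)" if "x \<in> V" for x
    proof -
      have lin: "linear (D V f x)" using smooth_on_has_derivative[OF f that] by (rule has_derivative_linear)
      have "u i x = (\<Sum>k\<in>UNIV. (u i x $ k) *\<^sub>R axis k 1)"
        by (simp add: vec_eq_iff axis_def if_distrib cong: if_cong)
      then have "D V f x (u i x) = D V f x (\<Sum>k\<in>UNIV. (u i x $ k) *\<^sub>R axis k 1)" by simp
      then show ?thesis using lin by (simp add: linear_sum linear_cmul)
    qed
    ultimately show ?thesis by (rule continuous_on_eq)
  qed
  have "continuous_on V ?h"
    unfolding shape_energy_def
    by (intro continuous_intros cD[OF sY] cD[OF emb_param_smooth[OF emb]])
  then have "continuous_map (subtopology X (\<phi> ` V)) euclidean (?h \<circ> inv_into V \<phi>)"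
    by (intro continuous_map_compose[OF emb_param_inv_continuous[OF emb]]) simp
  then have "continuous_map (subtopology X (\<phi> ` V)) euclidean (variation_density X F Y)"
  proof (rule continuous_map_eq)
    fix p assume "p \<in> topspace (subtopology X (\<phi> ` V))"
    then obtain x where "x \<in> V" "p = \<phi> x" by auto
    then show "(?h \<circ> inv_into V \<phi>) p = variation_density X F Y p"
      using variation_density_eq[OF X Y emb _ fr] emb_param_inj[OF emb] by simp
  qed
  then show "continuous_map (subtopology X (case i of (V, \<phi>, u) \<Rightarrow> \<phi> ` V)) euclidean (variation_density X F Y)"
    by (simp add: i)
next
  fix p assume "p \<in> topspace X"
  then obtain V \<phi> u where "framed_param X F V \<phi> u" "p \<in> \<phi> ` V"
    using framed_param_exists[OF X] by blast
  then show "\<exists>j. j \<in> {(V, \<phi>, u). framed_param X F V \<phi> u} \<and> p \<in> (case j of (V, \<phi>, u) \<Rightarrow> \<phi> ` V) \<and>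
      variation_density X F Y p = variation_density X F Y p"
    by (intro exI[of _ "(V, \<phi>, u)"]) auto
qed auto

text \<open>The density contains derivatives of \<open>Y\<close>, so \<open>Y p = 0\<close> alone
  does not suffice. Off the closure \<open>Y\<close> vanishes in a whole neighbourhood of
  \<open>p\<close>.\<close>

lemma variation_density_support:
  assumes X: "immersed half_plane X F" and Y: "smooth_normal_field X F Y"
    and p: "p \<in> topspace X - X closure_of {p \<in> topspace X. Y p \<noteq> 0}"
  shows "variation_density X F Y p = 0"
proof -
  let ?C = "X closure_of {p \<in> topspace X. Y p \<noteq> 0}"
  obtain V \<phi> u where fp: "framed_param X F V \<phi> u" and "p \<in> \<phi> ` V"
    using framed_param_exists[OF X] p by blast
  then obtain x where x: "x \<in> V" "p = \<phi> x" by auto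
  have lp: "local_param half_plane X F V \<phi>"
    and fr: "on_frame (D V (F \<circ> \<phi>) x) (\<lambda>i. u i x)" using fp x by (auto simp: framed_param_iff)
  note emb = local_param_emb[OF lp]
  have "openin X (topspace X - ?C)" by (simp add: openin_diff)
  from openin_continuous_map_preimage[OF emb_param_continuous[OF emb] this]
  obtain O' where O': "open O'" "{y \<in> V. \<phi> y \<in> topspace X - ?C} = V \<inter> O'"
    by (auto simp: openin_open)
  have "Y q = 0" if "q \<in> topspace X - ?C" for q
    using that closure_of_subset[of "{p \<in> topspace X. Y p \<noteq> 0}" X] by auto
  then have Y0: "(Y \<circ> \<phi>) y = 0" if "y \<in> V \<inter> O'" for y using that O'(2) by auto
  have xO: "x \<in> O'" using x p O'(2) by auto
  have "((Y \<circ> \<phi>) has_derivative (\<lambda>v. 0)) (at x within V)"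
    by (rule has_derivative_within_cong[OF has_derivative_const[of 0] O'(1) xO x(1)]) (use Y0 in auto)
  then have "D V (Y \<circ> \<phi>) x = (\<lambda>v. 0)"
    by (rule D_eqI[OF model_space_half_plane emb_param_openin[OF emb] x(1)])
  then show ?thesis
    using variation_density_eq[OF X Y emb x(1) fr] x(2) by (simp add: shape_energy_def)
qed

subsection \<open>The boundary of a surface\<close>

text \<open>At an interior point the first coordinate of the transition map would have a local minimum,
  contradicting that its derivative is bijective.\<close>

lemma boundary_param_invariant:
  assumes lp: "local_param half_plane X F V \<phi>" "local_param half_plane X F W \<psi>"
    and xy: "x \<in> V" "y \<in> W" "\<phi> x = \<psi> y" and x0: "x $ 1 = 0"
  shows "y $ 1 = 0"
proof (rule ccontr)
  interpret transition half_plane X F W \<psi> V \<phi>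
    using model_space_half_plane local_param_emb[OF lp(2)] lp(1) by unfold_locales
  have sub: "V \<subseteq> half_plane" "W \<subseteq> half_plane"
    using lp by (auto simp: local_param_def dest: openin_imp_subset)
  assume "y $ 1 \<noteq> 0"
  then have y1: "y $ 1 > 0" using xy(2) sub(2) by (force simp: half_plane_def)
  have ydom: "y \<in> dom" and \<tau>y: "\<tau> y = x" using \<tau>_eq[OF xy(2,1)] xy(3) by auto
  obtain O' where O': "open O'" "dom = half_plane \<inter> O'" using openin_dom_H by (auto simp: openin_open)
  \<comment> \<open>Because \<open>y $ 1 > 0\<close>, this neighbourhood of \<open>y\<close> is open
    in the plane, and the derivative within \<open>W\<close> becomes an ordinary one, to which the
    criterion for extrema applies.\<close>
  define S where "S = O' \<inter> {z::real^2. z $ 1 > 0}"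
  have "open S" unfolding S_def by (intro open_Int O'(1) open_Collect_less continuous_intros)
  moreover have "y \<in> S" using O'(2) ydom y1 by (simp add: S_def)
  moreover have "S \<subseteq> dom" unfolding O'(2) S_def half_plane_def by auto
  ultimately have S: "open S" "y \<in> S" "S \<subseteq> dom" by blast+
  obtain A where A: "(\<tau> has_derivative A) (at y within W)" "bij A"
    using \<tau>_derivative[OF ydom] by blast
  have "(\<tau> has_derivative A) (at y within S)"
    by (rule has_derivative_subset[OF A(1)]) (use S(3) in \<open>auto simp: dom_def\<close>)
  then have "(\<tau> has_derivative A) (at y)" using at_within_open[OF S(2,1)] by simp
  then have d: "((\<lambda>z. \<tau> z $ 1) has_derivative (\<lambda>v. A v $ 1)) (at y)"
    by (rule bounded_linear.has_derivative[OF bounded_linear_vec_nth])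
  have "\<forall>z\<in>S. \<tau> y $ 1 \<le> \<tau> z $ 1"
  proof
    fix z assume "z \<in> S"
    then have "\<tau> z \<in> half_plane" using \<tau>(1) S(3) sub(1) by blast
    then show "\<tau> y $ 1 \<le> \<tau> z $ 1" using x0 \<tau>y by (simp add: half_plane_def)
  qed
  then have "(\<lambda>v. A v $ 1) = (\<lambda>v. 0)"
    using differential_zero_maxmin[OF S(2,1) d] by blast
  then have z: "A v $ 1 = 0" for v by (rule fun_cong)
  obtain v where "axis 1 1 = A v" using surjD[OF bij_is_surj[OF A(2)]] by blast
  then show False using z[of v] by (simp flip: \<open>axis 1 1 = A v\<close>)
qed

lemma surface_boundary_iff:
  assumes "local_param half_plane X F V \<phi>" "x \<in> V"
  shows "\<phi> x \<in> surface_boundary X F \<longleftrightarrow> x $ 1 = 0"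
  using boundary_param_invariant[OF _ assms(1) _ assms(2)] assms unfolding surface_boundary_def by blast

text \<open>In every chart the boundary lies on the line \<open>x $ 1 = 0\<close>, a Lebesgue null
  set, and countably many charts suffice.\<close>

lemma surface_boundary_null:
  fixes X :: "'a topology" and F :: "'a \<Rightarrow> real^'n"
  assumes X: "immersed half_plane X F" and B: "surface_boundary X F \<in> borel_sets X"
  shows "surface_boundary X F \<in> null_sets (area_measure X F)"
proof -
  let ?M = "area_measure X F" and ?B = "surface_boundary X F"
  note H = model_space_half_plane
  note s = volume_measure_sets[OF H X, folded area_measure_def]
  obtain Vs \<phi>s where at: "atlas_seq half_plane X F Vs \<phi>s" using immersed_atlas[OF X] by blast
  have Z: "{x::real^2. x $ 1 = 0} \<in> null_sets lborel"
  proof -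
    have "{x::real^2. x $ 1 = 0} \<in> sets lborel" by simp
    moreover have "negligible {x::real^2. x $ 1 = 0}"
      using negligible_standard_hyperplane[of "axis 1 1 :: real^2" 0] by (simp add: inner_axis axis_in_Basis_iff)
    ultimately show ?thesis by (simp add: negligible_iff_null_sets null_sets_completion_iff)
  qed
  have "emeasure ?M (?B \<inter> piece Vs \<phi>s n) = 0" for n
  proof -
    let ?A = "?B \<inter> piece Vs \<phi>s n"
    note lp = atlas_local_param[OF H at, of n]
    have A: "?A \<in> borel_sets X" "?A \<subseteq> \<phi>s n ` Vs n"
      using piece_decomp(2)[OF H at B] piece(3)[OF H at] by blast+
    have "emeasure ?M ?A = chart_measure F (Vs n) (\<phi>s n) ?A"
      using volume_specD[OF volume_measure_spec[OF H X] lp A] by (simp add: area_measure_def)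
    also have "\<dots> = (\<integral>\<^sup>+x. 0 \<partial>(lborel :: (real^2) measure))"
      unfolding chart_measure_def
    proof (rule nn_integral_cong_AE)
      have "AE x::real^2 in lborel. x \<notin> {x. x $ 1 = 0}" using Z by (rule AE_not_in)
      then show "AE x in lborel. ennreal (sqrt (gram_det (Vs n) (F \<circ> \<phi>s n) x)) *
          indicator (Vs n \<inter> \<phi>s n -` ?A) x = 0"
        by eventually_elim (use surface_boundary_iff[OF lp] in \<open>auto simp: indicator_def\<close>)
    qed
    finally show ?thesis by simp
  qed
  then have "emeasure ?M ?B = 0" using emeasure_pieces[OF H at s(2) B] by simp
  then show ?thesis using B s by (simp add: null_sets_def)
qed

subsection \<open>Quadratic forms on a real vector space\<close>

locale real_vs = vector_space scale for scale :: "real \<Rightarrow> 'v::ab_group_add \<Rightarrow> 'v"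
begin

text \<open>Polarization without the customary factor 1/2, so that
  \<open>polar q w w = 2 * q w\<close>.\<close>

definition polar :: "('v \<Rightarrow> real) \<Rightarrow> 'v \<Rightarrow> 'v \<Rightarrow> real" where
  "polar q y z = q (y + z) - q y - q z"

text \<open>Relative to \<open>W\<close>, since the second variation is well behaved only on smooth
  fields with integrable integrand; a non-integrable function has the default integral 0, which
  destroys additivity.\<close>

definition quadratic_on :: "'v set \<Rightarrow> ('v \<Rightarrow> real) \<Rightarrow> bool" where
  "quadratic_on W q \<longleftrightarrow>
     (\<forall>y\<in>W. \<forall>c. q (scale c y) = c\<^sup>2 * q y) \<and>
     (\<forall>x\<in>W. \<forall>y\<in>W. \<forall>z\<in>W. polar q (x + y) z = polar q x z + polar q y z) \<and>
     (\<forall>y\<in>W. \<forall>z\<in>W. \<forall>c. polar q (scale c y) z = c * polar q y z)"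

lemma polar_commute: "polar q y z = polar q z y"
  by (simp add: polar_def add.commute)

lemma quadratic_on_subset: "quadratic_on W q \<Longrightarrow> W' \<subseteq> W \<Longrightarrow> quadratic_on W' q"
  unfolding quadratic_on_def by (simp add: subset_iff)

lemma quadratic_onD:
  assumes "quadratic_on W q"
  shows "y \<in> W \<Longrightarrow> q (scale c y) = c\<^sup>2 * q y"
    and "x \<in> W \<Longrightarrow> y \<in> W \<Longrightarrow> z \<in> W \<Longrightarrow> polar q (x + y) z = polar q x z + polar q y z"
    and "y \<in> W \<Longrightarrow> z \<in> W \<Longrightarrow> polar q (scale c y) z = c * polar q y z"
  using assms unfolding quadratic_on_def by simp_all

lemma quadratic_on_cong:
  assumes W: "subspace W" and eq: "\<And>y. y \<in> W \<Longrightarrow> q y = r y" and r: "quadratic_on W r"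
  shows "quadratic_on W q"
proof -
  have p: "polar q y z = polar r y z" if "y \<in> W" "z \<in> W" for y z
    using that by (simp add: polar_def eq subspace_add[OF W])
  show ?thesis
    unfolding quadratic_on_def
    by (simp add: p eq subspace_add[OF W] subspace_scale[OF W] quadratic_onD[OF r])
qed

lemma quadratic_on_zero: "quadratic_on W q \<Longrightarrow> 0 \<in> W \<Longrightarrow> q 0 = 0"
  using quadratic_onD(1)[of W q 0 0] by simp

lemma quadratic_on_diff:
  "quadratic_on W q \<Longrightarrow> quadratic_on W r \<Longrightarrow> quadratic_on W (\<lambda>y. q y - r y)"
proof -
  have p: "polar (\<lambda>y. q y - r y) y z = polar q y z - polar r y z" for y z by (simp add: polar_def)
  assume "quadratic_on W q" "quadratic_on W r"
  then show ?thesis unfolding quadratic_on_def p by (simp add: algebra_simps)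
qed

lemma quadratic_on_integral:
  assumes W: "subspace W" and q: "\<And>p. p \<in> space M \<Longrightarrow> quadratic_on W (\<lambda>y. h y p)"
    and int: "\<And>y. y \<in> W \<Longrightarrow> integrable M (h y)"
  shows "quadratic_on W (\<lambda>y. \<integral>p. h y p \<partial>M)"
proof -
  have add: "y + z \<in> W" if "y \<in> W" "z \<in> W" for y z using W that by (rule subspace_add)
  have sc: "scale c y \<in> W" if "y \<in> W" for c y using W that by (rule subspace_scale)
  have ip: "integrable M (\<lambda>p. polar (\<lambda>y. h y p) y z)"
    and pol: "polar (\<lambda>y. \<integral>p. h y p \<partial>M) y z = (\<integral>p. polar (\<lambda>y. h y p) y z \<partial>M)" if "y \<in> W" "z \<in> W" for y z
    unfolding polar_def using that add int by simp_all
  show ?thesis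
    unfolding quadratic_on_def
  proof (intro conjI ballI allI)
    fix x y z c assume W3: "x \<in> W" "y \<in> W" "z \<in> W"
    have "(\<integral>p. h (scale c y) p \<partial>M) = (\<integral>p. c\<^sup>2 * h y p \<partial>M)"
      by (rule Bochner_Integration.integral_cong) (use quadratic_onD(1)[OF q] W3 in auto)
    then show "(\<integral>p. h (scale c y) p \<partial>M) = c\<^sup>2 * (\<integral>p. h y p \<partial>M)" by simp
    have "(\<integral>p. polar (\<lambda>y. h y p) (x + y) z \<partial>M) = (\<integral>p. polar (\<lambda>y. h y p) x z + polar (\<lambda>y. h y p) y z \<partial>M)"
      by (rule Bochner_Integration.integral_cong) (use quadratic_onD(2)[OF q] W3 in auto)
    also have "\<dots> = (\<integral>p. polar (\<lambda>y. h y p) x z \<partial>M) + (\<integral>p. polar (\<lambda>y. h y p) y z \<partial>M)"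
      by (rule Bochner_Integration.integral_add) (use ip W3 in auto)
    finally show "polar (\<lambda>y. \<integral>p. h y p \<partial>M) (x + y) z =
        polar (\<lambda>y. \<integral>p. h y p \<partial>M) x z + polar (\<lambda>y. \<integral>p. h y p \<partial>M) y z"
      using pol W3 add by simp
    have "(\<integral>p. polar (\<lambda>y. h y p) (scale c y) z \<partial>M) = (\<integral>p. c * polar (\<lambda>y. h y p) y z \<partial>M)"
      by (rule Bochner_Integration.integral_cong) (use quadratic_onD(3)[OF q] W3 in auto)
    then show "polar (\<lambda>y. \<integral>p. h y p \<partial>M) (scale c y) z = c * polar (\<lambda>y. \<integral>p. h y p \<partial>M) y z"
      using pol W3 sc by simp
  qed
qed

lemma quadratic_on_compose_linear:
  assumes add: "\<And>y z. y \<in> W \<Longrightarrow> z \<in> W \<Longrightarrow> L (y + z) = L y + L z"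
    and sc: "\<And>c y. y \<in> W \<Longrightarrow> L (scale c y) = c *\<^sub>R L y"
    and b: "\<And>l. Q l = B l l" and bil: "bounded_bilinear B" and W: "subspace W"
  shows "quadratic_on W (\<lambda>y. Q (L y) :: real)"
proof -
  interpret bounded_bilinear B by (rule bil)
  have p: "polar (\<lambda>y. Q (L y)) y z = B (L y) (L z) + B (L z) (L y)" if "y \<in> W" "z \<in> W" for y z
    using that by (simp add: polar_def b add.commute assms(1) add_left add_right)
  show ?thesis
    unfolding quadratic_on_def
  proof (intro conjI ballI allI)
    fix x y z c assume "x \<in> W" "y \<in> W" "z \<in> W"
    then show "Q (L (scale c y)) = c\<^sup>2 * Q (L y)"
      "polar (\<lambda>y. Q (L y)) (x + y) z = polar (\<lambda>y. Q (L y)) x z + polar (\<lambda>y. Q (L y)) y z"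
      "polar (\<lambda>y. Q (L y)) (scale c y) z = c * polar (\<lambda>y. Q (L y)) y z"
      by (simp_all only: p subspace_add[OF W] subspace_scale[OF W])
         (simp_all add: b sc assms(1) add_left add_right scaleR_left scaleR_right power2_eq_square algebra_simps)
  qed
qed

text \<open>Split off a vector \<open>w\<close> with \<open>q w < 0\<close> together with its \<open>q\<close>-orthogonal complement until
  \<open>q \<ge> 0\<close> on what remains; there \<open>r\<close> has to be negative.\<close>

lemma negative_definite_split:
  assumes "subspace W" "finite B" "span B = W" "quadratic_on W q"
    and "\<forall>y\<in>W. y \<noteq> 0 \<longrightarrow> q y + r y < 0"
  shows "\<exists>B1 B2. independent B1 \<and> independent B2 \<and> finite B1 \<and> finite B2 \<and> B1 \<subseteq> W \<and> B2 \<subseteq> W \<and>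
     dim W \<le> card B1 + card B2 \<and> (\<forall>y\<in>span B1. y \<noteq> 0 \<longrightarrow> q y < 0) \<and> (\<forall>y\<in>span B2. y \<noteq> 0 \<longrightarrow> r y < 0)"
  using assms
proof (induction "dim W" arbitrary: W B rule: less_induct)
  case less
  note W = less.prems(1) and B = less.prems(2,3) and q = less.prems(4)
  have neg: "q y + r y < 0" if "y \<in> W" "y \<noteq> 0" for y using less.prems(5) that by blast
  show ?case
  proof (cases "\<forall>y\<in>W. q y \<ge> 0")
    case True
    obtain B2 where B2: "B2 \<subseteq> W" "independent B2" "W \<subseteq> span B2" "card B2 = dim W"
      by (rule basis_exists)
    have "finite B2" using independent_span_bound[OF B(1) B2(2)] B2(1) B(2) by blast
    moreover have "span B2 \<subseteq> W" using B2(1) W by (rule span_minimal)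
    moreover have "r y < 0" if "y \<in> W" "y \<noteq> 0" for y using neg[OF that] True that by force
    ultimately have "\<forall>y\<in>span B2. y \<noteq> 0 \<longrightarrow> r y < 0" by blast
    then show ?thesis
      using B2 \<open>finite B2\<close> by (intro exI[of _ "{}"] exI[of _ B2]) (simp add: independent_empty)
  next
    case False
    then obtain w where w: "w \<in> W" "q w < 0" by force
    define W' where "W' = {y \<in> W. polar q y w = 0}"
    have q0: "q 0 = 0" using quadratic_on_zero[OF q subspace_0[OF W]] .
    have pww: "polar q w w = 2 * q w"
    proof -
      have "w + w = scale 2 w" using scale_left_distrib[of 1 1 w] by simp
      then show ?thesis using quadratic_onD(1)[OF q w(1), of 2] by (simp add: polar_def)
    qed
    have W': "subspace W'"
      unfolding W'_def
    proof (rule subspaceI)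
      show "0 \<in> {y \<in> W. polar q y w = 0}" using subspace_0[OF W] q0 by (simp add: polar_def)
    qed (use quadratic_onD(2,3)[OF q] W w(1) in \<open>auto simp: subspace_add subspace_scale\<close>)
    have W'W: "W' \<subseteq> W" by (auto simp: W'_def)
    obtain B' where B': "B' \<subseteq> W'" "independent B'" "W' \<subseteq> span B'" "card B' = dim W'"
      by (rule basis_exists)
    have fB': "finite B'" using independent_span_bound[OF B(1) B'(2)] B'(1) W'W B(2) by blast
    have sB': "span B' = W'" using B'(1,3) W' span_minimal by blast
    have wW': "w \<notin> W'" using pww w(2) by (simp add: W'_def)
    have "W \<subseteq> span (insert w B')"
    proof
      fix y assume y: "y \<in> W"
      \<comment> \<open>The Gram-Schmidt coefficient that makes \<open>y + c w\<close> orthogonal to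
        \<open>w\<close> with respect to \<open>q\<close>; the denominator equals
        \<open>2 * q w\<close> and is nonzero. Hence \<open>w\<close> and \<open>W'\<close> span
        \<open>W\<close>, and the dimension drops by one.\<close>
      define c where "c = - (polar q y w / polar q w w)"
      have cw: "scale c w \<in> W" using W w(1) by (rule subspace_scale)
      have "polar q (y + scale c w) w = 0"
        using quadratic_onD(2)[OF q y cw w(1)] quadratic_onD(3)[OF q w(1) w(1), of c] pww w(2)
        by (simp add: c_def)
      then have "y + scale c w \<in> W'" using subspace_add[OF W y cw] by (simp add: W'_def)
      then have "y - scale (- c) w \<in> span B'" using sB' by simp
      then show "y \<in> span (insert w B')" unfolding span_breakdown_eq by blast
    qed
    moreover have "independent (insert w B')" using wW' B'(2) sB' by (intro independent_insertI) auto
    moreover have "insert w B' \<subseteq> W" using w(1) B'(1) W'W by blast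
    ultimately have "card (insert w B') = dim W" by (intro basis_card_eq_dim)
    moreover have "w \<notin> B'" using wW' B'(1) by blast
    ultimately have dimW: "dim W = Suc (dim W')" using fB' B'(4) by simp
    have "\<exists>B1 B2. independent B1 \<and> independent B2 \<and> finite B1 \<and> finite B2 \<and> B1 \<subseteq> W' \<and> B2 \<subseteq> W' \<and>
     dim W' \<le> card B1 + card B2 \<and> (\<forall>y\<in>span B1. y \<noteq> 0 \<longrightarrow> q y < 0) \<and> (\<forall>y\<in>span B2. y \<noteq> 0 \<longrightarrow> r y < 0)"
    proof (rule less.hyps[OF _ W' fB' sB' quadratic_on_subset[OF q W'W]])
      show "dim W' < dim W" using dimW by simp
      show "\<forall>y\<in>W'. y \<noteq> 0 \<longrightarrow> q y + r y < 0" using neg W'W by blast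
    qed
    then obtain B1 B2 where IH: "independent B1" "independent B2" "finite B1" "finite B2" "B1 \<subseteq> W'" "B2 \<subseteq> W'"
      "dim W' \<le> card B1 + card B2" "\<forall>y\<in>span B1. y \<noteq> 0 \<longrightarrow> q y < 0" "\<forall>y\<in>span B2. y \<noteq> 0 \<longrightarrow> r y < 0"
      by (elim exE conjE)
    have sB1: "span B1 \<subseteq> W'" using IH(5) W' by (rule span_minimal)
    have wB1: "w \<notin> span B1" using sB1 wW' by blast
    have "q y < 0" if y: "y \<in> span (insert w B1)" "y \<noteq> 0" for y
    proof -
      obtain c where c: "y - scale c w \<in> span B1" using y(1) unfolding span_breakdown_eq by blast
      define z where "z = y - scale c w"
      have z: "z \<in> W'" "z \<in> span B1" "y = scale c w + z" using c sB1 by (auto simp: z_def)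
      \<comment> \<open>Orthogonality removes the mixed term, so \<open>q\<close> of the sum is
        \<open>c\<^sup>2 * q w + q z\<close>, with both summands nonpositive and one of them
        negative.\<close>
      have "polar q w z = 0" using z(1) by (simp add: W'_def polar_commute[of q w])
      then have "polar q (scale c w) z = 0" using quadratic_onD(3)[OF q w(1), of z c] z(1) W'W by auto
      then have qy: "q y = c\<^sup>2 * q w + q z"
        unfolding z(3) using quadratic_onD(1)[OF q w(1), of c] by (simp add: polar_def)
      show ?thesis
      proof (cases "z = 0")
        case True
        then have "c \<noteq> 0" using y(2) z(3) by auto
        then show ?thesis using qy q0 True w(2) by (simp add: mult_pos_neg)
      next
        case False
        then have "q z < 0" using IH(8) z(2) by blast
        moreover have "c\<^sup>2 * q w \<le> 0" using w(2) by (simp add: mult_nonneg_nonpos)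
        ultimately show ?thesis using qy by linarith
      qed
    qed
    moreover have "independent (insert w B1)" using wB1 IH(1) by (rule independent_insertI)
    moreover have "w \<notin> B1" using wB1 span_base by blast
    ultimately show ?thesis
      using IH W'W w(1) dimW by (intro exI[of _ "insert w B1"] exI[of _ B2]) auto
  qed
qed

end

subsection \<open>The boundary curve\<close>

text \<open>The edge of \<open>half_plane\<close> as a copy of \<open>real^1\<close>, the coordinate
  space used by \<open>boundary_length_measure\<close>.\<close>

definition bline :: "real^1 \<Rightarrow> real^2" where
  "bline t = (t $ 1) *\<^sub>R axis 2 1"

lemma bline_nth: "bline t $ 1 = 0" "bline t $ 2 = t $ 1"
  by (simp_all add: bline_def axis_def)

lemma bounded_linear_bline: "bounded_linear bline"
  unfolding bline_def by (intro bounded_linear_scaleR_const bounded_linear_vec_nth)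

lemma bline_eqI: "x $ 1 = 0 \<Longrightarrow> bline (vec (x $ 2)) = x"
  by (simp add: vec_eq_iff forall_2 bline_nth)

text \<open>A chart of the surface restricted to the edge of the half-plane. It captures every
  boundary point in the chart image, because being a boundary point does not depend on the
  chart.\<close>

lemma boundary_curve_param:
  assumes lp: "local_param half_plane X F V \<phi>"
  defines "V1 \<equiv> bline -` V"
  shows "local_param UNIV (subtopology X (surface_boundary X F)) F V1 (\<phi> \<circ> bline)"
    and "(\<phi> \<circ> bline) ` V1 = \<phi> ` V \<inter> surface_boundary X F"
proof -
  let ?B = "surface_boundary X F" and ?f = "\<phi> \<circ> bline"
  note emb = local_param_emb[OF lp]
  have cl: "continuous_on S bline" for S using bounded_linear_bline by (rule linear_continuous_on)
  obtain O' where O': "open O'" "V = half_plane \<inter> O'"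
    using emb_param_openin[OF emb] by (auto simp: openin_open)
  have "V1 = bline -` O'" by (auto simp: V1_def O' half_plane_def bline_nth)
  then have oV1: "open V1" using open_vimage[OF O'(1) cl] by simp
  show img: "?f ` V1 = \<phi> ` V \<inter> ?B"
  proof (intro equalityI subsetI)
    fix p assume "p \<in> ?f ` V1"
    then obtain t where t: "bline t \<in> V" "p = \<phi> (bline t)" by (auto simp: V1_def)
    then show "p \<in> \<phi> ` V \<inter> ?B" using surface_boundary_iff[OF lp t(1)] by (simp add: bline_nth)
  next
    fix p assume "p \<in> \<phi> ` V \<inter> ?B"
    then obtain x where x: "x \<in> V" "p = \<phi> x" "\<phi> x \<in> ?B" by auto
    then have "bline (vec (x $ 2)) = x" using surface_boundary_iff[OF lp x(1)] bline_eqI by blast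
    then show "p \<in> ?f ` V1" using x by (intro image_eqI[of _ _ "vec (x $ 2)"]) (auto simp: V1_def)
  qed
  have opV: "openin X (\<phi> ` V)" using lp by (simp add: local_param_def)
  have opf: "openin (subtopology X ?B) (?f ` V1)"
    unfolding img openin_subtopology using opV by blast
  have "continuous_map (top_of_set V1) (top_of_set V) bline"
    using cl by (auto simp: V1_def continuous_map_in_subtopology)
  then have "continuous_map (top_of_set V1) X ?f"
    using emb_param_continuous[OF emb] by (rule continuous_map_compose)
  then have cf: "continuous_map (top_of_set V1) (subtopology (subtopology X ?B) (?f ` V1)) ?f"
    using img by (auto simp: continuous_map_in_subtopology)
  \<comment> \<open>The inverse of the curve chart: the second coordinate of the surface chart's
    inverse, since the first one is 0 on the boundary.\<close>
  let ?g = "\<lambda>p. vec (inv_into V \<phi> p $ 2) :: real^1"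
  have gf: "?g (?f t) = t" if "t \<in> V1" for t
    using that emb_param_inj[OF emb] by (simp add: V1_def vec_eq_iff bline_nth)
  have "continuous_map (subtopology X (\<phi> ` V)) (top_of_set V) (inv_into V \<phi>)"
    by (rule emb_param_inv_continuous[OF emb])
  then have "continuous_map (subtopology (subtopology X (\<phi> ` V)) (?f ` V1)) (top_of_set V) (inv_into V \<phi>)"
    by (rule continuous_map_from_subtopology)
  moreover have "subtopology (subtopology X (\<phi> ` V)) (?f ` V1) = subtopology (subtopology X ?B) (?f ` V1)"
    unfolding subtopology_subtopology img by (rule arg_cong[where f = "subtopology X"]) auto
  ultimately have ci: "continuous_map (subtopology (subtopology X ?B) (?f ` V1)) (top_of_set V) (inv_into V \<phi>)"
    by simp
  have "continuous_map (top_of_set V) euclidean (\<lambda>x::real^2. vec (x $ 2) :: real^1)"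
    by (simp add: vec_def) (intro continuous_intros)
  with ci have "continuous_map (subtopology (subtopology X ?B) (?f ` V1)) euclidean ?g"
    by (rule continuous_map_compose[unfolded o_def])
  then have cg: "continuous_map (subtopology (subtopology X ?B) (?f ` V1)) (top_of_set V1) ?g"
    using gf by (auto simp: continuous_map_in_subtopology)
  have "homeomorphic_maps (top_of_set V1) (subtopology (subtopology X ?B) (?f ` V1)) ?f ?g"
    unfolding homeomorphic_maps_def using cf cg gf by auto
  then have hom: "homeomorphic_map (top_of_set V1) (subtopology (subtopology X ?B) (?f ` V1)) ?f"
    by (rule homeomorphic_maps_imp_map)
  have sb: "smooth_on V1 bline"
    using Ck_on_bounded_linear[OF bounded_linear_bline oV1] by (rule smooth_on_Ck[OF oV1])
  have "smooth_on V1 (\<lambda>t. (F \<circ> \<phi>) (bline t))"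
    by (rule smooth_on_compose[OF emb_param_smooth[OF emb] sb]) (auto simp: V1_def)
  then have sm: "smooth_on V1 (F \<circ> ?f)" by (simp add: o_def)
  have "inj (D V1 (F \<circ> ?f) t)" if t: "t \<in> V1" for t
  proof -
    have bV: "bline t \<in> V" using t by (simp add: V1_def)
    have "((F \<circ> \<phi>) has_derivative D V (F \<circ> \<phi>) (bline t)) (at (bline t) within bline ` V1)"
      by (rule has_derivative_subset[OF smooth_on_has_derivative[OF emb_param_smooth[OF emb] bV]]) (auto simp: V1_def)
    with bounded_linear_imp_has_derivative[OF bounded_linear_bline]
    have "((F \<circ> \<phi> \<circ> bline) has_derivative (D V (F \<circ> \<phi>) (bline t) \<circ> bline)) (at t within V1)"
      by (rule diff_chain_within)
    then have "((F \<circ> ?f) has_derivative (D V (F \<circ> \<phi>) (bline t) \<circ> bline)) (at t within V1)"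
      by (simp add: o_assoc)
    then have "D V1 (F \<circ> ?f) t = D V (F \<circ> \<phi>) (bline t) \<circ> bline"
      using D_eqI[OF model_space_UNIV _ t] oV1 by (simp add: openin_open_eq)
    moreover have "inj bline" by (rule injI) (metis bline_nth(2) vec_eq_iff num1_eq1)
    ultimately show ?thesis using emb_param_imm[OF emb bV] by (simp add: inj_compose)
  qed
  then show "local_param UNIV (subtopology X ?B) F V1 ?f"
    unfolding local_param_def using oV1 opf hom sm by simp
qed

lemma immersed_boundary:
  assumes X: "immersed half_plane X F"
  shows "immersed (UNIV :: (real^1) set) (subtopology X (surface_boundary X F)) F"
  unfolding immersed_def
proof (intro conjI ballI)
  show "Hausdorff_space (subtopology X (surface_boundary X F))" "second_countable (subtopology X (surface_boundary X F))"
    using X by (auto simp: immersed_def intro: Hausdorff_space_subtopology second_countable_subtopology)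
  fix p assume p: "p \<in> topspace (subtopology X (surface_boundary X F))"
  then obtain V \<phi> where lp: "local_param half_plane X F V \<phi>" and pV: "p \<in> \<phi> ` V"
    using X by (auto simp: immersed_def)
  show "\<exists>V \<phi>. local_param (UNIV :: (real^1) set) (subtopology X (surface_boundary X F)) F V \<phi> \<and> p \<in> \<phi> ` V"
    using boundary_curve_param[OF lp] p pV
    by (intro exI[of _ "bline -` V"] exI[of _ "\<phi> \<circ> bline"]) auto
qed

subsection \<open>Restriction of normal fields to pieces\<close>

text \<open>Cutting off by 0 follows the convention of \<open>normal_sections\<close> and keeps
  restriction linear on all functions.\<close>

definition restrict_field :: "'a topology \<Rightarrow> ('a \<Rightarrow> real^'n) \<Rightarrow> 'a \<Rightarrow> real^'n" where
  "restrict_field P Y p = (if p \<in> topspace P then Y p else 0)"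

text \<open>Without boundary points a chart domain avoids the edge of the half-plane. This is the
  openness under which \<open>smooth_\<tau>\<close> holds.\<close>

lemma no_boundary_param_open:
  assumes "surface_boundary X F = {}" "local_param half_plane X F W \<psi>"
  shows "open W"
proof -
  obtain O' where O': "open O'" "W = half_plane \<inter> O'"
    using assms(2) by (auto simp: local_param_def openin_open)
  have "x $ 1 \<noteq> 0" if "x \<in> W" for x using surface_boundary_iff[OF assms(2) that] assms(1) by simp
  then have "W = {x::real^2. 0 < x $ 1} \<inter> O'" using O'(2) by (force simp: half_plane_def)
  moreover have "open ({x::real^2. 0 < x $ 1} \<inter> O')"
    by (intro open_Int O'(1) open_Collect_less continuous_intros)
  ultimately show ?thesis by simp
qed

text \<open>Transition maps embed the tangent spaces of the subspace in those of \<open>X\<close>,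
  so normal vectors stay normal. In a boundary chart the field is its expression in an open chart of
  \<open>X\<close> composed with a smooth transition map.\<close>

lemma restrict_field_smooth_normal:
  assumes X: "immersed half_plane X F" and nb: "surface_boundary X F = {}" and Y: "smooth_normal_field X F Y"
  shows "smooth_normal_field (subtopology X S) F (restrict_field (subtopology X S) Y)"
  unfolding smooth_normal_field_def
proof (intro conjI ballI allI impI)
  let ?P = "subtopology X S"
  have chart: "\<exists>W \<psi>. transition half_plane X F V \<phi> W \<psi> \<and> \<phi> x \<in> \<psi> ` W"
    if "local_param half_plane ?P F V \<phi>" "x \<in> V" for V \<phi> x
  proof -
    have emb: "emb_param half_plane X F V \<phi>" using that(1) by (rule local_param_subtopology_emb)
    then have "\<phi> x \<in> topspace X" using emb_param_subset that(2) by blast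
    then obtain W \<psi> where "local_param half_plane X F W \<psi>" "\<phi> x \<in> \<psi> ` W" using X by (auto simp: immersed_def)
    then show ?thesis using emb model_space_half_plane transition.intro by blast
  qed
  {
    fix p assume p: "p \<in> topspace ?P"
    have "tangent_space ?P F p \<subseteq> tangent_space X F p"
    proof
      fix t assume "t \<in> tangent_space ?P F p"
      then obtain V \<phi> x v where lp: "local_param half_plane ?P F V \<phi>" and x: "x \<in> V" "\<phi> x = p"
        and t: "t = D V (F \<circ> \<phi>) x v" unfolding tangent_space_def by blast
      obtain W \<psi> where tr: "transition half_plane X F V \<phi> W \<psi>" and xW: "\<phi> x \<in> \<psi> ` W"
        using chart[OF lp x(1)] by blast
      interpret transition half_plane X F V \<phi> W \<psi> by (rule tr)
      have xd: "x \<in> dom" using x xW by (simp add: dom_def)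
      obtain A where "D V (F \<circ> \<phi>) x = (\<lambda>v. D W (F \<circ> \<psi>) (\<tau> x) (A v))"
        using \<tau>_derivative[OF xd] by blast
      then have "t = D W (F \<circ> \<psi>) (\<tau> x) (A v)" using t by simp
      moreover have "\<tau> x \<in> W" "\<psi> (\<tau> x) = p" using \<tau>[OF xd] x(2) by auto
      ultimately show "t \<in> tangent_space X F p" unfolding tangent_space_def using loc by blast
    qed
    moreover have "Y p \<in> normal_space X F p" using Y p by (simp add: smooth_normal_field_def)
    ultimately have "Y p \<in> normal_space ?P F p"
      by (auto simp: normal_space_def orthogonal_comp_def)
    then show "restrict_field ?P Y p \<in> normal_space ?P F p" using p by (simp add: restrict_field_def)
  }
  fix V \<phi> assume lp: "local_param half_plane ?P F V \<phi>"
  have "smooth_on V (Y \<circ> \<phi>)"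
  proof (rule smooth_on_local)
    fix x assume x: "x \<in> V"
    obtain W \<psi> where tr: "transition half_plane X F V \<phi> W \<psi>" and xW: "\<phi> x \<in> \<psi> ` W"
      using chart[OF lp x] by blast
    interpret transition half_plane X F V \<phi> W \<psi> by (rule tr)
    have "smooth_on W (Y \<circ> \<psi>)" using Y loc by (simp add: smooth_normal_field_def)
    then have "smooth_on dom (Y \<circ> \<phi>)" using smooth_via no_boundary_param_open[OF nb loc] by blast
    moreover have "x \<in> dom" using x xW by (simp add: dom_def)
    ultimately show "\<exists>S'. openin (top_of_set V) S' \<and> x \<in> S' \<and> smooth_on S' (Y \<circ> \<phi>)"
      using openin_dom by blast
  qed
  moreover have "(Y \<circ> \<phi>) x = (restrict_field ?P Y \<circ> \<phi>) x" if "x \<in> V" for x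
    using emb_param_subset[OF local_param_emb[OF lp]] that by (auto simp: restrict_field_def)
  ultimately show "smooth_on V (restrict_field ?P Y \<circ> \<phi>)"
    using smooth_on_cong[of V "Y \<circ> \<phi>" "restrict_field ?P Y \<circ> \<phi>"] by blast
qed

lemma normal_sections_iff:
  "Y \<in> normal_sections X F \<Omega> \<longleftrightarrow> (\<forall>p. p \<notin> topspace X \<longrightarrow> Y p = 0) \<and> smooth_normal_field X F Y \<and>
     X closure_of {p \<in> topspace X. Y p \<noteq> 0} \<subseteq> \<Omega>"
  by (auto simp: normal_sections_def smooth_normal_field_def)

lemma restrict_field_normal_sections:
  assumes "immersed half_plane X F" "surface_boundary X F = {}" "Y \<in> normal_sections X F \<Omega>"
  shows "restrict_field (subtopology X S) Y \<in> normal_sections (subtopology X S) F (\<Omega> \<inter> S)"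
  unfolding normal_sections_iff
proof (intro conjI allI impI)
  let ?P = "subtopology X S"
  let ?N = "{p \<in> topspace ?P. restrict_field ?P Y p \<noteq> 0}"
  show "smooth_normal_field ?P F (restrict_field ?P Y)"
    using assms by (intro restrict_field_smooth_normal) (auto simp: normal_sections_iff)
  have "?P closure_of ?N \<subseteq> X closure_of ?N" by (rule closure_of_subtopology_subset)
  also have "\<dots> \<subseteq> X closure_of {p \<in> topspace X. Y p \<noteq> 0}"
    by (rule closure_of_mono) (auto simp: restrict_field_def)
  also have "\<dots> \<subseteq> \<Omega>" using assms(3) by (simp add: normal_sections_iff)
  finally have "?P closure_of ?N \<subseteq> \<Omega>" .
  moreover have "?P closure_of ?N \<subseteq> S" using closure_of_subset_topspace[of ?P ?N] by auto
  ultimately show "?P closure_of ?N \<subseteq> \<Omega> \<inter> S" by blast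
qed (auto simp: restrict_field_def)

text \<open>One chart of the subspace computes both densities, once as a chart and once as an
  embedded parametrization of \<open>X\<close>.\<close>

lemma variation_density_restrict:
  assumes X: "immersed half_plane X F" and nb: "surface_boundary X F = {}" and Y: "smooth_normal_field X F Y"
    and P: "immersed half_plane (subtopology X S) F" and p: "p \<in> topspace (subtopology X S)"
  shows "variation_density (subtopology X S) F (restrict_field (subtopology X S) Y) p = variation_density X F Y p"
proof -
  let ?P = "subtopology X S" and ?Y = "restrict_field (subtopology X S) Y"
  obtain V \<phi> u where fp: "framed_param ?P F V \<phi> u" and "p \<in> \<phi> ` V"
    using framed_param_exists[OF P p] by blast
  then obtain x where x: "x \<in> V" "p = \<phi> x" by auto
  have lp: "local_param half_plane ?P F V \<phi>" and fr: "on_frame (D V (F \<circ> \<phi>) x) (\<lambda>i. u i x)"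
    using fp x by (auto simp: framed_param_iff)
  have sY: "smooth_on V (?Y \<circ> \<phi>)"
    using restrict_field_smooth_normal[OF X nb Y] lp by (simp add: smooth_normal_field_def)
  have eq: "(?Y \<circ> \<phi>) z = (Y \<circ> \<phi>) z" if "z \<in> V" for z
    using emb_param_subset[OF local_param_emb[OF lp]] that by (auto simp: restrict_field_def)
  have "((Y \<circ> \<phi>) has_derivative D V (?Y \<circ> \<phi>) x) (at x within V)"
    by (rule has_derivative_transform[OF x(1) _ smooth_on_has_derivative[OF sY x(1)]]) (use eq in simp)
  then have "D V (Y \<circ> \<phi>) x = D V (?Y \<circ> \<phi>) x"
    using lp x(1) by (intro D_eqI[OF model_space_half_plane]) (auto simp: local_param_def)
  then show ?thesis
    unfolding x(2)
    using variation_density_eq[OF P restrict_field_smooth_normal[OF X nb Y] local_param_emb[OF lp] x(1) fr]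
      variation_density_eq[OF X Y local_param_subtopology_emb[OF lp] x(1) fr] by simp
qed

subsection \<open>The second variation on pieces\<close>

interpretation fun_quad: real_vs "\<lambda>(c::real) (Y::'a \<Rightarrow> 'b::real_vector) p. c *\<^sub>R Y p"
  by (intro real_vs.intro fun_vs.vector_space_axioms)

lemma continuous_map_chartwise:
  assumes X: "immersed H X F" and h: "\<And>V \<phi>. local_param H X F V \<phi> \<Longrightarrow> continuous_on V (h \<circ> \<phi>)"
  shows "continuous_map X euclidean h"
proof (rule pasting_lemma[where I = "{(V, \<phi>). local_param H X F V \<phi>}" and
      T = "\<lambda>(V, \<phi>). \<phi> ` V" and f = "\<lambda>_. h"])
  fix i assume "i \<in> {(V, \<phi>). local_param H X F V \<phi>}"
  then obtain V \<phi> where i: "i = (V, \<phi>)" and lp: "local_param H X F V \<phi>" by auto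
  note emb = local_param_emb[OF lp]
  show "openin X (case i of (V, \<phi>) \<Rightarrow> \<phi> ` V)" using lp by (simp add: i local_param_def)
  have "continuous_map (subtopology X (\<phi> ` V)) euclidean ((h \<circ> \<phi>) \<circ> inv_into V \<phi>)"
    using h[OF lp] by (intro continuous_map_compose[OF emb_param_inv_continuous[OF emb]]) simp
  then have "continuous_map (subtopology X (\<phi> ` V)) euclidean h"
    by (rule continuous_map_eq) (use emb_param_inj[OF emb] in auto)
  then show "continuous_map (subtopology X (case i of (V, \<phi>) \<Rightarrow> \<phi> ` V)) euclidean h" by (simp add: i)
next
  fix p assume "p \<in> topspace X"
  then obtain V \<phi> where "local_param H X F V \<phi>" "p \<in> \<phi> ` V" using X by (auto simp: immersed_def)
  then show "\<exists>j. j \<in> {(V, \<phi>). local_param H X F V \<phi>} \<and> p \<in> (case j of (V, \<phi>) \<Rightarrow> \<phi> ` V) \<and> h p = h p"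
    by (intro exI[of _ "(V, \<phi>)"]) auto
qed auto

lemma immersion_continuous:
  assumes "immersed H X F"
  shows "continuous_map X euclidean F"
  by (rule continuous_map_chartwise[OF assms])
     (blast intro: smooth_on_continuous_on emb_param_smooth local_param_emb)

lemma smooth_normal_field_continuous:
  assumes "immersed half_plane X F" "smooth_normal_field X F Y"
  shows "continuous_map X euclidean Y"
proof (rule continuous_map_chartwise[OF assms(1)])
  fix V \<phi> assume "local_param half_plane X F V \<phi>"
  then have "smooth_on V (Y \<circ> \<phi>)" using assms(2) by (simp add: smooth_normal_field_def)
  then show "continuous_on V (Y \<circ> \<phi>)" by (rule smooth_on_continuous_on)
qed

text \<open>At a fixed point and frame, the density is a bilinear form \<open>B\<close>, the
  polarized \<open>shape_energy\<close>, evaluated twice at the derivative of \<open>Y\<close>, and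
  this derivative is linear in \<open>Y\<close> on \<open>W\<close>.\<close>

lemma variation_density_quadratic:
  assumes X: "immersed half_plane X F" and W: "fun_vs.subspace W"
    and WY: "\<And>Y. Y \<in> W \<Longrightarrow> smooth_normal_field X F Y" and p: "p \<in> topspace X"
  shows "fun_quad.quadratic_on W (\<lambda>Y. variation_density X F Y p)"
proof -
  obtain V \<phi> u where fp: "framed_param X F V \<phi> u" and "p \<in> \<phi> ` V"
    using framed_param_exists[OF X p] by blast
  then obtain x where x: "x \<in> V" "p = \<phi> x" by auto
  have lp: "local_param half_plane X F V \<phi>" and fr: "on_frame (D V (F \<circ> \<phi>) x) (\<lambda>i. u i x)"
    using fp x by (auto simp: framed_param_iff)
  note mV = model_space_half_plane emb_param_openin[OF local_param_emb[OF lp]]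
  define e where "e j = D V (F \<circ> \<phi>) x (u j x)" for j
  define L :: "('a \<Rightarrow> real^'b) \<Rightarrow> real^'b^2" where "L Y = (\<chi> i. D V (Y \<circ> \<phi>) x (u i x))" for Y
  define B :: "real^'b^2 \<Rightarrow> real^'b^2 \<Rightarrow> real" where
    "B l m = (\<Sum>i\<in>UNIV. l $ i \<bullet> m $ i - 2 * (\<Sum>j\<in>UNIV. (l $ i \<bullet> e j) * (m $ i \<bullet> e j)))" for l m
  have "bilinear B"
    unfolding bilinear_def B_def
    by (intro conjI allI linearI)
       (simp_all add: sum_2 inner_add_left inner_add_right algebra_simps)
  then have bB: "bounded_bilinear B" by (simp add: bilinear_conv_bounded_bilinear)
  have d: "((Y \<circ> \<phi>) has_derivative D V (Y \<circ> \<phi>) x) (at x within V)" if "Y \<in> W" for Y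
    using WY[OF that] lp x(1) by (auto simp: smooth_normal_field_def intro: smooth_on_has_derivative)
  have eq: "variation_density X F Y p = B (L Y) (L Y)" if "Y \<in> W" for Y
    using variation_density_eq[OF X WY[OF that] local_param_emb[OF lp] x(1) fr]
    by (simp add: x(2) shape_energy_def B_def L_def e_def power2_norm_eq_inner power2_eq_square[of "_ \<bullet> _"])
  have "fun_quad.quadratic_on W (\<lambda>Y. B (L Y) (L Y))"
  proof (rule fun_quad.quadratic_on_compose_linear[OF _ _ refl bB W])
    fix Y Z assume YZ: "Y \<in> W" "Z \<in> W"
    have "(((Y + Z) \<circ> \<phi>) has_derivative (\<lambda>v. D V (Y \<circ> \<phi>) x v + D V (Z \<circ> \<phi>) x v)) (at x within V)"
      using has_derivative_add[OF d[OF YZ(1)] d[OF YZ(2)]] by (simp add: o_def)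
    from D_eqI[OF mV x(1) this] show "L (Y + Z) = L Y + L Z" by (simp add: L_def vec_eq_iff)
  next
    fix c Y assume Y: "Y \<in> W"
    have "(((\<lambda>p. c *\<^sub>R Y p) \<circ> \<phi>) has_derivative (\<lambda>v. c *\<^sub>R D V (Y \<circ> \<phi>) x v)) (at x within V)"
      using has_derivative_scaleR_right[OF d[OF Y], of c] by (simp add: o_def)
    from D_eqI[OF mV x(1) this] show "L (\<lambda>p. c *\<^sub>R Y p) = c *\<^sub>R L Y" by (simp add: L_def vec_eq_iff)
  qed
  then show ?thesis
    using fun_quad.quadratic_on_cong[OF W, of "\<lambda>Y. variation_density X F Y p" "\<lambda>Y. B (L Y) (L Y)"] eq by blast
qed

text \<open>Expresses the second variation of a piece by measures that do not mention the piece: the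
  area of \<open>X\<close>, and a length measure depending only on \<open>B\<close>. For the two
  pieces the boundary integrals thus become literally the same.\<close>

lemma second_variation_restrict:
  assumes X: "immersed half_plane X F" and nb: "surface_boundary X F = {}" and Y: "smooth_normal_field X F Y"
    and P: "immersed half_plane (subtopology X S) F" and S: "closedin X (topspace X \<inter> S)"
    and B: "surface_boundary (subtopology X S) F = B" "B \<subseteq> topspace X \<inter> S"
  shows "second_variation \<epsilon> (subtopology X S) F (restrict_field (subtopology X S) Y) =
    (\<integral>p. indicator (topspace X \<inter> S) p * variation_density X F Y p \<partial>area_measure X F)
     + \<epsilon> * (\<integral>p. (norm (Y p))\<^sup>2 \<partial>volume_measure (UNIV :: (real^1) set) (subtopology X B) F)"
proof -
  let ?P = "subtopology X S" and ?A = "area_measure X F" and ?T = "topspace X \<inter> S"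
  let ?L = "volume_measure (UNIV :: (real^1) set) (subtopology X B) F"
  note H = model_space_half_plane
  have sp: "space ?A = topspace X" "sets ?A = borel_sets X"
    using volume_measure_sets[OF H X] by (simp_all add: area_measure_def)
  have T: "?T \<in> borel_sets X" using S by (rule closedin_borel_sets)
  have area: "area_measure ?P F = restrict_space ?A ?T"
    unfolding area_measure_def by (rule volume_measure_subtopology[OF H X P T])
  have "(\<integral>p. variation_density ?P F (restrict_field ?P Y) p \<partial>area_measure ?P F) =
      (\<integral>p. variation_density X F Y p \<partial>restrict_space ?A ?T)"
    unfolding area
    by (rule Bochner_Integration.integral_cong)
       (use variation_density_restrict[OF X nb Y P] sp in \<open>auto simp: space_restrict_space\<close>)
  also have "\<dots> = (\<integral>p. indicator ?T p * variation_density X F Y p \<partial>?A)"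
    using T sp by (subst integral_restrict_space) (auto simp: Int_absorb2)
  finally have 1: "(\<integral>p. variation_density ?P F (restrict_field ?P Y) p \<partial>area_measure ?P F) =
      (\<integral>p. indicator ?T p * variation_density X F Y p \<partial>?A)" .
  have "subtopology ?P B = subtopology X B"
    using B(2) by (simp add: subtopology_subtopology Int_absorb1)
  then have len: "boundary_length_measure ?P F = ?L"
    by (simp add: boundary_length_measure_def B(1))
  have "immersed (UNIV :: (real^1) set) (subtopology X B) F"
    using immersed_boundary[OF P] \<open>subtopology ?P B = subtopology X B\<close> by (simp add: B(1))
  from volume_measure_sets(1)[OF model_space_UNIV this]
  have "space ?L = topspace X \<inter> B" by simp
  then have "(\<integral>p. (norm (restrict_field ?P Y p))\<^sup>2 \<partial>?L) = (\<integral>p. (norm (Y p))\<^sup>2 \<partial>?L)"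
    by (intro Bochner_Integration.integral_cong) (use B(2) in \<open>auto simp: restrict_field_def\<close>)
  with 1 show ?thesis unfolding second_variation_def len by simp
qed

text \<open>Needed for injectivity of restriction: a field whose restriction is 0 cannot have
  negative second variation on the piece.\<close>

lemma second_variation_zero:
  assumes P: "immersed half_plane P F"
  shows "second_variation \<epsilon> P F 0 = 0"
proof -
  have "0 \<in> normal_space P F p" for p
    by (simp add: normal_space_def orthogonal_comp_def orthogonal_def)
  then have z: "smooth_normal_field P F 0"
    by (simp add: smooth_normal_field_def comp_def smooth_on_const)
  have "variation_density P F 0 p = 0" if "p \<in> topspace P" for p
    using variation_density_support[OF P z] that by simp
  then have "(\<integral>p. variation_density P F 0 p \<partial>area_measure P F) = (\<integral>p. 0 \<partial>area_measure P F)"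
    using volume_measure_sets(1)[OF model_space_half_plane P]
    by (intro Bochner_Integration.integral_cong) (auto simp: area_measure_def)
  then show ?thesis by (simp add: second_variation_def)
qed

text \<open>Negativity is demanded for every nonzero \<open>Y\<close>, even if its restriction were
  0. This excludes a kernel, so restriction preserves independence and the restricted span competes
  in the index with its full dimension.\<close>

lemma index_lower_bound:
  assumes P: "immersed half_plane P F" and B: "fun_vs.independent B" "finite B"
    and neg: "\<And>Y. Y \<in> fun_vs.span B \<Longrightarrow> Y \<noteq> 0 \<Longrightarrow> second_variation \<epsilon> P F (restrict_field P Y) < 0"
    and sec: "\<And>Y. Y \<in> fun_vs.span B \<Longrightarrow> restrict_field P Y \<in> normal_sections P F \<Omega>"
    and \<Omega>: "openin P \<Omega>" "compactin P (P closure_of \<Omega>)"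
  shows "enat (card B) \<le> index \<epsilon> P F"
proof -
  let ?r = "restrict_field P :: ('a \<Rightarrow> real^'b) \<Rightarrow> 'a \<Rightarrow> real^'b"
  let ?s = "\<lambda>(c::real) (Y::'a \<Rightarrow> real^'b) p. c *\<^sub>R Y p"
  interpret r: Vector_Spaces.linear ?s ?s ?r
    by unfold_locales (auto simp: fun_eq_iff restrict_field_def)
  have "inj_on ?r (fun_vs.span B)"
    unfolding r.inj_on_iff_eq_0[OF fun_vs.subspace_span]
  proof (intro ballI impI)
    fix Y assume Y: "Y \<in> fun_vs.span B" "?r Y = 0"
    then show "Y = 0" using neg[of Y] second_variation_zero[OF P, of \<epsilon>] by force
  qed
  then have ind: "fun_vs.independent (?r ` B)" and inj: "inj_on ?r B"
    using r.independent_injective_image[OF B(1)] inj_on_subset fun_vs.span_superset by blast+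
  let ?W = "fun_vs.span (?r ` B)"
  have W: "?W = ?r ` fun_vs.span B" by (rule r.span_image)
  have dim: "fun_vs.dim ?W = card B"
    using fun_vs.dim_span_eq_card_independent[OF ind] card_image[OF inj] by simp
  have "enat (fun_vs.dim ?W) \<le> index_on \<epsilon> P F \<Omega>"
    unfolding index_on_def
  proof (rule Sup_upper, rule CollectI, rule exI[of _ ?W], intro conjI refl)
    show "fun_vs.subspace ?W" by (rule fun_vs.subspace_span)
    show "\<exists>B. finite B \<and> fun_vs.span B = ?W" using B(2) by blast
    show "?W \<subseteq> normal_sections P F \<Omega>" unfolding W using sec by blast
    show "\<forall>Y\<in>?W. Y \<noteq> 0 \<longrightarrow> second_variation \<epsilon> P F Y < 0"
      unfolding W
    proof (intro ballI impI)
      fix Z assume Z: "Z \<in> ?r ` fun_vs.span B" "Z \<noteq> 0"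
      then obtain Y where "Y \<in> fun_vs.span B" "Z = ?r Y" by blast
      moreover then have "Y \<noteq> 0" using Z(2) r.zero by blast
      ultimately show "second_variation \<epsilon> P F Z < 0" using neg by blast
    qed
  qed
  also have "\<dots> \<le> index \<epsilon> P F"
    unfolding index_def using \<Omega> by (intro SUP_upper) simp
  finally show ?thesis unfolding dim .
qed

theorem proposition1p4:
  fixes X :: "'a topology" and F :: "'a \<Rightarrow> real^'n"
  assumes "minimal_surface X F"
    and "surface_boundary X F = {}"
    and "free_boundary_minimal_surface (- ball 0 1) (exterior_piece X F) F"
    and "free_boundary_minimal_surface (cball 0 1) (interior_piece X F) F"
    and "surface_boundary (exterior_piece X F) F = {p \<in> topspace X. F p \<in> sphere 0 1}"
    and "surface_boundary (interior_piece X F) F = {p \<in> topspace X. F p \<in> sphere 0 1}"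
  shows "index (-1) (interior_piece X F) F + index 1 (exterior_piece X F) F \<ge> index 0 X F"
proof -
  define SI where "SI = F -` cball 0 1"
  define SE where "SE = F -` (- ball 0 1)"
  define B where "B = {p \<in> topspace X. F p \<in> sphere 0 1}"
  let ?I = "subtopology X SI" and ?E = "subtopology X SE"
  let ?A = "area_measure X F" and ?L = "volume_measure (UNIV :: (real^1) set) (subtopology X B) F"
  note H = model_space_half_plane and nb = assms(2)
  have pieces: "interior_piece X F = ?I" "exterior_piece X F = ?E"
    by (simp_all add: interior_piece_def exterior_piece_def SI_def SE_def)
  have X: "immersed half_plane X F" using assms(1) by (simp add: minimal_surface_def)
  have I: "immersed half_plane ?I F" and E: "immersed half_plane ?E F"
    using assms(3,4) by (simp_all add: free_boundary_minimal_surface_def minimal_surface_def pieces)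
  have bI: "surface_boundary ?I F = B" and bE: "surface_boundary ?E F = B"
    using assms(5,6) by (simp_all add: pieces B_def)
  have F: "continuous_map X euclidean F" by (rule immersion_continuous[OF X])
  have cl: "closedin X (topspace X \<inter> F -` C)" if "closed C" for C
    using closedin_continuous_map_preimage[OF F, of C] that by (simp add: Int_def vimage_def)
  have cI: "closedin X (topspace X \<inter> SI)" and cE: "closedin X (topspace X \<inter> SE)"
    unfolding SI_def SE_def by (auto intro!: cl)
  have cB: "closedin X B" using cl[of "sphere 0 1"] by (simp add: B_def Int_def vimage_def)
  have BI: "B \<subseteq> topspace X \<inter> SI" and BE: "B \<subseteq> topspace X \<inter> SE"
    by (auto simp: B_def SI_def SE_def)
  have cover: "topspace X \<inter> SI \<inter> (topspace X \<inter> SE) = B" "topspace X \<inter> SI \<union> topspace X \<inter> SE = topspace X"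
    by (auto simp: B_def SI_def SE_def)
  have sp: "space ?A = topspace X" "sets ?A = borel_sets X"
    using volume_measure_sets[OF H X] by (simp_all add: area_measure_def)
  have TI: "topspace X \<inter> SI \<in> sets ?A" and TE: "topspace X \<inter> SE \<in> sets ?A"
    using cI cE sp(2) closedin_borel_sets by blast+
  \<comment> \<open>\<open>B\<close> consists of boundary points of the pieces, not of
    \<open>X\<close>. So it is shown to be null for the area of \<open>?I\<close> first, and this
    area is a restriction of \<open>?A\<close>.\<close>
  have null: "B \<in> null_sets ?A"
  proof -
    have T: "topspace X \<inter> SI \<in> borel_sets X" using cI by (rule closedin_borel_sets)
    have "closedin ?I B" using cB BI by (simp add: closedin_subset_topspace)
    then have "B \<in> null_sets (area_measure ?I F)"
      using surface_boundary_null[OF I] closedin_borel_sets[of ?I B] unfolding bI by blast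
    moreover have "area_measure ?I F = restrict_space ?A (topspace X \<inter> SI)"
      unfolding area_measure_def by (rule volume_measure_subtopology[OF H X I T])
    ultimately have "emeasure (restrict_space ?A (topspace X \<inter> SI)) B = 0" by (simp add: null_sets_def)
    then have "emeasure ?A B = 0" using TI BI sp by (subst (asm) emeasure_restrict_space) (auto simp: Int_absorb2)
    then show ?thesis using closedin_borel_sets[OF cB] sp(2) by (simp add: null_sets_def)
  qed
  have imB: "immersed (UNIV :: (real^1) set) (subtopology X B) F"
  proof -
    have "subtopology ?I B = subtopology X B" using BI by (simp add: subtopology_subtopology Int_absorb1)
    then show ?thesis using immersed_boundary[OF I] by (simp add: bI)
  qed
  have main: "enat (fun_vs.dim W) \<le> index (-1) ?I F + index 1 ?E F"
    if \<Omega>: "openin X \<Omega>" "compactin X (X closure_of \<Omega>)"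
      and W: "fun_vs.subspace W" "finite B0" "fun_vs.span B0 = W" "W \<subseteq> normal_sections X F \<Omega>"
      and neg: "\<And>Y. Y \<in> W \<Longrightarrow> Y \<noteq> 0 \<Longrightarrow> second_variation 0 X F Y < 0" for \<Omega> W B0
  proof -
    let ?K = "X closure_of \<Omega>"
    have WY: "smooth_normal_field X F Y" and supp: "X closure_of {p \<in> topspace X. Y p \<noteq> 0} \<subseteq> \<Omega>" if "Y \<in> W" for Y
    proof -
      have "Y \<in> normal_sections X F \<Omega>" using W(4) that by blast
      then show "smooth_normal_field X F Y" "X closure_of {p \<in> topspace X. Y p \<noteq> 0} \<subseteq> \<Omega>"
        by (simp_all add: normal_sections_iff)
    qed
    have \<Omega>K: "\<Omega> \<subseteq> ?K" using closure_of_subset openin_subset[OF \<Omega>(1)] by blast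
    \<comment> \<open>The density is continuous and vanishes off the compact closure of
      \<open>\<Omega>\<close>.\<close>
    have intA: "integrable ?A (variation_density X F Y)" if Y: "Y \<in> W" for Y
      unfolding area_measure_def
    proof (rule integrable_volume_measure[OF H X continuous_map_variation_density[OF X WY[OF Y]] \<Omega>(2)])
      fix p assume "p \<in> topspace X - ?K"
      then show "variation_density X F Y p = 0"
        using supp[OF Y] \<Omega>K by (intro variation_density_support[OF X WY[OF Y]]) blast
    qed
    have intL: "integrable ?L (\<lambda>p. (norm (Y p))\<^sup>2)" if Y: "Y \<in> W" for Y
    proof (rule integrable_volume_measure[OF model_space_UNIV imB])
      have "continuous_map X euclidean Y" by (rule smooth_normal_field_continuous[OF X WY[OF Y]])
      then have "continuous_map (subtopology X B) euclidean Y" by (rule continuous_map_from_subtopology)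
      then show "continuous_map (subtopology X B) euclidean (\<lambda>p. (norm (Y p))\<^sup>2)"
        by (intro continuous_intros)
      show "compactin (subtopology X B) (B \<inter> ?K)"
        using closed_Int_compactin[OF cB \<Omega>(2)] by (simp add: compactin_subtopology)
      fix p assume "p \<in> topspace (subtopology X B) - B \<inter> ?K"
      then have "p \<in> topspace X" "p \<notin> \<Omega>" using \<Omega>K by auto
      moreover have "{p \<in> topspace X. Y p \<noteq> 0} \<subseteq> \<Omega>"
        using supp[OF Y] closure_of_subset[of "{p \<in> topspace X. Y p \<noteq> 0}" X] by blast
      ultimately show "(norm (Y p))\<^sup>2 = 0" by auto
    qed
    define aI where "aI Y = (\<integral>p. indicator (topspace X \<inter> SI) p * variation_density X F Y p \<partial>?A)" for Y
    define aE where "aE Y = (\<integral>p. indicator (topspace X \<inter> SE) p * variation_density X F Y p \<partial>?A)" for Y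
    define b where "b Y = (\<integral>p. (norm (Y p))\<^sup>2 \<partial>?L)" for Y :: "'a \<Rightarrow> real^'n"
    \<comment> \<open>The sign of \<open>b\<close> is the coefficient \<open>\<epsilon>\<close> of
      the respective piece.\<close>
    define q where "q Y = aI Y - b Y" for Y
    define r where "r Y = aE Y + b Y" for Y
    have q: "second_variation (-1) ?I F (restrict_field ?I Y) = q Y" if "Y \<in> W" for Y
      using second_variation_restrict[OF X nb WY[OF that] I cI bI BI, of "-1"] by (simp add: q_def aI_def b_def)
    have r: "second_variation 1 ?E F (restrict_field ?E Y) = r Y" if "Y \<in> W" for Y
      using second_variation_restrict[OF X nb WY[OF that] E cE bE BE, of 1] by (simp add: r_def aE_def b_def)
    have qr: "q Y + r Y = second_variation 0 X F Y" if Y: "Y \<in> W" for Y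
    proof -
      let ?d = "variation_density X F Y"
      have iI: "integrable ?A (\<lambda>p. indicator (topspace X \<inter> SI) p * ?d p)"
        and iE: "integrable ?A (\<lambda>p. indicator (topspace X \<inter> SE) p * ?d p)"
        using integrable_mult_indicator[OF TI intA[OF Y]] integrable_mult_indicator[OF TE intA[OF Y]] by simp_all
      \<comment> \<open>Off \<open>B\<close> exactly one of the two indicators is 1; on
        \<open>B\<close> both are, so the identity holds only almost everywhere.\<close>
      have "(\<integral>p. ?d p \<partial>?A) = (\<integral>p. indicator (topspace X \<inter> SI) p * ?d p + indicator (topspace X \<inter> SE) p * ?d p \<partial>?A)"
      proof (rule integral_cong_AE)
        show "?d \<in> borel_measurable ?A" using intA[OF Y] by simp
        show "(\<lambda>p. indicator (topspace X \<inter> SI) p * ?d p + indicator (topspace X \<inter> SE) p * ?d p) \<in> borel_measurable ?A"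
          using iI iE by simp
        have "AE p in ?A. p \<notin> B" using null by (rule AE_not_in)
        then show "AE p in ?A. ?d p = indicator (topspace X \<inter> SI) p * ?d p + indicator (topspace X \<inter> SE) p * ?d p"
          using AE_space
        proof eventually_elim
          case (elim p)
          then show ?case using cover sp(1) by (auto simp: indicator_def)
        qed
      qed
      also have "\<dots> = aI Y + aE Y" unfolding aI_def aE_def by (rule Bochner_Integration.integral_add[OF iI iE])
      finally show ?thesis by (simp add: second_variation_def q_def r_def)
    qed
    have quad: "fun_quad.quadratic_on W q"
      unfolding q_def[abs_def] aI_def b_def
    proof (intro fun_quad.quadratic_on_diff fun_quad.quadratic_on_integral[OF W(1)])
      fix p assume "p \<in> space ?A"
      then have "fun_quad.quadratic_on W (\<lambda>Y. variation_density X F Y p)"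
        using variation_density_quadratic[OF X W(1) WY] sp(1) by blast
      then show "fun_quad.quadratic_on W (\<lambda>Y. indicator (topspace X \<inter> SI) p * variation_density X F Y p)"
        by (cases "p \<in> topspace X \<inter> SI") (auto simp: fun_quad.quadratic_on_def fun_quad.polar_def)
    next
      fix Y assume "Y \<in> W"
      then show "integrable ?A (\<lambda>p. indicator (topspace X \<inter> SI) p * variation_density X F Y p)"
        using integrable_mult_indicator[OF TI intA] by simp
    next
      fix p
      show "fun_quad.quadratic_on W (\<lambda>Y. (norm (Y p))\<^sup>2)"
        by (rule fun_quad.quadratic_on_compose_linear[OF _ _ power2_norm_eq_inner bounded_bilinear_inner W(1)]) auto
    qed (rule intL)
    have "\<forall>Y\<in>W. Y \<noteq> 0 \<longrightarrow> q Y + r Y < 0" using neg qr by simp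
    from fun_quad.negative_definite_split[OF W(1-3) quad this]
    obtain B1 B2 where B12: "fun_vs.independent B1" "fun_vs.independent B2" "finite B1" "finite B2"
      "B1 \<subseteq> W" "B2 \<subseteq> W" "fun_vs.dim W \<le> card B1 + card B2"
      "\<forall>Y\<in>fun_vs.span B1. Y \<noteq> 0 \<longrightarrow> q Y < 0" "\<forall>Y\<in>fun_vs.span B2. Y \<noteq> 0 \<longrightarrow> r Y < 0"
      by (elim exE conjE)
    have s1: "fun_vs.span B1 \<subseteq> W" and s2: "fun_vs.span B2 \<subseteq> W"
      using fun_vs.span_minimal[OF B12(5) W(1)] fun_vs.span_minimal[OF B12(6) W(1)] by blast+
    \<comment> \<open>The trace of \<open>\<Omega>\<close> is an admissible domain of the piece:
      because the piece is closed in \<open>X\<close>, the relative closure is a closed subset of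
      the compact closure of \<open>\<Omega>\<close>.\<close>
    have dom: "openin (subtopology X S) (\<Omega> \<inter> S)"
      "compactin (subtopology X S) (subtopology X S closure_of (\<Omega> \<inter> S))" if S: "closedin X (topspace X \<inter> S)" for S
    proof -
      show "openin (subtopology X S) (\<Omega> \<inter> S)" using \<Omega>(1) by (auto simp: openin_subtopology)
      let ?C = "subtopology X S closure_of (\<Omega> \<inter> S)"
      have "?C \<subseteq> X closure_of (\<Omega> \<inter> S)" by (rule closure_of_subtopology_subset)
      also have "\<dots> \<subseteq> ?K" by (rule closure_of_mono) simp
      finally have CK: "?C \<subseteq> ?K" .
      have "closedin (subtopology X (topspace X \<inter> S)) ?C"
        by (simp only: subtopology_restrict closedin_closure_of)
      then have "closedin X ?C" using S by (rule closedin_trans_full)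
      then have "compactin X ?C" using closed_compactin[OF \<Omega>(2) CK] by simp
      moreover have "?C \<subseteq> S" using closure_of_subset_topspace[of "subtopology X S" "\<Omega> \<inter> S"] by auto
      ultimately show "compactin (subtopology X S) ?C" by (simp add: compactin_subtopology)
    qed
    have "enat (card B1) \<le> index (-1) ?I F"
    proof (rule index_lower_bound[OF I B12(1,3) _ _ dom[OF cI]])
      show "second_variation (-1) ?I F (restrict_field ?I Y) < 0" if "Y \<in> fun_vs.span B1" "Y \<noteq> 0" for Y
        using B12(8) that q s1 by auto
      show "restrict_field ?I Y \<in> normal_sections ?I F (\<Omega> \<inter> SI)" if "Y \<in> fun_vs.span B1" for Y
        using that s1 W(4) by (intro restrict_field_normal_sections[OF X nb]) blast
    qed
    moreover have "enat (card B2) \<le> index 1 ?E F"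
    proof (rule index_lower_bound[OF E B12(2,4) _ _ dom[OF cE]])
      show "second_variation 1 ?E F (restrict_field ?E Y) < 0" if "Y \<in> fun_vs.span B2" "Y \<noteq> 0" for Y
        using B12(9) that r s2 by auto
      show "restrict_field ?E Y \<in> normal_sections ?E F (\<Omega> \<inter> SE)" if "Y \<in> fun_vs.span B2" for Y
        using that s2 W(4) by (intro restrict_field_normal_sections[OF X nb]) blast
    qed
    ultimately have "enat (card B1 + card B2) \<le> index (-1) ?I F + index 1 ?E F"
      unfolding plus_enat_simps(1)[symmetric] by (rule add_mono)
    with B12(7) show ?thesis by (meson enat_ord_simps(1) order_trans)
  qed
  show ?thesis
    unfolding pieces index_def[of 0]
  proof (rule SUP_least)
    fix \<Omega> assume \<Omega>: "\<Omega> \<in> {\<Omega>. openin X \<Omega> \<and> compactin X (X closure_of \<Omega>)}"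
    show "index_on 0 X F \<Omega> \<le> index (-1) ?I F + index 1 ?E F"
      unfolding index_on_def
    proof (rule Sup_least)
      fix n assume "n \<in> {enat (fun_vs.dim W) | W.
       fun_vs.subspace W \<and> (\<exists>B. finite B \<and> fun_vs.span B = W) \<and>
       W \<subseteq> normal_sections X F \<Omega> \<and> (\<forall>Y\<in>W. Y \<noteq> 0 \<longrightarrow> second_variation 0 X F Y < 0)}"
      then obtain W B0 where n: "n = enat (fun_vs.dim W)" and W: "fun_vs.subspace W" "finite B0"
        "fun_vs.span B0 = W" "W \<subseteq> normal_sections X F \<Omega>"
        and neg: "\<forall>Y\<in>W. Y \<noteq> 0 \<longrightarrow> second_variation 0 X F Y < 0"
        by (elim CollectE exE conjE)
      have "openin X \<Omega>" "compactin X (X closure_of \<Omega>)" using \<Omega> by simp_all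
      then show "n \<le> index (-1) ?I F + index 1 ?E F"
        unfolding n by (rule main[OF _ _ W]) (use neg in blast)
    qed
  qed
qed

end
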